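(* Let $N\ge 1$ be an integer and let $\mathcal B_{\mathbb C}(N)$ be the specialized B-web category. There is a monoidal functor $\mathcal F_N:\mathcal B_{\mathbb C}(N)\to \mathfrak{so}_N\text{-mod}$ which sends the object $a$ to $\bigwedge^aV$ for each $a\ge 1$, and sends the generating morphisms as follows ($a,b\ge1$). (i) The merge $m_{a,b}$ is sent to the map $\bigwedge^aV\otimes\bigwedge^bV\to\bigwedge^{a+b}V$, $\ v_{i_1}\wedge\cdots\wedge v_{i_a}\otimes v_{i_{a+1}}\wedge\cdots\wedge v_{i_{a+b}}\mapsto v_{i_1}\wedge\cdots\wedge v_{i_{a+b}}$. (ii) The split $s_{a,b}$ is sent to the map $\bigwedge^{a+b}V\to\bigwedge^aV\otimes\bigwedge^bV$, $$v_{i_1}\wedge\cdots\wedge v_{i_{a+b}}\mapsto\sum_w(-1)^{\ell(w)}v_{i_{w(1)}}\wedge\cdots\wedge v_{i_{w(a)}}\otimes v_{i_{w(a+1)}}\wedge\cdots\wedge v_{i_{w(a+b)}},$$ where $w$ runs over the minimal length representatives of the cosets $\mathfrak S_{a+b}/(\mathfrak S_a\times\mathfrak S_b)$. (iii) The crossing $c_{a,b}$ is sent to $\bigwedge^aV\otimes\bigwedge^bV\to\bigwedge^bV\otimes\bigwedge^aV$, $\ y\otimes z\mapsto(-1)^{ab}z\otimes y$. (iv) The cap $\cap_a$ is sent to the map $\bigwedge^aV\otimes\bigwedge^aV\to\mathbb C$, $\ v_{i_1}\wedge\cdots\wedge v_{i_a}\otimes v_{j_a}\wedge\cdots\wedge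 v_{j_1}\mapsto\prod_{k=1}^a\delta_{i_k,-j_k}$ for $i_1<\cdots<i_a$ and $j_1>\cdots>j_a$. (v) The cup $\cup_a$ is sent to the map $\mathbb C\to\bigwedge^aV\otimes\bigwedge^aV$, $\ 1\mapsto\sum_{i_1<\cdots<i_a}v_{i_1}\wedge\cdots\wedge v_{i_a}\otimes v_{-i_a}\wedge\cdots\wedge v_{-i_1}$.
   Context: The finite B-web category. Let $\mathbb J=\{f\in\mathbb Q[x]: f(n)\in\mathbb Z\ \text{for all } n\in\mathbb Z\}$. The B-web category $\mathcal B$ is the strict $\mathbb J$-linear monoidal category with unit object $\mathbf 1$, generating objects $a\in\mathbb Z_{\ge1}$, and generating morphisms (for $a,b\ge1$): merges $m_{a,b}:a\otimes b\to a+b$, splits $s_{a,b}:a+b\to a\otimes b$, crossings $c_{a,b}:a\otimes b\to b\otimes a$, cups $\cup_a:\mathbf 1\to a\otimes a$, caps $\cap_a:a\otimes a\to\mathbf 1$. Composition is written $fg=f\circ g$, and $1_a$ is the identity of $a$. Strands of thickness $0$ are omitted: the object $0$ is $\mathbf 1$, and $m_{0,a},m_{a,0},s_{0,a},s_{a,0},c_{0,a},c_{a,0}$ are $1_a$, while $\cup_0,\cap_0$ are $1_{\mathbf 1}$. The relations are, for all positive labels: (W1) $m_{a+b,c}(m_{a,b}\otimes1_c)=m_{a,b+c}(1_a\otimes m_{b,c})$ and $(s_{a,b}\otimes1_c)s_{a+b,c}=(1_a\otimes s_{b,c})s_{a,b+c}$. (W2) $m_{a,b}s_{a,b}=\binom{a+b}{a}1_{a+b}$;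 and, for $a+c=b+d$, $s_{b,d}m_{a,c}=\sum(m_{s,c-t}\otimes m_{a-s,t})(1_s\otimes c_{a-s,c-t}\otimes1_t)(s_{s,a-s}\otimes s_{c-t,t})$, summed over $0\le s\le\min(a,b)$, $0\le t\le\min(c,d)$ with $t-s=d-a$. (W3) $(\cap_a\otimes1_a)(1_a\otimes\cup_a)=1_a=(1_a\otimes\cap_a)(\cup_a\otimes1_a)$; $(\cap_a\otimes1_b)(1_a\otimes c_{b,a})=(1_b\otimes\cap_a)(c_{a,b}\otimes1_a)$; $(c_{b,a}\otimes1_a)(1_b\otimes\cup_a)=(1_a\otimes c_{a,b})(\cup_a\otimes1_b)$. (W4) $\cap_b(1_b\otimes\cap_a\otimes1_b)(s_{b,a}\otimes1_a\otimes1_b)=\cap_{a+b}(1_{a+b}\otimes m_{a,b})$; $\cap_a(1_a\otimes\cap_b\otimes1_a)(1_a\otimes1_b\otimes s_{b,a})=\cap_{a+b}(m_{a,b}\otimes1_{a+b})$. (W5) $\cap_a\cup_a=\binom xa$; $\cap_as_{a,a}=0$; $\cap_ac_{a,a}=(-1)^a\cap_a$. Specialization. $\mathcal B_{\mathbb C}(N)=\mathcal B\otimes_{\mathbb J}\mathbb C$ along $\mathbb J\to\mathbb C$, $f\mapsto f(N)$; i.e. the $\mathbb C$-linear strict monoidal category with the same presentation with $x$ replaced by $N$. Lie algebra. Put $[N]=\{-n,\dots,-1,0,1,\dots,n\}$ if $N=2n+1$ and $[N]=\{-n,\dots,-1,1,\dots,n\}$ if $N=2n$. $V$ is the $N$-dimensional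 complex vector space with basis $\{v_i\mid i\in[N]\}$ and symmetric bilinear form $(v_i,v_j)=\delta_{i,-j}$; $\mathfrak{so}_N=\{g\in\mathrm{End}(V):(gy,z)+(y,gz)=0\ \forall y,z\in V\}$. $\mathfrak{so}_N$-mod is the monoidal category of finite-dimensional $\mathfrak{so}_N$-modules. $\ell$ is the length function on symmetric groups. *)

theory Defs
  imports
    Complex_Main
    "HOL-Library.FuncSet"
    "HOL-Library.Function_Algebras"
    "HOL-Combinatorics.Permutations"
begin

section \<open>Linear monoidal categories and functors\<close>

record ('o, 'm) lmcat =
  Ob :: "'o set"
  Arrows :: "'o \<Rightarrow> 'o \<Rightarrow> 'm set"
  ide :: "'o \<Rightarrow> 'm"
  cmp :: "'m \<Rightarrow> 'm \<Rightarrow> 'm"  (infixl "\<cdot>\<index>" 70)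
  zero_ar :: "'o \<Rightarrow> 'o \<Rightarrow> 'm"
  add_ar :: "'m \<Rightarrow> 'm \<Rightarrow> 'm"  (infixl "\<oplus>\<index>" 65)
  scale_ar :: "complex \<Rightarrow> 'm \<Rightarrow> 'm"
  tensor_ob :: "'o \<Rightarrow> 'o \<Rightarrow> 'o"  (infixl "\<odot>\<index>" 75)
  tensor_ar :: "'m \<Rightarrow> 'm \<Rightarrow> 'm"  (infixl "\<otimes>\<index>" 75)
  unit_ob :: "'o"
  assoc :: "'o \<Rightarrow> 'o \<Rightarrow> 'o \<Rightarrow> 'm"
  lunit :: "'o \<Rightarrow> 'm"
  runit :: "'o \<Rightarrow> 'm"

definition iso_ar :: "('o, 'm) lmcat \<Rightarrow> 'o \<Rightarrow> 'o \<Rightarrow> 'm \<Rightarrow> bool" where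
  "iso_ar C x y f \<longleftrightarrow> f \<in> Arrows C x y \<and>
     (\<exists>g \<in> Arrows C y x. cmp C g f = ide C x \<and> cmp C f g = ide C y)"

locale linear_monoidal_category =
  fixes C :: "('o, 'm) lmcat" (structure)
  assumes ide_in: "x \<in> Ob C \<Longrightarrow> ide C x \<in> Arrows C x x"
    and cmp_in: "\<lbrakk>x \<in> Ob C; y \<in> Ob C; z \<in> Ob C; f \<in> Arrows C y z; g \<in> Arrows C x y\<rbrakk>
      \<Longrightarrow> f \<cdot> g \<in> Arrows C x z"
    and cmp_ide: "\<lbrakk>x \<in> Ob C; y \<in> Ob C; f \<in> Arrows C x y\<rbrakk>
      \<Longrightarrow> ide C y \<cdot> f = f \<and> f \<cdot> ide C x = f"
    and cmp_assoc: "\<lbrakk>w \<in> Ob C; x \<in> Ob C; y \<in> Ob C; z \<in> Ob C;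
        f \<in> Arrows C y z; g \<in> Arrows C x y; h \<in> Arrows C w x\<rbrakk>
      \<Longrightarrow> (f \<cdot> g) \<cdot> h = f \<cdot> (g \<cdot> h)"
    and zero_in: "\<lbrakk>x \<in> Ob C; y \<in> Ob C\<rbrakk> \<Longrightarrow> zero_ar C x y \<in> Arrows C x y"
    and add_in: "\<lbrakk>x \<in> Ob C; y \<in> Ob C; f \<in> Arrows C x y; g \<in> Arrows C x y\<rbrakk>
      \<Longrightarrow> f \<oplus> g \<in> Arrows C x y"
    and scale_in: "\<lbrakk>x \<in> Ob C; y \<in> Ob C; f \<in> Arrows C x y\<rbrakk>
      \<Longrightarrow> scale_ar C c f \<in> Arrows C x y"
    and add_assoc: "\<lbrakk>x \<in> Ob C; y \<in> Ob C; f \<in> Arrows C x y; g \<in> Arrows C x y; h \<in> Arrows C x y\<rbrakk>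
      \<Longrightarrow> (f \<oplus> g) \<oplus> h = f \<oplus> (g \<oplus> h)"
    and add_comm: "\<lbrakk>x \<in> Ob C; y \<in> Ob C; f \<in> Arrows C x y; g \<in> Arrows C x y\<rbrakk>
      \<Longrightarrow> f \<oplus> g = g \<oplus> f"
    and add_zero: "\<lbrakk>x \<in> Ob C; y \<in> Ob C; f \<in> Arrows C x y\<rbrakk> \<Longrightarrow> f \<oplus> zero_ar C x y = f"
    and add_inverse: "\<lbrakk>x \<in> Ob C; y \<in> Ob C; f \<in> Arrows C x y\<rbrakk>
      \<Longrightarrow> f \<oplus> scale_ar C (-1) f = zero_ar C x y"
    and scale_one: "\<lbrakk>x \<in> Ob C; y \<in> Ob C; f \<in> Arrows C x y\<rbrakk> \<Longrightarrow> scale_ar C 1 f = f"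
    and scale_scale: "\<lbrakk>x \<in> Ob C; y \<in> Ob C; f \<in> Arrows C x y\<rbrakk>
      \<Longrightarrow> scale_ar C c (scale_ar C d f) = scale_ar C (c * d) f"
    and scale_add_left: "\<lbrakk>x \<in> Ob C; y \<in> Ob C; f \<in> Arrows C x y\<rbrakk>
      \<Longrightarrow> scale_ar C (c + d) f = scale_ar C c f \<oplus> scale_ar C d f"
    and scale_add_right: "\<lbrakk>x \<in> Ob C; y \<in> Ob C; f \<in> Arrows C x y; g \<in> Arrows C x y\<rbrakk>
      \<Longrightarrow> scale_ar C c (f \<oplus> g) = scale_ar C c f \<oplus> scale_ar C c g"
    and cmp_add_left: "\<lbrakk>x \<in> Ob C; y \<in> Ob C; z \<in> Ob C;
        f \<in> Arrows C y z; g \<in> Arrows C y z; h \<in> Arrows C x y\<rbrakk>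
      \<Longrightarrow> (f \<oplus> g) \<cdot> h = (f \<cdot> h) \<oplus> (g \<cdot> h)"
    and cmp_add_right: "\<lbrakk>x \<in> Ob C; y \<in> Ob C; z \<in> Ob C;
        f \<in> Arrows C y z; g \<in> Arrows C x y; h \<in> Arrows C x y\<rbrakk>
      \<Longrightarrow> f \<cdot> (g \<oplus> h) = (f \<cdot> g) \<oplus> (f \<cdot> h)"
    and cmp_scale: "\<lbrakk>x \<in> Ob C; y \<in> Ob C; z \<in> Ob C; f \<in> Arrows C y z; g \<in> Arrows C x y\<rbrakk>
      \<Longrightarrow> scale_ar C c f \<cdot> g = scale_ar C c (f \<cdot> g)
        \<and> f \<cdot> scale_ar C c g = scale_ar C c (f \<cdot> g)"
    and unit_in: "unit_ob C \<in> Ob C"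
    and tensor_ob_in: "\<lbrakk>x \<in> Ob C; y \<in> Ob C\<rbrakk> \<Longrightarrow> x \<odot> y \<in> Ob C"
    and tensor_in: "\<lbrakk>x \<in> Ob C; x' \<in> Ob C; y \<in> Ob C; y' \<in> Ob C;
        f \<in> Arrows C x x'; g \<in> Arrows C y y'\<rbrakk>
      \<Longrightarrow> f \<otimes> g \<in> Arrows C (x \<odot> y) (x' \<odot> y')"
    and tensor_ide: "\<lbrakk>x \<in> Ob C; y \<in> Ob C\<rbrakk> \<Longrightarrow> ide C x \<otimes> ide C y = ide C (x \<odot> y)"
    and interchange: "\<lbrakk>x \<in> Ob C; x' \<in> Ob C; x'' \<in> Ob C; y \<in> Ob C; y' \<in> Ob C; y'' \<in> Ob C;
        f \<in> Arrows C x' x''; h \<in> Arrows C x x'; g \<in> Arrows C y' y''; k \<in> Arrows C y y'\<rbrakk>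
      \<Longrightarrow> (f \<otimes> g) \<cdot> (h \<otimes> k) = (f \<cdot> h) \<otimes> (g \<cdot> k)"
    and tensor_add_left: "\<lbrakk>x \<in> Ob C; x' \<in> Ob C; y \<in> Ob C; y' \<in> Ob C;
        f \<in> Arrows C x x'; g \<in> Arrows C x x'; h \<in> Arrows C y y'\<rbrakk>
      \<Longrightarrow> (f \<oplus> g) \<otimes> h = (f \<otimes> h) \<oplus> (g \<otimes> h)"
    and tensor_add_right: "\<lbrakk>x \<in> Ob C; x' \<in> Ob C; y \<in> Ob C; y' \<in> Ob C;
        f \<in> Arrows C x x'; g \<in> Arrows C y y'; h \<in> Arrows C y y'\<rbrakk>
      \<Longrightarrow> f \<otimes> (g \<oplus> h) = (f \<otimes> g) \<oplus> (f \<otimes> h)"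
    and tensor_scale: "\<lbrakk>x \<in> Ob C; x' \<in> Ob C; y \<in> Ob C; y' \<in> Ob C;
        f \<in> Arrows C x x'; g \<in> Arrows C y y'\<rbrakk>
      \<Longrightarrow> scale_ar C c f \<otimes> g = scale_ar C c (f \<otimes> g)
        \<and> f \<otimes> scale_ar C c g = scale_ar C c (f \<otimes> g)"
    and assoc_iso: "\<lbrakk>x \<in> Ob C; y \<in> Ob C; z \<in> Ob C\<rbrakk>
      \<Longrightarrow> iso_ar C ((x \<odot> y) \<odot> z) (x \<odot> (y \<odot> z)) (assoc C x y z)"
    and lunit_iso: "x \<in> Ob C \<Longrightarrow> iso_ar C (unit_ob C \<odot> x) x (lunit C x)"
    and runit_iso: "x \<in> Ob C \<Longrightarrow> iso_ar C (x \<odot> unit_ob C) x (runit C x)"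
    and assoc_natural: "\<lbrakk>x \<in> Ob C; x' \<in> Ob C; y \<in> Ob C; y' \<in> Ob C; z \<in> Ob C; z' \<in> Ob C;
        f \<in> Arrows C x x'; g \<in> Arrows C y y'; h \<in> Arrows C z z'\<rbrakk>
      \<Longrightarrow> assoc C x' y' z' \<cdot> ((f \<otimes> g) \<otimes> h) = (f \<otimes> (g \<otimes> h)) \<cdot> assoc C x y z"
    and lunit_natural: "\<lbrakk>x \<in> Ob C; y \<in> Ob C; f \<in> Arrows C x y\<rbrakk>
      \<Longrightarrow> lunit C y \<cdot> (ide C (unit_ob C) \<otimes> f) = f \<cdot> lunit C x"
    and runit_natural: "\<lbrakk>x \<in> Ob C; y \<in> Ob C; f \<in> Arrows C x y\<rbrakk>
      \<Longrightarrow> runit C y \<cdot> (f \<otimes> ide C (unit_ob C)) = f \<cdot> runit C x"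
    and pentagon: "\<lbrakk>w \<in> Ob C; x \<in> Ob C; y \<in> Ob C; z \<in> Ob C\<rbrakk>
      \<Longrightarrow> assoc C w x (y \<odot> z) \<cdot> assoc C (w \<odot> x) y z =
          (ide C w \<otimes> assoc C x y z) \<cdot> assoc C w (x \<odot> y) z \<cdot> (assoc C w x y \<otimes> ide C z)"
    and triangle: "\<lbrakk>x \<in> Ob C; y \<in> Ob C\<rbrakk>
      \<Longrightarrow> (ide C x \<otimes> lunit C y) \<cdot> assoc C x (unit_ob C) y = runit C x \<otimes> ide C y"

record ('o, 'm, 'p, 'q) mfunctor =
  F_ob :: "'o \<Rightarrow> 'p"
  F_ar :: "'m \<Rightarrow> 'q"
  F_mult :: "'o \<Rightarrow> 'o \<Rightarrow> 'q"
  F_unit :: "'q"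

text \<open>
  \<open>F_mult F x y : F x \<otimes> F y \<rightarrow> F (x \<otimes> y)\<close> and \<open>F_unit F : \<one> \<rightarrow> F \<one>\<close> are the
  structure isomorphisms of the (strong) monoidal functor \<open>F\<close>.
\<close>

locale linear_monoidal_functor =
  C: linear_monoidal_category C + D: linear_monoidal_category D
  for C :: "('o, 'm) lmcat" and D :: "('p, 'q) lmcat" +
  fixes F :: "('o, 'm, 'p, 'q) mfunctor"
  assumes F_ob_in: "x \<in> Ob C \<Longrightarrow> F_ob F x \<in> Ob D"
    and F_ar_in: "\<lbrakk>x \<in> Ob C; y \<in> Ob C; f \<in> Arrows C x y\<rbrakk>
      \<Longrightarrow> F_ar F f \<in> Arrows D (F_ob F x) (F_ob F y)"
    and F_ide: "x \<in> Ob C \<Longrightarrow> F_ar F (ide C x) = ide D (F_ob F x)"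
    and F_cmp: "\<lbrakk>x \<in> Ob C; y \<in> Ob C; z \<in> Ob C; f \<in> Arrows C y z; g \<in> Arrows C x y\<rbrakk>
      \<Longrightarrow> F_ar F (cmp C f g) = cmp D (F_ar F f) (F_ar F g)"
    and F_add: "\<lbrakk>x \<in> Ob C; y \<in> Ob C; f \<in> Arrows C x y; g \<in> Arrows C x y\<rbrakk>
      \<Longrightarrow> F_ar F (add_ar C f g) = add_ar D (F_ar F f) (F_ar F g)"
    and F_scale: "\<lbrakk>x \<in> Ob C; y \<in> Ob C; f \<in> Arrows C x y\<rbrakk>
      \<Longrightarrow> F_ar F (scale_ar C c f) = scale_ar D c (F_ar F f)"
    and F_unit_iso: "iso_ar D (unit_ob D) (F_ob F (unit_ob C)) (F_unit F)"
    and F_mult_iso: "\<lbrakk>x \<in> Ob C; y \<in> Ob C\<rbrakk>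
      \<Longrightarrow> iso_ar D (tensor_ob D (F_ob F x) (F_ob F y)) (F_ob F (tensor_ob C x y)) (F_mult F x y)"
    and F_mult_natural: "\<lbrakk>x \<in> Ob C; x' \<in> Ob C; y \<in> Ob C; y' \<in> Ob C;
        f \<in> Arrows C x x'; g \<in> Arrows C y y'\<rbrakk>
      \<Longrightarrow> cmp D (F_mult F x' y') (tensor_ar D (F_ar F f) (F_ar F g)) =
          cmp D (F_ar F (tensor_ar C f g)) (F_mult F x y)"
    and F_mult_assoc: "\<lbrakk>x \<in> Ob C; y \<in> Ob C; z \<in> Ob C\<rbrakk>
      \<Longrightarrow> cmp D (F_ar F (assoc C x y z))
            (cmp D (F_mult F (tensor_ob C x y) z) (tensor_ar D (F_mult F x y) (ide D (F_ob F z)))) =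
          cmp D (F_mult F x (tensor_ob C y z))
            (cmp D (tensor_ar D (ide D (F_ob F x)) (F_mult F y z))
              (assoc D (F_ob F x) (F_ob F y) (F_ob F z)))"
    and F_lunit: "x \<in> Ob C
      \<Longrightarrow> cmp D (F_ar F (lunit C x))
            (cmp D (F_mult F (unit_ob C) x) (tensor_ar D (F_unit F) (ide D (F_ob F x)))) =
          lunit D (F_ob F x)"
    and F_runit: "x \<in> Ob C
      \<Longrightarrow> cmp D (F_ar F (runit C x))
            (cmp D (F_mult F x (unit_ob C)) (tensor_ar D (ide D (F_ob F x)) (F_unit F))) =
          runit D (F_ob F x)"


section \<open>The specialized B-web category\<close>

text \<open>
  Objects are words in the positive integers; the empty word is the unit object.
  Morphisms are terms in the generators modulo the smallest congruence containing the axioms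
  of a complex-linear strict monoidal category and the B-web relations. The circle value
  \<open>of_nat N gchoose a\<close> is the integer-valued polynomial \<open>x gchoose a\<close> specialized at \<open>x = N\<close>.
\<close>

datatype web =
    Ident "nat list"
  | Merge nat nat
  | Split nat nat
  | Cross nat nat
  | Cup nat
  | Cap nat
  | Comp web web  (infixl "\<odot>\<odot>" 70)
  | Tens web web  (infixl "\<otimes>\<otimes>" 75)
  | Zero "nat list" "nat list"
  | Add web web  (infixl "\<oplus>\<oplus>" 65)
  | Scale complex web

definition web_ob :: "nat list set" where
  "web_ob = {x. \<forall>a\<in>set x. a \<ge> 1}"

primrec web_dom :: "web \<Rightarrow> nat list" where
  "web_dom (Ident x) = x"
| "web_dom (Merge a b) = [a, b]"
| "web_dom (Split a b) = [a + b]"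
| "web_dom (Cross a b) = [a, b]"
| "web_dom (Cup a) = []"
| "web_dom (Cap a) = [a, a]"
| "web_dom (f \<odot>\<odot> g) = web_dom g"
| "web_dom (f \<otimes>\<otimes> g) = web_dom f @ web_dom g"
| "web_dom (Zero x y) = x"
| "web_dom (f \<oplus>\<oplus> g) = web_dom f"
| "web_dom (Scale c f) = web_dom f"

primrec web_cod :: "web \<Rightarrow> nat list" where
  "web_cod (Ident x) = x"
| "web_cod (Merge a b) = [a + b]"
| "web_cod (Split a b) = [a, b]"
| "web_cod (Cross a b) = [b, a]"
| "web_cod (Cup a) = [a, a]"
| "web_cod (Cap a) = []"
| "web_cod (f \<odot>\<odot> g) = web_cod f"
| "web_cod (f \<otimes>\<otimes> g) = web_cod f @ web_cod g"
| "web_cod (Zero x y) = y"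
| "web_cod (f \<oplus>\<oplus> g) = web_cod f"
| "web_cod (Scale c f) = web_cod f"

primrec wt :: "web \<Rightarrow> bool" where
  "wt (Ident x) \<longleftrightarrow> x \<in> web_ob"
| "wt (Merge a b) \<longleftrightarrow> a \<ge> 1 \<and> b \<ge> 1"
| "wt (Split a b) \<longleftrightarrow> a \<ge> 1 \<and> b \<ge> 1"
| "wt (Cross a b) \<longleftrightarrow> a \<ge> 1 \<and> b \<ge> 1"
| "wt (Cup a) \<longleftrightarrow> a \<ge> 1"
| "wt (Cap a) \<longleftrightarrow> a \<ge> 1"
| "wt (f \<odot>\<odot> g) \<longleftrightarrow> wt f \<and> wt g \<and> web_dom f = web_cod g"
| "wt (f \<otimes>\<otimes> g) \<longleftrightarrow> wt f \<and> wt g"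
| "wt (Zero x y) \<longleftrightarrow> x \<in> web_ob \<and> y \<in> web_ob"
| "wt (f \<oplus>\<oplus> g) \<longleftrightarrow> wt f \<and> wt g \<and> web_dom f = web_dom g \<and> web_cod f = web_cod g"
| "wt (Scale c f) \<longleftrightarrow> wt f"

text \<open>Strands of thickness \<open>0\<close> are omitted.\<close>

definition thick :: "nat \<Rightarrow> nat list" where
  "thick a = (if a = 0 then [] else [a])"

abbreviation strand :: "nat \<Rightarrow> web" where
  "strand a \<equiv> Ident (thick a)"

definition merge_web :: "nat \<Rightarrow> nat \<Rightarrow> web" where
  "merge_web a b = (if a = 0 \<or> b = 0 then strand (a + b) else Merge a b)"

definition split_web :: "nat \<Rightarrow> nat \<Rightarrow> web" where
  "split_web a b = (if a = 0 \<or> b = 0 then strand (a + b) else Split a b)"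

definition cross_web :: "nat \<Rightarrow> nat \<Rightarrow> web" where
  "cross_web a b = (if a = 0 \<or> b = 0 then strand (a + b) else Cross a b)"

definition sum_web :: "nat list \<Rightarrow> nat list \<Rightarrow> web list \<Rightarrow> web" where
  "sum_web x y fs = foldr Add fs (Zero x y)"

definition square_webs :: "nat \<Rightarrow> nat \<Rightarrow> nat \<Rightarrow> nat \<Rightarrow> web list" where
  "square_webs a b c d =
     [(merge_web s (c - t) \<otimes>\<otimes> merge_web (a - s) t)
        \<odot>\<odot> (strand s \<otimes>\<otimes> cross_web (a - s) (c - t) \<otimes>\<otimes> strand t)
        \<odot>\<odot> (split_web s (a - s) \<otimes>\<otimes> split_web (c - t) t).
      s \<leftarrow> [0..<Suc (min a b)], t \<leftarrow> [0..<Suc (min c d)], int t - int s = int d - int a]"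

inductive web_rel :: "nat \<Rightarrow> web \<Rightarrow> web \<Rightarrow> bool" for N :: nat where
  merge_assoc: "\<lbrakk>a \<ge> 1; b \<ge> 1; c \<ge> 1\<rbrakk> \<Longrightarrow>
    web_rel N (Merge (a + b) c \<odot>\<odot> (Merge a b \<otimes>\<otimes> strand c))
              (Merge a (b + c) \<odot>\<odot> (strand a \<otimes>\<otimes> Merge b c))"
| split_assoc: "\<lbrakk>a \<ge> 1; b \<ge> 1; c \<ge> 1\<rbrakk> \<Longrightarrow>
    web_rel N ((Split a b \<otimes>\<otimes> strand c) \<odot>\<odot> Split (a + b) c)
              ((strand a \<otimes>\<otimes> Split b c) \<odot>\<odot> Split a (b + c))"
| merge_split: "\<lbrakk>a \<ge> 1; b \<ge> 1\<rbrakk> \<Longrightarrow>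
    web_rel N (Merge a b \<odot>\<odot> Split a b) (Scale (of_nat ((a + b) choose a)) (strand (a + b)))"
| split_merge: "\<lbrakk>a \<ge> 1; b \<ge> 1; c \<ge> 1; d \<ge> 1; a + c = b + d\<rbrakk> \<Longrightarrow>
    web_rel N (Split b d \<odot>\<odot> Merge a c) (sum_web [a, c] [b, d] (square_webs a b c d))"
| zigzag_left: "a \<ge> 1 \<Longrightarrow>
    web_rel N ((Cap a \<otimes>\<otimes> strand a) \<odot>\<odot> (strand a \<otimes>\<otimes> Cup a)) (strand a)"
| zigzag_right: "a \<ge> 1 \<Longrightarrow>
    web_rel N ((strand a \<otimes>\<otimes> Cap a) \<odot>\<odot> (Cup a \<otimes>\<otimes> strand a)) (strand a)"
| cap_cross: "\<lbrakk>a \<ge> 1; b \<ge> 1\<rbrakk> \<Longrightarrow>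
    web_rel N ((Cap a \<otimes>\<otimes> strand b) \<odot>\<odot> (strand a \<otimes>\<otimes> Cross b a))
              ((strand b \<otimes>\<otimes> Cap a) \<odot>\<odot> (Cross a b \<otimes>\<otimes> strand a))"
| cup_cross: "\<lbrakk>a \<ge> 1; b \<ge> 1\<rbrakk> \<Longrightarrow>
    web_rel N ((Cross b a \<otimes>\<otimes> strand a) \<odot>\<odot> (strand b \<otimes>\<otimes> Cup a))
              ((strand a \<otimes>\<otimes> Cross a b) \<odot>\<odot> (Cup a \<otimes>\<otimes> strand b))"
| cap_split: "\<lbrakk>a \<ge> 1; b \<ge> 1\<rbrakk> \<Longrightarrow>
    web_rel N (Cap b \<odot>\<odot> (strand b \<otimes>\<otimes> Cap a \<otimes>\<otimes> strand b)
                 \<odot>\<odot> (Split b a \<otimes>\<otimes> strand a \<otimes>\<otimes> strand b))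
              (Cap (a + b) \<odot>\<odot> (strand (a + b) \<otimes>\<otimes> Merge a b))"
| split_cap: "\<lbrakk>a \<ge> 1; b \<ge> 1\<rbrakk> \<Longrightarrow>
    web_rel N (Cap a \<odot>\<odot> (strand a \<otimes>\<otimes> Cap b \<otimes>\<otimes> strand a)
                 \<odot>\<odot> (strand a \<otimes>\<otimes> strand b \<otimes>\<otimes> Split b a))
              (Cap (a + b) \<odot>\<odot> (Merge a b \<otimes>\<otimes> strand (a + b)))"
| circle: "a \<ge> 1 \<Longrightarrow>
    web_rel N (Cap a \<odot>\<odot> Cup a) (Scale ((of_nat N :: complex) gchoose a) (Ident []))"
| lollipop: "a \<ge> 1 \<Longrightarrow>
    web_rel N (Cap a \<odot>\<odot> Split a a) (Zero [a + a] [])"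
| cap_twist: "a \<ge> 1 \<Longrightarrow>
    web_rel N (Cap a \<odot>\<odot> Cross a a) (Scale ((-1) ^ a) (Cap a))"

inductive web_eq :: "nat \<Rightarrow> web \<Rightarrow> web \<Rightarrow> bool" for N :: nat where
  rel: "web_rel N f g \<Longrightarrow> web_eq N f g"
| refl: "wt f \<Longrightarrow> web_eq N f f"
| sym: "web_eq N f g \<Longrightarrow> web_eq N g f"
| trans: "\<lbrakk>web_eq N f g; web_eq N g h\<rbrakk> \<Longrightarrow> web_eq N f h"
| comp_cong: "\<lbrakk>web_eq N f f'; web_eq N g g'; web_dom f = web_cod g\<rbrakk>
    \<Longrightarrow> web_eq N (f \<odot>\<odot> g) (f' \<odot>\<odot> g')"
| tens_cong: "\<lbrakk>web_eq N f f'; web_eq N g g'\<rbrakk> \<Longrightarrow> web_eq N (f \<otimes>\<otimes> g) (f' \<otimes>\<otimes> g')"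
| add_cong: "\<lbrakk>web_eq N f f'; web_eq N g g'; web_dom f = web_dom g; web_cod f = web_cod g\<rbrakk>
    \<Longrightarrow> web_eq N (f \<oplus>\<oplus> g) (f' \<oplus>\<oplus> g')"
| scale_cong: "web_eq N f f' \<Longrightarrow> web_eq N (Scale c f) (Scale c f')"
| comp_assoc: "wt (f \<odot>\<odot> g \<odot>\<odot> h) \<Longrightarrow> web_eq N (f \<odot>\<odot> g \<odot>\<odot> h) (f \<odot>\<odot> (g \<odot>\<odot> h))"
| comp_id_left: "wt f \<Longrightarrow> web_eq N (Ident (web_cod f) \<odot>\<odot> f) f"
| comp_id_right: "wt f \<Longrightarrow> web_eq N (f \<odot>\<odot> Ident (web_dom f)) f"
| tens_assoc: "wt (f \<otimes>\<otimes> g \<otimes>\<otimes> h) \<Longrightarrow> web_eq N (f \<otimes>\<otimes> g \<otimes>\<otimes> h) (f \<otimes>\<otimes> (g \<otimes>\<otimes> h))"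
| tens_unit_left: "wt f \<Longrightarrow> web_eq N (Ident [] \<otimes>\<otimes> f) f"
| tens_unit_right: "wt f \<Longrightarrow> web_eq N (f \<otimes>\<otimes> Ident []) f"
| tens_id: "\<lbrakk>x \<in> web_ob; y \<in> web_ob\<rbrakk> \<Longrightarrow> web_eq N (Ident x \<otimes>\<otimes> Ident y) (Ident (x @ y))"
| interchange: "\<lbrakk>wt (f \<odot>\<odot> h); wt (g \<odot>\<odot> k)\<rbrakk>
    \<Longrightarrow> web_eq N ((f \<otimes>\<otimes> g) \<odot>\<odot> (h \<otimes>\<otimes> k)) ((f \<odot>\<odot> h) \<otimes>\<otimes> (g \<odot>\<odot> k))"
| add_assoc: "wt (f \<oplus>\<oplus> g \<oplus>\<oplus> h) \<Longrightarrow> web_eq N (f \<oplus>\<oplus> g \<oplus>\<oplus> h) (f \<oplus>\<oplus> (g \<oplus>\<oplus> h))"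
| add_comm: "wt (f \<oplus>\<oplus> g) \<Longrightarrow> web_eq N (f \<oplus>\<oplus> g) (g \<oplus>\<oplus> f)"
| add_zero: "wt f \<Longrightarrow> web_eq N (f \<oplus>\<oplus> Zero (web_dom f) (web_cod f)) f"
| add_inverse: "wt f \<Longrightarrow> web_eq N (f \<oplus>\<oplus> Scale (-1) f) (Zero (web_dom f) (web_cod f))"
| scale_one: "wt f \<Longrightarrow> web_eq N (Scale 1 f) f"
| scale_scale: "wt f \<Longrightarrow> web_eq N (Scale c (Scale d f)) (Scale (c * d) f)"
| scale_add_left: "wt f \<Longrightarrow> web_eq N (Scale (c + d) f) (Scale c f \<oplus>\<oplus> Scale d f)"
| scale_add_right: "wt (f \<oplus>\<oplus> g) \<Longrightarrow> web_eq N (Scale c (f \<oplus>\<oplus> g)) (Scale c f \<oplus>\<oplus> Scale c g)"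
| comp_add_left: "wt ((f \<oplus>\<oplus> g) \<odot>\<odot> h)
    \<Longrightarrow> web_eq N ((f \<oplus>\<oplus> g) \<odot>\<odot> h) ((f \<odot>\<odot> h) \<oplus>\<oplus> (g \<odot>\<odot> h))"
| comp_add_right: "wt (f \<odot>\<odot> (g \<oplus>\<oplus> h))
    \<Longrightarrow> web_eq N (f \<odot>\<odot> (g \<oplus>\<oplus> h)) ((f \<odot>\<odot> g) \<oplus>\<oplus> (f \<odot>\<odot> h))"
| comp_scale_left: "wt (f \<odot>\<odot> g) \<Longrightarrow> web_eq N (Scale c f \<odot>\<odot> g) (Scale c (f \<odot>\<odot> g))"
| comp_scale_right: "wt (f \<odot>\<odot> g) \<Longrightarrow> web_eq N (f \<odot>\<odot> Scale c g) (Scale c (f \<odot>\<odot> g))"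
| tens_add_left: "wt ((f \<oplus>\<oplus> g) \<otimes>\<otimes> h)
    \<Longrightarrow> web_eq N ((f \<oplus>\<oplus> g) \<otimes>\<otimes> h) ((f \<otimes>\<otimes> h) \<oplus>\<oplus> (g \<otimes>\<otimes> h))"
| tens_add_right: "wt (f \<otimes>\<otimes> (g \<oplus>\<oplus> h))
    \<Longrightarrow> web_eq N (f \<otimes>\<otimes> (g \<oplus>\<oplus> h)) ((f \<otimes>\<otimes> g) \<oplus>\<oplus> (f \<otimes>\<otimes> h))"
| tens_scale_left: "wt (f \<otimes>\<otimes> g) \<Longrightarrow> web_eq N (Scale c f \<otimes>\<otimes> g) (Scale c (f \<otimes>\<otimes> g))"
| tens_scale_right: "wt (f \<otimes>\<otimes> g) \<Longrightarrow> web_eq N (f \<otimes>\<otimes> Scale c g) (Scale c (f \<otimes>\<otimes> g))"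

definition web_class :: "nat \<Rightarrow> web \<Rightarrow> web set" where
  "web_class N f = {g. web_eq N f g}"

definition web_cat :: "nat \<Rightarrow> (nat list, web set) lmcat" where
  "web_cat N = \<lparr>
     Ob = web_ob,
     Arrows = (\<lambda>x y. {web_class N f |f. wt f \<and> web_dom f = x \<and> web_cod f = y}),
     ide = (\<lambda>x. web_class N (Ident x)),
     cmp = (\<lambda>A B. \<Union>f\<in>A. \<Union>g\<in>B. web_class N (f \<odot>\<odot> g)),
     zero_ar = (\<lambda>x y. web_class N (Zero x y)),
     add_ar = (\<lambda>A B. \<Union>f\<in>A. \<Union>g\<in>B. web_class N (f \<oplus>\<oplus> g)),
     scale_ar = (\<lambda>c A. \<Union>f\<in>A. web_class N (Scale c f)),
     tensor_ob = (@),
     tensor_ar = (\<lambda>A B. \<Union>f\<in>A. \<Union>g\<in>B. web_class N (f \<otimes>\<otimes> g)),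
     unit_ob = [],
     assoc = (\<lambda>x y z. web_class N (Ident (x @ y @ z))),
     lunit = (\<lambda>x. web_class N (Ident x)),
     runit = (\<lambda>x. web_class N (Ident x)) \<rparr>"

lemma web_rel_wt:
  assumes "web_rel N f g"
  shows "wt f \<and> wt g \<and> web_dom f = web_dom g \<and> web_cod f = web_cod g"
proof -
  have sum: "wt (sum_web x y fs) \<and> web_dom (sum_web x y fs) = x \<and> web_cod (sum_web x y fs) = y"
    if "x \<in> web_ob" "y \<in> web_ob" "\<And>f. f \<in> set fs \<Longrightarrow> wt f \<and> web_dom f = x \<and> web_cod f = y" for x y fs
    using that(3) by (induction fs) (use that(1,2) in \<open>auto simp: sum_web_def\<close>)
  have square: "wt f \<and> web_dom f = [a, c] \<and> web_cod f = [b, d]"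
    if mem: "f \<in> set (square_webs a b c d)" and pos: "a \<ge> 1" "b \<ge> 1" "c \<ge> 1" "d \<ge> 1" and ac: "a + c = b + d"
    for a b c d f
  proof -
    obtain s t where f: "f = (merge_web s (c - t) \<otimes>\<otimes> merge_web (a - s) t)
          \<odot>\<odot> (strand s \<otimes>\<otimes> cross_web (a - s) (c - t) \<otimes>\<otimes> strand t)
          \<odot>\<odot> (split_web s (a - s) \<otimes>\<otimes> split_web (c - t) t)"
      and st: "s \<le> a" "t \<le> c" "int t - int s = int d - int a"
      using mem by (auto simp: square_webs_def less_Suc_eq_le simp del: upt_Suc)
    have types:
      "wt (merge_web m n)" "web_dom (merge_web m n) = thick m @ thick n"
      "web_cod (merge_web m n) = thick (m + n)"
      "wt (split_web m n)" "web_dom (split_web m n) = thick (m + n)"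
      "web_cod (split_web m n) = thick m @ thick n"
      "wt (cross_web m n)" "web_dom (cross_web m n) = thick m @ thick n"
      "web_cod (cross_web m n) = thick n @ thick m"
      "thick m \<in> web_ob" for m n
      by (auto simp: merge_web_def split_web_def cross_web_def thick_def web_ob_def)
    have "s + (c - t) = b" "a - s + t = d" "s + (a - s) = a" "c - t + t = c"
      using st ac by auto
    then show ?thesis
      using pos by (simp add: f types) (simp add: thick_def)
  qed
  show ?thesis
    using assms
  proof cases
    case (split_merge a b c d)
    then show ?thesis
      using sum[of "[a, c]" "[b, d]" "square_webs a b c d"] square[of _ a b c d]
      by (auto simp: web_ob_def)
  qed (auto simp: thick_def web_ob_def)
qed

lemma web_ob_append: "[] \<in> web_ob" "x @ y \<in> web_ob \<longleftrightarrow> x \<in> web_ob \<and> y \<in> web_ob"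
  by (auto simp: web_ob_def)

lemma wt_web_ob: "wt f \<Longrightarrow> web_dom f \<in> web_ob \<and> web_cod f \<in> web_ob"
  by (induction f) (auto simp: web_ob_def)

lemma web_eq_wt:
  "web_eq N f g \<Longrightarrow> wt f \<and> wt g \<and> web_dom f = web_dom g \<and> web_cod f = web_cod g"
proof (induction rule: web_eq.induct)
  case (rel f g)
  then show ?case by (rule web_rel_wt)
qed (auto simp: wt_web_ob web_ob_append)


section \<open>The Lie algebra \<open>so\<^sub>N\<close> and its finite-dimensional modules\<close>

definition vscale :: "complex \<Rightarrow> ('i \<Rightarrow> complex) \<Rightarrow> 'i \<Rightarrow> complex" where
  "vscale c v = (\<lambda>i. c * v i)"

global_interpretation cfun: vector_space "vscale :: complex \<Rightarrow> ('i \<Rightarrow> complex) \<Rightarrow> 'i \<Rightarrow> complex"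
  by unfold_locales (auto simp: vscale_def fun_eq_iff algebra_simps)

definition linear_between ::
  "('i \<Rightarrow> complex) set \<Rightarrow> ('j \<Rightarrow> complex) set \<Rightarrow> (('i \<Rightarrow> complex) \<Rightarrow> 'j \<Rightarrow> complex) set" where
  "linear_between W X = {f \<in> W \<rightarrow>\<^sub>E X.
     (\<forall>v\<in>W. \<forall>w\<in>W. f (v + w) = f v + f w) \<and> (\<forall>c. \<forall>v\<in>W. f (vscale c v) = vscale c (f v))}"

definition idx :: "nat \<Rightarrow> int set" where
  "idx N = (if odd N then {- int (N div 2)..int (N div 2)}
            else {- int (N div 2)..int (N div 2)} - {0})"

definition Vspace :: "nat \<Rightarrow> (int \<Rightarrow> complex) set" where
  "Vspace N = {y. \<forall>i. i \<notin> idx N \<longrightarrow> y i = 0}"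

definition vb :: "int \<Rightarrow> int \<Rightarrow> complex" where
  "vb i = (\<lambda>j. if j = i then 1 else 0)"

definition bform :: "nat \<Rightarrow> (int \<Rightarrow> complex) \<Rightarrow> (int \<Rightarrow> complex) \<Rightarrow> complex" where
  "bform N y z = (\<Sum>i\<in>idx N. y i * z (- i))"

type_synonym endo = "(int \<Rightarrow> complex) \<Rightarrow> int \<Rightarrow> complex"

definition so :: "nat \<Rightarrow> endo set" where
  "so N = {g \<in> linear_between (Vspace N) (Vspace N).
     \<forall>y\<in>Vspace N. \<forall>z\<in>Vspace N. bform N (g y) z + bform N y (g z) = 0}"

definition so_add :: "nat \<Rightarrow> endo \<Rightarrow> endo \<Rightarrow> endo" where
  "so_add N g h = (\<lambda>y\<in>Vspace N. g y + h y)"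

definition so_scale :: "nat \<Rightarrow> complex \<Rightarrow> endo \<Rightarrow> endo" where
  "so_scale N c g = (\<lambda>y\<in>Vspace N. vscale c (g y))"

definition so_bracket :: "nat \<Rightarrow> endo \<Rightarrow> endo \<Rightarrow> endo" where
  "so_bracket N g h = (\<lambda>y\<in>Vspace N. g (h y) - h (g y))"

text \<open>
  The underlying space of a module is a finite-dimensional subspace of the space of complex
  functions on a fixed set of labels. \<open>Idx [i\<^sub>1, \<dots>, i\<^sub>a]\<close> labels the basis tensor
  \<open>v\<^bsub>i\<^sub>1\<^esub> \<otimes> \<dots> \<otimes> v\<^bsub>i\<^sub>a\<^esub>\<close> of the \<open>a\<close>-th tensor power of \<open>V\<close>, and \<open>Tensor\<close> makes the class
  of these spaces closed under tensor products: \<open>W \<otimes> X\<close> is spanned by the functions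
  \<open>Tensor p q \<mapsto> w p * x q\<close>.
\<close>

datatype label = Idx "int list" | Tensor label label

type_synonym vec = "label \<Rightarrow> complex"

record so_module =
  underlying :: "vec set"
  act :: "endo \<Rightarrow> vec \<Rightarrow> vec"

definition is_so_module :: "nat \<Rightarrow> so_module \<Rightarrow> bool" where
  "is_so_module N M \<longleftrightarrow>
     (\<exists>B. finite B \<and> underlying M = cfun.span B) \<and>
     act M \<in> so N \<rightarrow>\<^sub>E linear_between (underlying M) (underlying M) \<and>
     (\<forall>g\<in>so N. \<forall>h\<in>so N. \<forall>w\<in>underlying M.
        act M (so_add N g h) w = act M g w + act M h w) \<and>
     (\<forall>c. \<forall>g\<in>so N. \<forall>w\<in>underlying M. act M (so_scale N c g) w = vscale c (act M g w)) \<and>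
     (\<forall>g\<in>so N. \<forall>h\<in>so N. \<forall>w\<in>underlying M.
        act M (so_bracket N g h) w = act M g (act M h w) - act M h (act M g w))"

record so_map =
  src :: so_module
  tgt :: so_module
  arrow_map :: "vec \<Rightarrow> vec"

definition so_maps :: "nat \<Rightarrow> so_module \<Rightarrow> so_module \<Rightarrow> so_map set" where
  "so_maps N M M' = {f. src f = M \<and> tgt f = M' \<and>
     arrow_map f \<in> linear_between (underlying M) (underlying M') \<and>
     (\<forall>g\<in>so N. \<forall>w\<in>underlying M. arrow_map f (act M g w) = act M' g (arrow_map f w))}"

definition tensor_vec :: "vec \<Rightarrow> vec \<Rightarrow> vec"  (infixl "\<otimes>\<^sub>v" 75) where
  "w \<otimes>\<^sub>v x = (\<lambda>l. case l of Idx _ \<Rightarrow> 0 | Tensor p q \<Rightarrow> w p * x q)"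

definition tensor_space :: "vec set \<Rightarrow> vec set \<Rightarrow> vec set" where
  "tensor_space W X = cfun.span {w \<otimes>\<^sub>v x |w x. w \<in> W \<and> x \<in> X}"

text \<open>
  For linear \<open>f\<close> on \<open>W\<close> and \<open>h\<close> on \<open>X\<close> this is the linear map \<open>f \<otimes> h\<close> on \<open>W \<otimes> X\<close>:
  all slices of a tensor in \<open>W \<otimes> X\<close> along the second component lie in \<open>X\<close>; \<open>h\<close> is applied
  to each of them, and then \<open>f\<close> to the resulting slices along the first component.
\<close>

definition tensor_fun :: "(vec \<Rightarrow> vec) \<Rightarrow> (vec \<Rightarrow> vec) \<Rightarrow> vec \<Rightarrow> vec" where
  "tensor_fun f h t = (\<lambda>l. case l of Idx _ \<Rightarrow> 0
     | Tensor p q \<Rightarrow> f (\<lambda>p'. h (\<lambda>q'. t (Tensor p' q')) q) p)"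

lemma tensor_fun_tensor_vec:
  assumes f: "f \<in> linear_between W W'" and h: "h \<in> linear_between X X'"
    and w: "w \<in> W" and x: "x \<in> X"
  shows "tensor_fun f h (w \<otimes>\<^sub>v x) = f w \<otimes>\<^sub>v h x"
proof -
  have h': "h (\<lambda>q'. c * x q') = (\<lambda>q. c * h x q)" for c
    using h x by (auto simp: linear_between_def vscale_def)
  have f': "f (\<lambda>p'. w p' * c) = (\<lambda>p. f w p * c)" for c
    using f w by (auto simp: linear_between_def vscale_def mult.commute)
  show ?thesis
    by (rule ext) (auto simp: tensor_fun_def tensor_vec_def h' f' split: label.split)
qed

definition tensor_module :: "nat \<Rightarrow> so_module \<Rightarrow> so_module \<Rightarrow> so_module" where
  "tensor_module N M M' = \<lparr>
     underlying = tensor_space (underlying M) (underlying M'),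
     act = (\<lambda>g\<in>so N. \<lambda>t\<in>tensor_space (underlying M) (underlying M').
       tensor_fun (act M g) (\<lambda>x. x) t + tensor_fun (\<lambda>w. w) (act M' g) t) \<rparr>"

definition unit_tensor :: vec where
  "unit_tensor = (\<lambda>l. if l = Idx [] then 1 else 0)"

definition trivial_module :: "nat \<Rightarrow> so_module" where
  "trivial_module N = \<lparr>
     underlying = cfun.span {unit_tensor},
     act = (\<lambda>g\<in>so N. \<lambda>w\<in>cfun.span {unit_tensor}. 0) \<rparr>"

definition assoc_fun :: "vec \<Rightarrow> vec" where
  "assoc_fun t = (\<lambda>l. case l of Tensor p (Tensor q r) \<Rightarrow> t (Tensor (Tensor p q) r) | _ \<Rightarrow> 0)"

definition so_mod :: "nat \<Rightarrow> (so_module, so_map) lmcat" where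
  "so_mod N = \<lparr>
     Ob = {M. is_so_module N M},
     Arrows = so_maps N,
     ide = (\<lambda>M. \<lparr>src = M, tgt = M, arrow_map = (\<lambda>w\<in>underlying M. w)\<rparr>),
     cmp = (\<lambda>f h. \<lparr>src = src h, tgt = tgt f,
       arrow_map = (\<lambda>w\<in>underlying (src h). arrow_map f (arrow_map h w))\<rparr>),
     zero_ar = (\<lambda>M M'. \<lparr>src = M, tgt = M', arrow_map = (\<lambda>w\<in>underlying M. 0)\<rparr>),
     add_ar = (\<lambda>f h. \<lparr>src = src f, tgt = tgt f,
       arrow_map = (\<lambda>w\<in>underlying (src f). arrow_map f w + arrow_map h w)\<rparr>),
     scale_ar = (\<lambda>c f. \<lparr>src = src f, tgt = tgt f,
       arrow_map = (\<lambda>w\<in>underlying (src f). vscale c (arrow_map f w))\<rparr>),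
     tensor_ob = tensor_module N,
     tensor_ar = (\<lambda>f h. \<lparr>
       src = tensor_module N (src f) (src h),
       tgt = tensor_module N (tgt f) (tgt h),
       arrow_map = (\<lambda>t\<in>underlying (tensor_module N (src f) (src h)). tensor_fun (arrow_map f) (arrow_map h) t)\<rparr>),
     unit_ob = trivial_module N,
     assoc = (\<lambda>M M' M''. \<lparr>
       src = tensor_module N (tensor_module N M M') M'',
       tgt = tensor_module N M (tensor_module N M' M''),
       arrow_map = (\<lambda>t\<in>underlying (tensor_module N (tensor_module N M M') M''). assoc_fun t)\<rparr>),
     lunit = (\<lambda>M. \<lparr>
       src = tensor_module N (trivial_module N) M,
       tgt = M,
       arrow_map = (\<lambda>t\<in>underlying (tensor_module N (trivial_module N) M). \<lambda>p. t (Tensor (Idx []) p))\<rparr>),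
     runit = (\<lambda>M. \<lparr>
       src = tensor_module N M (trivial_module N),
       tgt = M,
       arrow_map = (\<lambda>t\<in>underlying (tensor_module N M (trivial_module N)). \<lambda>p. t (Tensor p (Idx [])))\<rparr>) \<rparr>"


section \<open>Exterior powers\<close>

text \<open>
  The exterior power is realized inside the tensor power as the space of antisymmetric tensors,
  with \<open>y\<^sub>1 \<and> \<dots> \<and> y\<^sub>a = \<Sum>\<^sub>\<sigma> sign \<sigma> y\<^bsub>\<sigma> 1\<^esub> \<otimes> \<dots> \<otimes> y\<^bsub>\<sigma> a\<^esub>\<close>; there is no factor \<open>1 / a!\<close>.
\<close>

definition wedge :: "(int \<Rightarrow> complex) list \<Rightarrow> vec" where
  "wedge ys = (\<lambda>l. case l of Tensor _ _ \<Rightarrow> 0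
     | Idx k \<Rightarrow> if length k = length ys
         then \<Sum>\<sigma> | \<sigma> permutes {..<length ys}.
                of_int (sign \<sigma>) * (\<Prod>p<length ys. (ys ! \<sigma> p) (k ! p))
         else 0)"

definition ext_space :: "nat \<Rightarrow> nat \<Rightarrow> vec set" where
  "ext_space N a = cfun.span {wedge ys |ys. length ys = a \<and> set ys \<subseteq> Vspace N}"

text \<open>The action of \<open>g\<close> on tensors by derivations, i.e. \<open>\<Sum>\<^sub>p 1 \<otimes> \<dots> \<otimes> g \<otimes> \<dots> \<otimes> 1\<close>.\<close>

definition deriv_fun :: "endo \<Rightarrow> vec \<Rightarrow> vec" where
  "deriv_fun g t = (\<lambda>l. case l of Tensor _ _ \<Rightarrow> 0
     | Idx k \<Rightarrow> \<Sum>p<length k. g (\<lambda>j. t (Idx (k[p := j]))) (k ! p))"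

definition ext_power :: "nat \<Rightarrow> nat \<Rightarrow> so_module" where
  "ext_power N a = \<lparr>
     underlying = ext_space N a,
     act = (\<lambda>g\<in>so N. \<lambda>t\<in>ext_space N a. deriv_fun g t) \<rparr>"

abbreviation wedge_vb :: "int list \<Rightarrow> vec" where
  "wedge_vb i \<equiv> wedge (map vb i)"


section \<open>Length in symmetric groups\<close>

definition perm_length :: "nat \<Rightarrow> (nat \<Rightarrow> nat) \<Rightarrow> nat" where
  "perm_length n w = (LEAST k. \<exists>js. length js = k \<and> (\<forall>j\<in>set js. Suc j < n) \<and>
     w = foldr (\<circ>) (map (\<lambda>j. transpose j (Suc j)) js) id)"

text \<open>
  \<open>\<SS>\<^bsub>a + b\<^esub>\<close> permutes \<open>{..<a + b}\<close>, and \<open>\<SS>\<^sub>a \<times> \<SS>\<^sub>b\<close> is the stabilizer of \<open>{..<a}\<close>.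
\<close>

definition min_coset_reps :: "nat \<Rightarrow> nat \<Rightarrow> (nat \<Rightarrow> nat) set" where
  "min_coset_reps a b = {w. w permutes {..<a + b} \<and>
     (\<forall>u. u permutes {..<a + b} \<and> u ` {..<a} = {..<a} \<longrightarrow>
        perm_length (a + b) w \<le> perm_length (a + b) (w \<circ> u))}"

end

theory Submission
  imports "Jordan_Normal_Form.Determinant" "HOL-Combinatorics.Multiset_Permutations" Defs
begin

text \<open>
  The functor is realized strictly: a word \<open>[a\<^sub>1, \<dots>, a\<^sub>r]\<close> goes to the span of the products of \<open>r\<close> wedges
  inside the tensor power of \<open>V\<close> of exponent \<open>a\<^sub>1 + \<dots> + a\<^sub>r\<close>, where the product is concatenation \<open>\<star>\<close>
  of tensors; the structure isomorphisms just concatenate indices. On these spaces a split is an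
  inclusion and a merge is the signed shuffle product, so the relations (W1) and the second half of
  (W2) hold on arbitrary tensors because deconcatenation and signed shuffles form a graded bialgebra.
  The first half of (W2) and the relations for caps and cups use that the tensors are alternating: then every unshuffle of
  an index word contributes the same amount, and contracting over all words is \<open>a!\<close> times
  contracting over increasing words. The Lie algebra acts by derivations of both products, so
  equivariance needs a check only for caps; for cups it follows by duality. Finally, the coset
  formula for splits is the Laplace expansion of a wedge, once minimal coset representatives are
  identified with the permutations that increase on both blocks.
\<close>

section \<open>Linear maps between function spaces\<close>

text \<open>The web category is strict and the module category is not, so webs are evaluated on
  vectors indexed by flat words, and brackets enter only through the structure isomorphisms. The
  maps \<open>ev N f\<close> are total and linear on all vectors, with no reference to a domain.
  They can therefore be applied to basis tensors that are not alternating, while relations are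
  claimed only on the spaces \<open>wspace N x\<close>. The signs fit because every letter counts as
  odd: a crossing with sign (-1)^(ab) is exactly the braiding for which deconcatenation is
  multiplicative with respect to signed shuffles. Since wedges are antisymmetrized without 1/a!, a
  split needs no scalar, a merge after a split produces the binomial coefficient, and the factorial
  has to appear in the cap, as the factor 1/a!. Symmetry of the bilinear form, against antisymmetry
  of the tensors, makes the cap vanish after a split; it also makes the cap itself symmetric, so
  that a crossing below it contributes only its own sign.\<close>

definition lin :: "('i \<Rightarrow> complex) set \<Rightarrow> ('j \<Rightarrow> complex) set \<Rightarrow> (('i \<Rightarrow> complex) \<Rightarrow> 'j \<Rightarrow> complex) \<Rightarrow> bool"
  where "lin W X f \<longleftrightarrow> (\<forall>v\<in>W. f v \<in> X) \<and> (\<forall>v\<in>W. \<forall>w\<in>W. f (v + w) = f v + f w) \<and>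
     (\<forall>c. \<forall>v\<in>W. f (vscale c v) = vscale c (f v))"

text \<open>Splitting off extensionality lets maps be composed as plain functions and used on
  smaller or larger domains; \<open>extensional\<close> returns only when arrows are formed.\<close>

lemma linear_between_iff: "f \<in> linear_between W X \<longleftrightarrow> lin W X f \<and> f \<in> extensional W"
  by (auto simp: linear_between_def lin_def PiE_iff)

(* Resolution and induction leave eta-expanded goals, in which these rules would rewrite every vector. *)
declare plus_fun_apply [simp del] zero_fun_apply [simp del] minus_apply [simp del] uminus_apply [simp del]

lemma vscale_apply: "vscale c v i = c * v i"
  by (simp add: vscale_def)

lemmas pw = plus_fun_apply zero_fun_apply minus_apply uminus_apply vscale_apply

lemma fun_zero_eq: "(\<lambda>x. 0) = (0 :: 'a \<Rightarrow> complex)"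
  by (simp add: fun_eq_iff pw)

lemma lin_in: "lin W X f \<Longrightarrow> v \<in> W \<Longrightarrow> f v \<in> X"
  and lin_add: "lin W X f \<Longrightarrow> v \<in> W \<Longrightarrow> w \<in> W \<Longrightarrow> f (v + w) = f v + f w"
  and lin_scale: "lin W X f \<Longrightarrow> v \<in> W \<Longrightarrow> f (vscale c v) = vscale c (f v)"
  by (auto simp: lin_def)

lemma linI:
  assumes "\<And>v. v \<in> W \<Longrightarrow> f v \<in> X" "\<And>v w. v \<in> W \<Longrightarrow> w \<in> W \<Longrightarrow> f (v + w) = f v + f w"
    "\<And>c v. v \<in> W \<Longrightarrow> f (vscale c v) = vscale c (f v)"
  shows "lin W X f"
  using assms by (auto simp: lin_def)

lemma lin_zero: "lin W X f \<Longrightarrow> cfun.subspace W \<Longrightarrow> f 0 = 0"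
  using lin_scale[of W X f 0 0] cfun.subspace_0[of W] by simp

lemma lin_sum:
  assumes "lin W X f" "cfun.subspace W" "finite A" "\<And>a. a \<in> A \<Longrightarrow> t a \<in> W"
  shows "f (\<Sum>a\<in>A. t a) = (\<Sum>a\<in>A. f (t a))"
  using assms(3,4)
proof (induction A)
  case empty
  then show ?case using lin_zero[OF assms(1,2)] by (simp add: fun_zero_eq)
next
  case (insert a A)
  have "sum t A \<in> W" using insert assms(2) by (intro cfun.subspace_sum) auto
  then have "f (sum t (insert a A)) = (\<Sum>a\<in>insert a A. f (t a))"
    using insert lin_add[OF assms(1), of "t a" "sum t A"] by simp
  then show ?case .
qed

lemma lin_id: "W \<subseteq> X \<Longrightarrow> lin W X (\<lambda>w. w)"
  by (auto intro!: linI)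

lemma lin_compose: "lin W X h \<Longrightarrow> lin X Y f \<Longrightarrow> lin W Y (\<lambda>w. f (h w))"
  unfolding lin_def by simp

lemma lin_plus: "lin W X f \<Longrightarrow> lin W X h \<Longrightarrow> cfun.subspace X \<Longrightarrow> lin W X (\<lambda>w. f w + h w)"
  by (rule linI) (auto simp: lin_in lin_add lin_scale cfun.subspace_add cfun.scale_right_distrib)

lemma lin_minus: "lin W X f \<Longrightarrow> lin W X h \<Longrightarrow> cfun.subspace X \<Longrightarrow> lin W X (\<lambda>w. f w - h w)"
  by (rule linI) (auto simp: lin_in lin_add lin_scale cfun.subspace_diff cfun.scale_right_diff_distrib)

lemma lin_vscale: "lin W X f \<Longrightarrow> cfun.subspace X \<Longrightarrow> lin W X (\<lambda>w. vscale c (f w))"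
  unfolding lin_def by (simp add: cfun.subspace_scale cfun.scale_right_distrib mult.commute)

lemma lin_const_zero: "cfun.subspace X \<Longrightarrow> lin W X (\<lambda>w. 0)"
  by (rule linI) (auto simp: cfun.subspace_0)

lemma lin_weaken: "lin W X f \<Longrightarrow> W' \<subseteq> W \<Longrightarrow> X \<subseteq> X' \<Longrightarrow> lin W' X' f"
  unfolding lin_def by blast

lemma lin_cong:
  assumes "lin W X f" "cfun.subspace W" and eq: "\<And>w. w \<in> W \<Longrightarrow> f w = h w"
  shows "lin W X h"
  using assms(1) cfun.subspace_add[OF assms(2)] cfun.subspace_scale[OF assms(2)]
  unfolding lin_def by (simp flip: eq)

lemma lin_eq_on_span:
  assumes f: "lin (cfun.span B) X f" and h: "lin (cfun.span B) Y h"
    and eq: "\<And>b. b \<in> B \<Longrightarrow> f b = h b" and t: "t \<in> cfun.span B"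
  shows "f t = h t"
proof -
  have "t \<in> cfun.span B \<and> f t = h t"
    using t
  proof (induction rule: cfun.span_induct_alt)
    case base
    then show ?case using lin_zero[OF f] lin_zero[OF h] by (simp add: cfun.span_zero)
  next
    case (step c x y)
    then show ?case
      using lin_add[OF f] lin_add[OF h] lin_scale[OF f] lin_scale[OF h] eq
      by (simp add: cfun.span_add cfun.span_base cfun.span_scale)
  qed
  then show ?thesis ..
qed

text \<open>The codomain \<open>X\<close> may be far too large, often \<open>UNIV\<close>: linearity
  is shown first and the true codomain is then read off from the generators.\<close>

lemma lin_into:
  assumes f: "lin (cfun.span B) X f" and "cfun.subspace Y" "\<And>b. b \<in> B \<Longrightarrow> f b \<in> Y"
  shows "lin (cfun.span B) Y f"
proof -
  have "t \<in> cfun.span B \<and> f t \<in> Y" if "t \<in> cfun.span B" for t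
    using that
  proof (induction rule: cfun.span_induct_alt)
    case base
    then show ?case using lin_zero[OF f] assms(2) by (simp add: cfun.span_zero cfun.subspace_0)
  next
    case (step c x y)
    then show ?case
      using lin_add[OF f] lin_scale[OF f] assms(2,3)
      by (simp add: cfun.span_add cfun.span_base cfun.span_scale cfun.subspace_add cfun.subspace_scale)
  qed
  then show ?thesis using f by (auto simp: lin_def)
qed

text \<open>Modules must have a finite spanning set, whereas the word spaces below are spans of
  infinite families inside a finite-dimensional space.\<close>

lemma finite_basis_of_subspace:
  assumes "finite B" "W \<subseteq> cfun.span B" "cfun.subspace W"
  shows "\<exists>C. finite C \<and> W = cfun.span C"
proof -
  obtain C where C: "C \<subseteq> W" "cfun.independent C" "W \<subseteq> cfun.span C"
    using cfun.maximal_independent_subset by blast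
  then have "finite C"
    using cfun.independent_span_bound[of B C] assms by blast
  moreover have "cfun.span C \<subseteq> W"
    using C(1) assms(3) by (rule cfun.span_minimal)
  ultimately show ?thesis using C(3) by blast
qed

section \<open>Tensor products of function spaces\<close>

lemma tensor_vec_simps: "(w \<otimes>\<^sub>v x) (Idx k) = 0" "(w \<otimes>\<^sub>v x) (Tensor p q) = w p * x q"
  by (simp_all add: tensor_vec_def)

lemma tensor_fun_simps: "tensor_fun f h t (Idx k) = 0"
  "tensor_fun f h t (Tensor p q) = f (\<lambda>p'. h (\<lambda>q'. t (Tensor p' q')) q) p"
  by (simp_all add: tensor_fun_def)

lemma assoc_fun_simps: "assoc_fun t (Idx k) = 0" "assoc_fun t (Tensor p (Idx k)) = 0"
  "assoc_fun t (Tensor p (Tensor q r)) = t (Tensor (Tensor p q) r)"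
  by (simp_all add: assoc_fun_def)

lemma label_eqI:
  assumes "\<And>k. v (Idx k) = w (Idx k)" "\<And>p q. v (Tensor p q) = w (Tensor p q)"
  shows "v = w"
proof
  fix l show "v l = w l" using assms by (cases l) auto
qed

lemma tensor_vec_add: "(w + w') \<otimes>\<^sub>v x = w \<otimes>\<^sub>v x + w' \<otimes>\<^sub>v x" "w \<otimes>\<^sub>v (x + x') = w \<otimes>\<^sub>v x + w \<otimes>\<^sub>v x'"
  and tensor_vec_scale: "vscale c w \<otimes>\<^sub>v x = vscale c (w \<otimes>\<^sub>v x)" "w \<otimes>\<^sub>v vscale c x = vscale c (w \<otimes>\<^sub>v x)"
  and tensor_vec_zero: "0 \<otimes>\<^sub>v x = 0" "w \<otimes>\<^sub>v 0 = 0"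
  by (rule label_eqI; simp add: algebra_simps pw tensor_vec_simps)+

lemma subspace_tensor_space: "cfun.subspace (tensor_space W X)"
  by (simp add: tensor_space_def)

lemma tensor_vec_in: "w \<in> W \<Longrightarrow> x \<in> X \<Longrightarrow> w \<otimes>\<^sub>v x \<in> tensor_space W X"
  unfolding tensor_space_def by (rule cfun.span_base) auto

text \<open>Scalars are absorbed into the left factor, so the induction step only adds a bare simple
  tensor; this is what requires \<open>W\<close> to be a subspace.\<close>

lemma tensor_space_induct [consumes 2, case_names zero add]:
  assumes "t \<in> tensor_space W X" and W: "cfun.subspace W"
    and "P 0" "\<And>w x t. w \<in> W \<Longrightarrow> x \<in> X \<Longrightarrow> t \<in> tensor_space W X \<Longrightarrow> P t \<Longrightarrow> P (w \<otimes>\<^sub>v x + t)"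
  shows "P t"
proof -
  have "t \<in> tensor_space W X \<and> P t"
    using assms(1)[unfolded tensor_space_def]
  proof (induction rule: cfun.span_induct_alt)
    case base
    then show ?case using assms(3) subspace_tensor_space cfun.subspace_0 by blast
  next
    case (step c s t)
    then obtain w x where s: "s = w \<otimes>\<^sub>v x" "w \<in> W" "x \<in> X" by auto
    have e: "vscale c s = vscale c w \<otimes>\<^sub>v x" by (simp add: s tensor_vec_scale)
    have "vscale c w \<in> W" using W s by (simp add: cfun.subspace_scale)
    then show ?case unfolding e using step assms(4) s
      by (auto intro: cfun.subspace_add[OF subspace_tensor_space] tensor_vec_in)
  qed
  then show ?thesis ..
qed

lemma slice_simps:
  fixes s t w x :: vec
  shows "(\<lambda>q. (0 :: vec) (Tensor p q)) = 0" "(\<lambda>p. (0 :: vec) (Tensor p q)) = 0"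
    "(\<lambda>q. (s + t) (Tensor p q)) = (\<lambda>q. s (Tensor p q)) + (\<lambda>q. t (Tensor p q))"
    "(\<lambda>p. (s + t) (Tensor p q)) = (\<lambda>p. s (Tensor p q)) + (\<lambda>p. t (Tensor p q))"
    "(\<lambda>q. vscale c t (Tensor p q)) = vscale c (\<lambda>q. t (Tensor p q))"
    "(\<lambda>p. vscale c t (Tensor p q)) = vscale c (\<lambda>p. t (Tensor p q))"
    "(\<lambda>q. (w \<otimes>\<^sub>v x) (Tensor p q)) = vscale (w p) x"
    "(\<lambda>p. (w \<otimes>\<^sub>v x) (Tensor p q)) = vscale (x q) w"
  by (simp_all add: fun_eq_iff pw tensor_vec_simps)

section \<open>Slices of tensors and tensor products of linear maps\<close>

lemma tensor_space_slices:
  assumes "t \<in> tensor_space W X" and W: "cfun.subspace W" and X: "cfun.subspace X"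
  shows "t (Idx k) = 0" and "(\<lambda>q. t (Tensor p q)) \<in> X" and "(\<lambda>p. t (Tensor p q)) \<in> W"
proof -
  have "t (Idx k) = 0"
    using assms(1) W by (induction rule: tensor_space_induct) (simp_all add: pw tensor_vec_simps)
  moreover have "\<forall>p. (\<lambda>q. t (Tensor p q)) \<in> X"
    using assms(1) W by (induction rule: tensor_space_induct)
      (simp_all add: slice_simps cfun.subspace_0 cfun.subspace_add cfun.subspace_scale X)
  moreover have "\<forall>q. (\<lambda>p. t (Tensor p q)) \<in> W"
    using assms(1) W by (induction rule: tensor_space_induct)
      (simp_all add: slice_simps cfun.subspace_0 cfun.subspace_add cfun.subspace_scale W)
  ultimately show "t (Idx k) = 0" "(\<lambda>q. t (Tensor p q)) \<in> X" "(\<lambda>p. t (Tensor p q)) \<in> W" by auto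
qed

text \<open>Since \<open>f\<close> is linear on \<open>W\<close> only, it may be applied in
  \<open>tensor_fun\<close> only once the result of applying \<open>h\<close> slice by slice is
  known to have its columns in \<open>W\<close>.\<close>

lemma tensor_fun_inner:
  assumes "t \<in> tensor_space W X" and W: "cfun.subspace W" and X: "cfun.subspace X" and h: "lin X X' h"
  shows "(\<lambda>p. h (\<lambda>q'. t (Tensor p q')) q) \<in> W"
  using assms(1) W
proof (induction rule: tensor_space_induct)
  case zero
  have "(\<lambda>p. h (\<lambda>q'. (0 :: vec) (Tensor p q')) q) = 0"
    unfolding slice_simps lin_zero[OF h X] by (simp add: fun_eq_iff pw)
  then show ?case using W by (simp add: cfun.subspace_0)
next
  case (add w x t)
  have "(\<lambda>p. h (\<lambda>q'. (w \<otimes>\<^sub>v x + t) (Tensor p q')) q) = vscale (h x q) w + (\<lambda>p. h (\<lambda>q'. t (Tensor p q')) q)"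
    using add(2) tensor_space_slices(2)[OF add(3) W X] h X
    by (simp add: slice_simps lin_add lin_scale cfun.subspace_scale) (simp add: fun_eq_iff pw)
  then show ?case
    using add W by (simp add: cfun.subspace_add cfun.subspace_scale)
qed

lemma tensor_fun_simple:
  assumes f: "lin W W' f" and h: "lin X X' h" and w: "w \<in> W" and x: "x \<in> X"
  shows "tensor_fun f h (w \<otimes>\<^sub>v x) = f w \<otimes>\<^sub>v h x"
proof (rule label_eqI)
  fix p q
  have "(\<lambda>p'. h (\<lambda>q'. (w \<otimes>\<^sub>v x) (Tensor p' q')) q) = vscale (h x q) w"
    unfolding slice_simps lin_scale[OF h x] by (simp add: fun_eq_iff pw)
  then show "tensor_fun f h (w \<otimes>\<^sub>v x) (Tensor p q) = (f w \<otimes>\<^sub>v h x) (Tensor p q)"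
    by (simp add: tensor_fun_simps lin_scale[OF f w]) (simp add: pw tensor_vec_simps)
qed (simp add: tensor_fun_simps tensor_vec_simps)

lemma lin_tensor_fun:
  assumes f: "lin W W' f" and h: "lin X X' h" and W: "cfun.subspace W" and X: "cfun.subspace X"
  shows "lin (tensor_space W X) (tensor_space W' X') (tensor_fun f h)"
  unfolding tensor_space_def
proof (rule lin_into)
  fix b assume "b \<in> {w \<otimes>\<^sub>v x |w x. w \<in> W \<and> x \<in> X}"
  then show "tensor_fun f h b \<in> cfun.span {w \<otimes>\<^sub>v x |w x. w \<in> W' \<and> x \<in> X'}"
    using tensor_fun_simple[OF f h] lin_in[OF f] lin_in[OF h] tensor_vec_in[of _ W' _ X']
    by (auto simp: tensor_space_def)
next
  show "lin (cfun.span {w \<otimes>\<^sub>v x |w x. w \<in> W \<and> x \<in> X}) UNIV (tensor_fun f h)"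
    unfolding tensor_space_def[symmetric]
  proof (rule linI)
    fix v w assume v: "v \<in> tensor_space W X" and w: "w \<in> tensor_space W X"
    note s = tensor_space_slices(2)[OF v W X] tensor_space_slices(2)[OF w W X]
    note i = tensor_fun_inner[OF v W X h] tensor_fun_inner[OF w W X h]
    show "tensor_fun f h (v + w) = tensor_fun f h v + tensor_fun f h w"
    proof (rule label_eqI)
      fix p q
      have "(\<lambda>p'. h (\<lambda>q'. (v + w) (Tensor p' q')) q) =
          (\<lambda>p'. h (\<lambda>q'. v (Tensor p' q')) q) + (\<lambda>p'. h (\<lambda>q'. w (Tensor p' q')) q)"
        unfolding slice_simps lin_add[OF h s] by (simp add: fun_eq_iff pw)
      then show "tensor_fun f h (v + w) (Tensor p q) = (tensor_fun f h v + tensor_fun f h w) (Tensor p q)"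
        by (simp add: tensor_fun_simps lin_add[OF f i]) (simp add: pw tensor_fun_simps)
    qed (simp add: pw tensor_fun_simps)
  next
    fix c v assume v: "v \<in> tensor_space W X"
    note s = tensor_space_slices(2)[OF v W X]
    note i = tensor_fun_inner[OF v W X h]
    show "tensor_fun f h (vscale c v) = vscale c (tensor_fun f h v)"
    proof (rule label_eqI)
      fix p q
      have "(\<lambda>p'. h (\<lambda>q'. (vscale c v) (Tensor p' q')) q) = vscale c (\<lambda>p'. h (\<lambda>q'. v (Tensor p' q')) q)"
        unfolding slice_simps lin_scale[OF h s] by (simp add: fun_eq_iff pw)
      then show "tensor_fun f h (vscale c v) (Tensor p q) = vscale c (tensor_fun f h v) (Tensor p q)"
        by (simp add: tensor_fun_simps lin_scale[OF f i]) (simp add: pw tensor_fun_simps)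
    qed (simp add: pw tensor_fun_simps)
  qed auto
qed simp

lemma tensor_fun_cong:
  assumes t: "t \<in> tensor_space W X" and W: "cfun.subspace W" and X: "cfun.subspace X" and h: "lin X X' h"
    and ff: "\<And>w. w \<in> W \<Longrightarrow> f w = f' w" and hh: "\<And>x. x \<in> X \<Longrightarrow> h x = h' x"
  shows "tensor_fun f h t = tensor_fun f' h' t"
proof (rule label_eqI)
  fix p q
  show "tensor_fun f h t (Tensor p q) = tensor_fun f' h' t (Tensor p q)"
    unfolding tensor_fun_simps hh[OF tensor_space_slices(2)[OF t W X], symmetric]
      ff[OF tensor_fun_inner[OF t W X h]] ..
qed (simp add: tensor_fun_simps)

lemma lin_eq_on_tensor:
  assumes "lin (tensor_space W X) Y f" "lin (tensor_space W X) Y' h"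
    and "\<And>w x. w \<in> W \<Longrightarrow> x \<in> X \<Longrightarrow> f (w \<otimes>\<^sub>v x) = h (w \<otimes>\<^sub>v x)" "t \<in> tensor_space W X"
  shows "f t = h t"
  by (rule lin_eq_on_span[OF assms(1,2)[unfolded tensor_space_def] _ assms(4)[unfolded tensor_space_def]])
    (use assms(3) in auto)

lemma lin_tensor_left: "x \<in> X \<Longrightarrow> lin W (tensor_space W X) (\<lambda>w. w \<otimes>\<^sub>v x)"
  and lin_tensor_right: "w \<in> W \<Longrightarrow> lin X (tensor_space W X) (\<lambda>x. w \<otimes>\<^sub>v x)"
  by (auto intro!: linI simp: tensor_vec_add tensor_vec_scale tensor_vec_in)

text \<open>With the last factor fixed, both maps are linear in the remaining tensor, which reduces
  the claim to two factors.\<close>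

lemma lin_eq_on_tensor3:
  assumes f: "lin (tensor_space (tensor_space W X) Y) U f" and h: "lin (tensor_space (tensor_space W X) Y) U' h"
    and eq: "\<And>w x y. w \<in> W \<Longrightarrow> x \<in> X \<Longrightarrow> y \<in> Y \<Longrightarrow> f ((w \<otimes>\<^sub>v x) \<otimes>\<^sub>v y) = h ((w \<otimes>\<^sub>v x) \<otimes>\<^sub>v y)"
    and t: "t \<in> tensor_space (tensor_space W X) Y"
  shows "f t = h t"
proof (rule lin_eq_on_tensor[OF f h _ t])
  fix s y assume s: "s \<in> tensor_space W X" and y: "y \<in> Y"
  show "f (s \<otimes>\<^sub>v y) = h (s \<otimes>\<^sub>v y)"
    by (rule lin_eq_on_tensor[OF lin_compose[OF lin_tensor_left[OF y] f] lin_compose[OF lin_tensor_left[OF y] h] _ s])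
      (use eq y in auto)
qed

lemma lin_eq_on_tensor3':
  assumes f: "lin (tensor_space W (tensor_space X Y)) U f" and h: "lin (tensor_space W (tensor_space X Y)) U' h"
    and eq: "\<And>w x y. w \<in> W \<Longrightarrow> x \<in> X \<Longrightarrow> y \<in> Y \<Longrightarrow> f (w \<otimes>\<^sub>v (x \<otimes>\<^sub>v y)) = h (w \<otimes>\<^sub>v (x \<otimes>\<^sub>v y))"
    and t: "t \<in> tensor_space W (tensor_space X Y)"
  shows "f t = h t"
proof (rule lin_eq_on_tensor[OF f h _ t])
  fix s w assume s: "s \<in> tensor_space X Y" and w: "w \<in> W"
  show "f (w \<otimes>\<^sub>v s) = h (w \<otimes>\<^sub>v s)"
    by (rule lin_eq_on_tensor[OF lin_compose[OF lin_tensor_right[OF w] f] lin_compose[OF lin_tensor_right[OF w] h] _ s])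
      (use eq w in auto)
qed

lemma lin_eq_on_tensor4:
  assumes f: "lin (tensor_space (tensor_space (tensor_space W X) Y) Z) U f"
    and h: "lin (tensor_space (tensor_space (tensor_space W X) Y) Z) U' h"
    and eq: "\<And>w x y z. w \<in> W \<Longrightarrow> x \<in> X \<Longrightarrow> y \<in> Y \<Longrightarrow> z \<in> Z \<Longrightarrow>
       f (((w \<otimes>\<^sub>v x) \<otimes>\<^sub>v y) \<otimes>\<^sub>v z) = h (((w \<otimes>\<^sub>v x) \<otimes>\<^sub>v y) \<otimes>\<^sub>v z)"
    and t: "t \<in> tensor_space (tensor_space (tensor_space W X) Y) Z"
  shows "f t = h t"
proof (rule lin_eq_on_tensor[OF f h _ t])
  fix s y assume s: "s \<in> tensor_space (tensor_space W X) Y" and y: "y \<in> Z"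
  show "f (s \<otimes>\<^sub>v y) = h (s \<otimes>\<^sub>v y)"
    by (rule lin_eq_on_tensor3[OF lin_compose[OF lin_tensor_left[OF y] f] lin_compose[OF lin_tensor_left[OF y] h] _ s])
      (use eq y in auto)
qed

text \<open>Applied to finite spanning sets this gives a finite spanning set of the tensor product,
  as the definition of a module demands.\<close>

lemma tensor_space_span:
  "tensor_space (cfun.span A) (cfun.span B) = cfun.span {a \<otimes>\<^sub>v b |a b. a \<in> A \<and> b \<in> B}" (is "_ = ?R")
proof
  show "?R \<subseteq> tensor_space (cfun.span A) (cfun.span B)"
    by (rule cfun.span_minimal) (auto intro!: tensor_vec_in cfun.span_base subspace_tensor_space)
  have 1: "a \<otimes>\<^sub>v x \<in> ?R" if a: "a \<in> A" and x: "x \<in> cfun.span B" for a x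
    using lin_in[OF lin_into[OF lin_tensor_right[of a UNIV "cfun.span B"]], of ?R x] a x
    by (auto intro: cfun.span_base)
  have 2: "w \<otimes>\<^sub>v x \<in> ?R" if w: "w \<in> cfun.span A" and x: "x \<in> cfun.span B" for w x
    using lin_in[OF lin_into[OF lin_tensor_left[of x UNIV "cfun.span A"]], of ?R w] 1 w x
    by auto
  then show "tensor_space (cfun.span A) (cfun.span B) \<subseteq> ?R"
    unfolding tensor_space_def by (intro cfun.span_minimal) auto
qed

section \<open>The monoidal category of modules\<close>

lemma subspace_Vspace: "cfun.subspace (Vspace N)"
  by (auto simp: cfun.subspace_def Vspace_def pw)

lemma soE:
  assumes "g \<in> so N"
  shows "lin (Vspace N) (Vspace N) g"
    and "y \<in> Vspace N \<Longrightarrow> z \<in> Vspace N \<Longrightarrow> bform N (g y) z + bform N y (g z) = 0"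
  using assms by (auto simp: so_def linear_between_iff)

lemma soI:
  assumes "lin (Vspace N) (Vspace N) g"
    "\<And>y z. y \<in> Vspace N \<Longrightarrow> z \<in> Vspace N \<Longrightarrow> bform N (g y) z + bform N y (g z) = 0"
  shows "restrict g (Vspace N) \<in> so N"
  using assms lin_cong[OF assms(1) subspace_Vspace, of "restrict g (Vspace N)"]
  by (auto simp: so_def linear_between_iff)

lemma bform_add: "bform N (y + y') z = bform N y z + bform N y' z"
    "bform N y (z + z') = bform N y z + bform N y z'"
  and bform_diff: "bform N (y - y') z = bform N y z - bform N y' z"
    "bform N y (z - z') = bform N y z - bform N y z'"
  and bform_scale: "bform N (vscale c y) z = c * bform N y z" "bform N y (vscale c z) = c * bform N y z"
  by (simp_all add: bform_def sum.distrib sum_subtractf sum_distrib_left algebra_simps pw)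

lemma so_add_in: "g \<in> so N \<Longrightarrow> h \<in> so N \<Longrightarrow> so_add N g h \<in> so N"
  unfolding so_add_def
proof (rule soI)
  fix y z assume *: "g \<in> so N" "h \<in> so N" "y \<in> Vspace N" "z \<in> Vspace N"
  show "bform N (g y + h y) z + bform N y (g z + h z) = 0"
    using soE(2)[OF *(1,3,4)] soE(2)[OF *(2,3,4)] by (simp add: bform_add) (metis add.assoc add.commute add_0)
qed (auto intro: lin_plus soE subspace_Vspace)

lemma so_scale_in: "g \<in> so N \<Longrightarrow> so_scale N c g \<in> so N"
  unfolding so_scale_def
proof (rule soI)
  fix y z assume *: "g \<in> so N" "y \<in> Vspace N" "z \<in> Vspace N"
  show "bform N (vscale c (g y)) z + bform N y (vscale c (g z)) = 0"
    using soE(2)[OF *] by (simp add: bform_scale flip: distrib_left)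
qed (auto intro: lin_vscale soE subspace_Vspace)

lemma so_bracket_in: "g \<in> so N \<Longrightarrow> h \<in> so N \<Longrightarrow> so_bracket N g h \<in> so N"
  unfolding so_bracket_def
proof (rule soI)
  fix y z assume *: "g \<in> so N" "h \<in> so N" "y \<in> Vspace N" "z \<in> Vspace N"
  have i: "g y \<in> Vspace N" "h y \<in> Vspace N" "g z \<in> Vspace N" "h z \<in> Vspace N"
    using * lin_in soE(1) by blast+
  \<comment> \<open>Skewness moves the outer operator of each of the four terms across the form; the
    results cancel in pairs.\<close>
  have "bform N (g (h y)) z = - bform N (h y) (g z)" "bform N (h (g y)) z = - bform N (g y) (h z)"
    "bform N y (g (h z)) = - bform N (g y) (h z)" "bform N y (h (g z)) = - bform N (h y) (g z)"
    using soE(2)[OF *(1) i(2) *(4)] soE(2)[OF *(2) i(1) *(4)] soE(2)[OF *(1,3) i(4)] soE(2)[OF *(2,3) i(3)]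
    by (simp_all add: eq_neg_iff_add_eq_0 add.commute)
  then show "bform N (g (h y) - h (g y)) z + bform N y (g (h z) - h (g z)) = 0"
    by (simp add: bform_diff)
qed (auto intro!: lin_minus intro: lin_compose soE subspace_Vspace)

section \<open>Modules and equivariant maps\<close>

lemma so_moduleD:
  assumes "is_so_module N M"
  shows "\<exists>B. finite B \<and> underlying M = cfun.span B" and "cfun.subspace (underlying M)"
    and "g \<in> so N \<Longrightarrow> lin (underlying M) (underlying M) (act M g)"
    and "g \<in> so N \<Longrightarrow> w \<in> underlying M \<Longrightarrow> act M g w \<in> underlying M"
    and "g \<in> so N \<Longrightarrow> h \<in> so N \<Longrightarrow> w \<in> underlying M \<Longrightarrow> act M (so_add N g h) w = act M g w + act M h w"
    and "g \<in> so N \<Longrightarrow> w \<in> underlying M \<Longrightarrow> act M (so_scale N c g) w = vscale c (act M g w)"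
    and "g \<in> so N \<Longrightarrow> h \<in> so N \<Longrightarrow> w \<in> underlying M \<Longrightarrow>
      act M (so_bracket N g h) w = act M g (act M h w) - act M h (act M g w)"
  using assms unfolding is_so_module_def PiE_iff linear_between_iff by (auto dest: lin_in)

lemma so_moduleI:
  assumes "finite B" "U = cfun.span B"
    and "\<And>g. g \<in> so N \<Longrightarrow> lin U U (a g)"
    and "\<And>g h w. g \<in> so N \<Longrightarrow> h \<in> so N \<Longrightarrow> w \<in> U \<Longrightarrow> a (so_add N g h) w = a g w + a h w"
    and "\<And>g c w. g \<in> so N \<Longrightarrow> w \<in> U \<Longrightarrow> a (so_scale N c g) w = vscale c (a g w)"
    and "\<And>g h w. g \<in> so N \<Longrightarrow> h \<in> so N \<Longrightarrow> w \<in> U \<Longrightarrow>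
      a (so_bracket N g h) w = a g (a h w) - a h (a g w)"
  shows "is_so_module N \<lparr>underlying = U, act = (\<lambda>g\<in>so N. \<lambda>w\<in>U. a g w)\<rparr>"
proof -
  have "lin U U (\<lambda>w\<in>U. a g w)" if "g \<in> so N" for g
    using lin_cong[OF assms(3)[OF that]] assms(2) by (simp add: restrict_def)
  moreover have "a g w \<in> U" if "g \<in> so N" "w \<in> U" for g w
    using lin_in[OF assms(3)] that by blast
  ultimately show ?thesis
    unfolding is_so_module_def using assms(1,2,4-6)
    by (auto simp: linear_between_iff so_add_in so_scale_in so_bracket_in)
qed

text \<open>Every arrow of \<open>so_maps\<close> has this form. Proofs can then work with functions
  that are arbitrary outside the source, and equality of arrows becomes equality on the
  source.\<close>

definition mk :: "so_module \<Rightarrow> so_module \<Rightarrow> (vec \<Rightarrow> vec) \<Rightarrow> so_map" where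
  "mk M M' f = \<lparr>src = M, tgt = M', arrow_map = restrict f (underlying M)\<rparr>"

definition equivariant :: "nat \<Rightarrow> so_module \<Rightarrow> so_module \<Rightarrow> (vec \<Rightarrow> vec) \<Rightarrow> bool" where
  "equivariant N M M' f \<longleftrightarrow> lin (underlying M) (underlying M') f \<and>
     (\<forall>g\<in>so N. \<forall>w\<in>underlying M. f (act M g w) = act M' g (f w))"

lemma mk_simps [simp]: "src (mk M M' f) = M" "tgt (mk M M' f) = M'"
  "w \<in> underlying M \<Longrightarrow> arrow_map (mk M M' f) w = f w"
  by (simp_all add: mk_def)

lemma mk_cong: "(\<And>w. w \<in> underlying M \<Longrightarrow> f w = h w) \<Longrightarrow> mk M M' f = mk M M' h"
  by (auto simp: mk_def)

lemma equivariantD: "equivariant N M M' f \<Longrightarrow> lin (underlying M) (underlying M') f"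
  "equivariant N M M' f \<Longrightarrow> w \<in> underlying M \<Longrightarrow> f w \<in> underlying M'"
  "equivariant N M M' f \<Longrightarrow> g \<in> so N \<Longrightarrow> w \<in> underlying M \<Longrightarrow> f (act M g w) = act M' g (f w)"
  by (auto simp: equivariant_def lin_in)

lemma mk_in_so_maps:
  assumes "is_so_module N M" "equivariant N M M' f"
  shows "mk M M' f \<in> so_maps N M M'"
proof -
  have "lin (underlying M) (underlying M') (restrict f (underlying M))"
    by (rule lin_cong[OF equivariantD(1)[OF assms(2)] so_moduleD(2)[OF assms(1)]]) simp
  then show ?thesis
    using assms so_moduleD(4)[OF assms(1)]
    unfolding so_maps_def linear_between_iff by (simp add: equivariantD mk_def)
qed

lemma so_mapsE:
  assumes "f \<in> so_maps N M M'"
  obtains h where "f = mk M M' h" "equivariant N M M' h"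
proof
  show "f = mk M M' (arrow_map f)" "equivariant N M M' (arrow_map f)"
    using assms by (auto simp: so_maps_def equivariant_def linear_between_iff mk_def extensional_restrict)
qed

lemma so_mod_simps:
  "Ob (so_mod N) = {M. is_so_module N M}"
  "Arrows (so_mod N) = so_maps N"
  "ide (so_mod N) M = mk M M (\<lambda>w. w)"
  "zero_ar (so_mod N) M M' = mk M M' (\<lambda>w. 0)"
  "add_ar (so_mod N) (mk M M' f) (mk M M' h) = mk M M' (\<lambda>w. f w + h w)"
  "scale_ar (so_mod N) c (mk M M' f) = mk M M' (\<lambda>w. vscale c (f w))"
  "tensor_ob (so_mod N) = tensor_module N"
  "unit_ob (so_mod N) = trivial_module N"
  "assoc (so_mod N) M M' M'' = mk (tensor_module N (tensor_module N M M') M'')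
       (tensor_module N M (tensor_module N M' M'')) assoc_fun"
  "lunit (so_mod N) M = mk (tensor_module N (trivial_module N) M) M (\<lambda>t p. t (Tensor (Idx []) p))"
  "runit (so_mod N) M = mk (tensor_module N M (trivial_module N)) M (\<lambda>t p. t (Tensor p (Idx [])))"
  by (auto simp: so_mod_def mk_def)

lemma cmp_mk:
  "equivariant N M M' h \<Longrightarrow> cmp (so_mod N) (mk M' M'' f) (mk M M' h) = mk M M'' (\<lambda>w. f (h w))"
  by (auto simp: so_mod_def mk_def equivariantD)

lemma underlying_tensor: "underlying (tensor_module N M M') = tensor_space (underlying M) (underlying M')"
  by (simp add: tensor_module_def)

lemma tensor_mk:
  assumes "is_so_module N M" "is_so_module N M'" "equivariant N M' K' h"
  shows "tensor_ar (so_mod N) (mk M K f) (mk M' K' h) =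
    mk (tensor_module N M M') (tensor_module N K K') (tensor_fun f h)"
proof -
  have "lin (underlying M') (underlying K') (restrict h (underlying M'))"
    by (rule lin_cong[OF equivariantD(1)[OF assms(3)] so_moduleD(2)[OF assms(2)]]) simp
  then have "tensor_fun (restrict f (underlying M)) (restrict h (underlying M')) t = tensor_fun f h t"
    if "t \<in> tensor_space (underlying M) (underlying M')" for t
    by (intro tensor_fun_cong[OF that so_moduleD(2)[OF assms(1)] so_moduleD(2)[OF assms(2)]]) auto
  then show ?thesis
    by (auto simp: so_mod_def mk_def underlying_tensor)
qed

lemma act_tensor:
  assumes "is_so_module N M" "is_so_module N M'" "g \<in> so N" "w \<in> underlying M" "x \<in> underlying M'"
  shows "act (tensor_module N M M') g (w \<otimes>\<^sub>v x) = act M g w \<otimes>\<^sub>v x + w \<otimes>\<^sub>v act M' g x"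
  using assms tensor_vec_in[OF assms(4,5)]
    tensor_fun_simple[OF so_moduleD(3)[OF assms(1,3)] lin_id[OF subset_UNIV] assms(4,5)]
    tensor_fun_simple[OF lin_id[OF subset_UNIV] so_moduleD(3)[OF assms(2,3)] assms(4,5)]
  by (simp add: tensor_module_def)

lemma is_so_module_tensor:
  assumes M: "is_so_module N M" and M': "is_so_module N M'"
  shows "is_so_module N (tensor_module N M M')"
proof -
  let ?U = "underlying M" and ?U' = "underlying M'"
  note sub = so_moduleD(2)[OF M] so_moduleD(2)[OF M']
  let ?a = "\<lambda>g t. tensor_fun (act M g) (\<lambda>x. x) t + tensor_fun (\<lambda>w. w) (act M' g) t"
  obtain B where B: "finite B" "?U = cfun.span B" using so_moduleD(1)[OF M] by auto
  obtain B' where B': "finite B'" "?U' = cfun.span B'" using so_moduleD(1)[OF M'] by auto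
  have span: "tensor_space ?U ?U' = cfun.span {a \<otimes>\<^sub>v b |a b. a \<in> B \<and> b \<in> B'}"
    using B B' by (simp add: tensor_space_span)
  have "{a \<otimes>\<^sub>v b |a b. a \<in> B \<and> b \<in> B'} = (\<lambda>(a, b). a \<otimes>\<^sub>v b) ` (B \<times> B')" by auto
  then have fin: "finite {a \<otimes>\<^sub>v b |a b. a \<in> B \<and> b \<in> B'}" using B B' by simp
  have lin: "lin (tensor_space ?U ?U') (tensor_space ?U ?U') (?a g)" if "g \<in> so N" for g
    by (intro lin_plus lin_tensor_fun so_moduleD(3)[OF M that] so_moduleD(3)[OF M' that] lin_id sub
        subset_refl subspace_tensor_space)
  have a: "?a g (w \<otimes>\<^sub>v x) = act M g w \<otimes>\<^sub>v x + w \<otimes>\<^sub>v act M' g x"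
    if "g \<in> so N" "w \<in> ?U" "x \<in> ?U'" for g w x
    using tensor_fun_simple[OF so_moduleD(3)[OF M that(1)] lin_id[OF subset_UNIV] that(2,3)]
      tensor_fun_simple[OF lin_id[OF subset_UNIV] so_moduleD(3)[OF M' that(1)] that(2,3)]
    by simp
  note acts = so_moduleD(4)[OF M] so_moduleD(4)[OF M']
  show ?thesis
    unfolding tensor_module_def
  proof (rule so_moduleI[OF fin span lin])
    fix g h t assume g: "g \<in> so N" and h: "h \<in> so N" and t: "t \<in> tensor_space ?U ?U'"
    show "?a (so_add N g h) t = ?a g t + ?a h t"
    proof (rule lin_eq_on_tensor[OF lin lin_plus[OF lin lin subspace_tensor_space] _ t])
      fix w x assume "w \<in> ?U" "x \<in> ?U'"
      then show "?a (so_add N g h) (w \<otimes>\<^sub>v x) = ?a g (w \<otimes>\<^sub>v x) + ?a h (w \<otimes>\<^sub>v x)"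
        unfolding a[OF g \<open>w \<in> ?U\<close> \<open>x \<in> ?U'\<close>] a[OF h \<open>w \<in> ?U\<close> \<open>x \<in> ?U'\<close>]
          a[OF so_add_in[OF g h] \<open>w \<in> ?U\<close> \<open>x \<in> ?U'\<close>]
        using g h so_moduleD(5)[OF M] so_moduleD(5)[OF M'] by (simp add: tensor_vec_add)
    qed (use g h so_add_in in auto)
    show "?a (so_bracket N g h) t = ?a g (?a h t) - ?a h (?a g t)"
    proof (rule lin_eq_on_tensor[OF lin lin_minus[OF lin_compose[OF lin lin] lin_compose[OF lin lin] subspace_tensor_space] _ t])
      fix w x assume w: "w \<in> ?U" and x: "x \<in> ?U'"
      have l: "?a g (u + v) = ?a g u + ?a g v" "?a h (u + v) = ?a h u + ?a h v"
        if "u \<in> tensor_space ?U ?U'" "v \<in> tensor_space ?U ?U'" for u v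
        using lin_add[OF lin[OF g] that] lin_add[OF lin[OF h] that] .
      show "?a (so_bracket N g h) (w \<otimes>\<^sub>v x) = ?a g (?a h (w \<otimes>\<^sub>v x)) - ?a h (?a g (w \<otimes>\<^sub>v x))"
        unfolding a[OF g w x] a[OF h w x] a[OF so_bracket_in[OF g h] w x]
        using g h w x so_moduleD(7)[OF M g h w] so_moduleD(7)[OF M' g h x]
        by (simp add: l a acts tensor_vec_in) (rule label_eqI; simp add: pw tensor_vec_simps algebra_simps)
    qed (use g h so_bracket_in in auto)
  next
    fix g c t assume g: "g \<in> so N" and t: "t \<in> tensor_space ?U ?U'"
    show "?a (so_scale N c g) t = vscale c (?a g t)"
    proof (rule lin_eq_on_tensor[OF lin lin_vscale[OF lin subspace_tensor_space] _ t])
      fix w x assume w: "w \<in> ?U" and x: "x \<in> ?U'"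
      show "?a (so_scale N c g) (w \<otimes>\<^sub>v x) = vscale c (?a g (w \<otimes>\<^sub>v x))"
        unfolding a[OF g w x] a[OF so_scale_in[OF g] w x]
        using g so_moduleD(6)[OF M g w] so_moduleD(6)[OF M' g x]
        by (simp add: tensor_vec_scale cfun.scale_right_distrib)
    qed (use g so_scale_in in auto)
  qed
qed

lemma is_so_module_trivial: "is_so_module N (trivial_module N)"
  unfolding trivial_module_def
  by (rule so_moduleI[of "{unit_tensor}"]) (auto intro: lin_const_zero simp: fun_eq_iff)

lemma equivariant_id: "is_so_module N M \<Longrightarrow> equivariant N M M (\<lambda>w. w)"
  by (simp add: equivariant_def lin_id)

lemma equivariant_compose: "equivariant N M M' h \<Longrightarrow> equivariant N M' M'' f \<Longrightarrow> equivariant N M M'' (\<lambda>w. f (h w))"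
  by (auto simp: equivariant_def lin_in intro: lin_compose)

lemma equivariant_zero: "is_so_module N M' \<Longrightarrow> equivariant N M M' (\<lambda>w. 0)"
  using lin_zero[OF so_moduleD(3) so_moduleD(2)] by (auto simp: equivariant_def intro!: lin_const_zero so_moduleD(2))

lemma equivariant_plus: "is_so_module N M' \<Longrightarrow> equivariant N M M' f \<Longrightarrow> equivariant N M M' h \<Longrightarrow> equivariant N M M' (\<lambda>w. f w + h w)"
  using lin_add[OF so_moduleD(3)] by (auto simp: equivariant_def lin_in intro!: lin_plus so_moduleD(2))

lemma equivariant_scale: "is_so_module N M' \<Longrightarrow> equivariant N M M' f \<Longrightarrow> equivariant N M M' (\<lambda>w. vscale c (f w))"
  using lin_scale[OF so_moduleD(3)] by (auto simp: equivariant_def lin_in intro!: lin_vscale so_moduleD(2))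

text \<open>Both sides are linear in the tensor, so only simple tensors have to be compared, and on
  these the action is given by the Leibniz rule.\<close>

lemma equivariant_tensorI:
  assumes M: "is_so_module N M" and M': "is_so_module N M'" and K: "is_so_module N K"
    and lin: "lin (underlying (tensor_module N M M')) (underlying K) f"
    and eq: "\<And>g w x. g \<in> so N \<Longrightarrow> w \<in> underlying M \<Longrightarrow> x \<in> underlying M' \<Longrightarrow>
      f (act M g w \<otimes>\<^sub>v x) + f (w \<otimes>\<^sub>v act M' g x) = act K g (f (w \<otimes>\<^sub>v x))"
  shows "equivariant N (tensor_module N M M') K f"
proof -
  have "f (act (tensor_module N M M') g t) = act K g (f t)"
    if g: "g \<in> so N" and t: "t \<in> underlying (tensor_module N M M')" for g t
  proof (rule lin_eq_on_tensor[OF _ _ _ t[unfolded underlying_tensor]])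
    show "lin (tensor_space (underlying M) (underlying M')) (underlying K) (\<lambda>t. f (act (tensor_module N M M') g t))"
      "lin (tensor_space (underlying M) (underlying M')) (underlying K) (\<lambda>t. act K g (f t))"
      using lin_compose[OF so_moduleD(3)[OF is_so_module_tensor[OF M M'] g] lin]
        lin_compose[OF lin so_moduleD(3)[OF K g]] by (simp_all add: underlying_tensor)
    fix w x assume w: "w \<in> underlying M" and x: "x \<in> underlying M'"
    then show "f (act (tensor_module N M M') g (w \<otimes>\<^sub>v x)) = act K g (f (w \<otimes>\<^sub>v x))"
      using eq[OF g w x] lin_add[OF lin]
      by (simp add: act_tensor[OF M M' g] underlying_tensor tensor_vec_in so_moduleD(4)[OF M g] so_moduleD(4)[OF M' g])
  qed
  then show ?thesis using lin by (simp add: equivariant_def)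
qed

lemma equivariant_tensor_fun:
  assumes M: "is_so_module N M" and M': "is_so_module N M'" and K: "is_so_module N K" and K': "is_so_module N K'"
    and f: "equivariant N M K f" and h: "equivariant N M' K' h"
  shows "equivariant N (tensor_module N M M') (tensor_module N K K') (tensor_fun f h)"
proof (rule equivariant_tensorI[OF M M' is_so_module_tensor[OF K K']])
  show "lin (underlying (tensor_module N M M')) (underlying (tensor_module N K K')) (tensor_fun f h)"
    unfolding underlying_tensor using M M' f h by (intro lin_tensor_fun equivariantD so_moduleD(2))
  fix g w x assume g: "g \<in> so N" and w: "w \<in> underlying M" and x: "x \<in> underlying M'"
  show "tensor_fun f h (act M g w \<otimes>\<^sub>v x) + tensor_fun f h (w \<otimes>\<^sub>v act M' g x) =
      act (tensor_module N K K') g (tensor_fun f h (w \<otimes>\<^sub>v x))"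
    using g w x f h
    by (simp add: tensor_fun_simple[OF equivariantD(1) equivariantD(1)] act_tensor[OF K K'] equivariantD so_moduleD(4)[OF M g]
        so_moduleD(4)[OF M' g])
qed


section \<open>Associators and unit isomorphisms of modules\<close>

lemma iso_mk:
  assumes "is_so_module N M" "is_so_module N M'" "equivariant N M M' f" "equivariant N M' M h"
    "\<And>w. w \<in> underlying M \<Longrightarrow> h (f w) = w" "\<And>w. w \<in> underlying M' \<Longrightarrow> f (h w) = w"
  shows "iso_ar (so_mod N) M M' (mk M M' f)"
  unfolding iso_ar_def
  using assms by (auto simp: so_mod_simps cmp_mk[OF assms(3)] cmp_mk[OF assms(4)] mk_in_so_maps
      intro!: bexI[of _ "mk M' M h"] mk_cong)

lemma assoc_fun_tensor: "assoc_fun ((w \<otimes>\<^sub>v x) \<otimes>\<^sub>v y) = w \<otimes>\<^sub>v (x \<otimes>\<^sub>v y)"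
proof (rule label_eqI)
  fix p q
  show "assoc_fun ((w \<otimes>\<^sub>v x) \<otimes>\<^sub>v y) (Tensor p q) = (w \<otimes>\<^sub>v (x \<otimes>\<^sub>v y)) (Tensor p q)"
    by (cases q) (simp_all add: assoc_fun_simps tensor_vec_simps)
qed (simp add: assoc_fun_simps tensor_vec_simps)

definition unassoc_fun :: "vec \<Rightarrow> vec" where
  "unassoc_fun t = (\<lambda>l. case l of Tensor (Tensor p q) r \<Rightarrow> t (Tensor p (Tensor q r)) | _ \<Rightarrow> 0)"

lemma unassoc_fun_simps: "unassoc_fun t (Idx k) = 0" "unassoc_fun t (Tensor (Idx k) r) = 0"
  "unassoc_fun t (Tensor (Tensor p q) r) = t (Tensor p (Tensor q r))"
  by (simp_all add: unassoc_fun_def)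

lemma unassoc_fun_tensor: "unassoc_fun (w \<otimes>\<^sub>v (x \<otimes>\<^sub>v y)) = (w \<otimes>\<^sub>v x) \<otimes>\<^sub>v y"
proof (rule label_eqI)
  fix p q
  show "unassoc_fun (w \<otimes>\<^sub>v (x \<otimes>\<^sub>v y)) (Tensor p q) = ((w \<otimes>\<^sub>v x) \<otimes>\<^sub>v y) (Tensor p q)"
    by (cases p) (simp_all add: unassoc_fun_simps tensor_vec_simps)
qed (simp add: unassoc_fun_simps tensor_vec_simps)

lemma tensor_space_span_left:
  "cfun.subspace X \<Longrightarrow> tensor_space (cfun.span A) X = cfun.span {a \<otimes>\<^sub>v x |a x. a \<in> A \<and> x \<in> X}"
  using tensor_space_span[of A X] by (simp add: cfun.span_eq_iff[THEN iffD2])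

lemma tensor_space_span_right:
  "cfun.subspace W \<Longrightarrow> tensor_space W (cfun.span B) = cfun.span {w \<otimes>\<^sub>v b |w b. w \<in> W \<and> b \<in> B}"
  using tensor_space_span[of W B] by (simp add: cfun.span_eq_iff[THEN iffD2])

lemma lin_assoc_fun:
  assumes "cfun.subspace Y"
  shows "lin (tensor_space (tensor_space W X) Y) (tensor_space W (tensor_space X Y)) assoc_fun"
proof -
  have "lin UNIV UNIV assoc_fun"
    by (rule linI) (auto simp: assoc_fun_def pw fun_eq_iff split: label.split)
  then have "lin (tensor_space (tensor_space W X) Y) UNIV assoc_fun"
    by (rule lin_weaken) auto
  \<comment> \<open>With simple tensors as left factors the generators become pure triple tensors,
    on which \<open>assoc_fun\<close> is known.\<close>
  moreover have "tensor_space (tensor_space W X) Y =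
      cfun.span {s \<otimes>\<^sub>v y |s y. s \<in> {w \<otimes>\<^sub>v x |w x. w \<in> W \<and> x \<in> X} \<and> y \<in> Y}"
      (is "?T = cfun.span ?S")
    using tensor_space_span_left[OF assms] by (simp add: tensor_space_def)
  ultimately have eq: "lin (cfun.span ?S) UNIV assoc_fun" and S: "?T = cfun.span ?S"
    by simp_all
  show ?thesis
    unfolding S by (rule lin_into[OF eq subspace_tensor_space]) (auto simp: assoc_fun_tensor tensor_vec_in)
qed

lemma lin_unassoc_fun:
  assumes "cfun.subspace W"
  shows "lin (tensor_space W (tensor_space X Y)) (tensor_space (tensor_space W X) Y) unassoc_fun"
proof -
  have "lin UNIV UNIV unassoc_fun"
    by (rule linI) (auto simp: unassoc_fun_def pw fun_eq_iff split: label.split)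
  then have "lin (tensor_space W (tensor_space X Y)) UNIV unassoc_fun"
    by (rule lin_weaken) auto
  moreover have "tensor_space W (tensor_space X Y) =
      cfun.span {w \<otimes>\<^sub>v s |w s. w \<in> W \<and> s \<in> {w \<otimes>\<^sub>v x |w x. w \<in> X \<and> x \<in> Y}}"
      (is "?T = cfun.span ?S")
    using tensor_space_span_right[OF assms] by (simp add: tensor_space_def)
  ultimately have eq: "lin (cfun.span ?S) UNIV unassoc_fun" and S: "?T = cfun.span ?S"
    by simp_all
  show ?thesis
    unfolding S by (rule lin_into[OF eq subspace_tensor_space]) (auto simp: unassoc_fun_tensor tensor_vec_in)
qed

lemma equivariant_assoc_fun:
  assumes M: "is_so_module N M" and M': "is_so_module N M'" and M'': "is_so_module N M''"
  shows "equivariant N (tensor_module N (tensor_module N M M') M'') (tensor_module N M (tensor_module N M' M'')) assoc_fun"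
    (is "equivariant N ?S ?T _")
proof -
  note S = is_so_module_tensor[OF is_so_module_tensor[OF M M'] M'']
  note T = is_so_module_tensor[OF M is_so_module_tensor[OF M' M'']]
  have lin: "lin (underlying ?S) (underlying ?T) assoc_fun"
    unfolding underlying_tensor by (rule lin_assoc_fun[OF so_moduleD(2)[OF M'']])
  have "assoc_fun (act ?S g t) = act ?T g (assoc_fun t)" if g: "g \<in> so N" and t: "t \<in> underlying ?S" for g t
  proof (rule lin_eq_on_tensor3[OF lin_compose[OF so_moduleD(3)[OF S g] lin, unfolded underlying_tensor]
        lin_compose[OF lin so_moduleD(3)[OF T g], unfolded underlying_tensor] _ t[unfolded underlying_tensor]])
    fix w x y assume *: "w \<in> underlying M" "x \<in> underlying M'" "y \<in> underlying M''"
    then show "assoc_fun (act ?S g ((w \<otimes>\<^sub>v x) \<otimes>\<^sub>v y)) = act ?T g (assoc_fun ((w \<otimes>\<^sub>v x) \<otimes>\<^sub>v y))"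
      using so_moduleD(4)[OF M g *(1)] so_moduleD(4)[OF M' g *(2)] so_moduleD(4)[OF M'' g *(3)]
        lin_add[OF lin]
      by (simp add: assoc_fun_tensor act_tensor[OF is_so_module_tensor[OF M M'] M'' g] act_tensor[OF M M' g]
          act_tensor[OF M is_so_module_tensor[OF M' M''] g] act_tensor[OF M' M'' g] underlying_tensor
          tensor_vec_in tensor_vec_add cfun.subspace_add[OF subspace_tensor_space])
  qed
  then show ?thesis using lin by (simp add: equivariant_def)
qed

lemma equivariant_inverse:
  assumes M': "is_so_module N M'" and f: "equivariant N M M' f" and h: "lin (underlying M') (underlying M) h"
    and "is_so_module N M"
    and fh: "\<And>w. w \<in> underlying M \<Longrightarrow> h (f w) = w" "\<And>w. w \<in> underlying M' \<Longrightarrow> f (h w) = w"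
  shows "equivariant N M' M h"
  unfolding equivariant_def
proof (intro conjI ballI h)
  fix g w assume "g \<in> so N" "w \<in> underlying M'"
  then show "h (act M' g w) = act M g (h w)"
    using fh equivariantD[OF f] lin_in[OF h] so_moduleD(4)[OF assms(4)] by metis
qed

lemma iso_mkI:
  assumes "is_so_module N M" "is_so_module N M'" "equivariant N M M' f" "lin (underlying M') (underlying M) h"
    "\<And>w. w \<in> underlying M \<Longrightarrow> h (f w) = w" "\<And>w. w \<in> underlying M' \<Longrightarrow> f (h w) = w"
  shows "iso_ar (so_mod N) M M' (mk M M' f)"
  using assms equivariant_inverse[OF assms(2-4,1,5,6)] by (intro iso_mk) auto

lemma iso_assoc:
  assumes M: "is_so_module N M" and M': "is_so_module N M'" and M'': "is_so_module N M''"
  shows "iso_ar (so_mod N) (tensor_module N (tensor_module N M M') M'')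
     (tensor_module N M (tensor_module N M' M'')) (assoc (so_mod N) M M' M'')"
  unfolding so_mod_simps
proof (rule iso_mkI)
  let ?W = "underlying M" and ?X = "underlying M'" and ?Y = "underlying M''"
  note la = lin_assoc_fun[OF so_moduleD(2)[OF M''], of ?W ?X]
    and lu = lin_unassoc_fun[OF so_moduleD(2)[OF M], of ?X ?Y]
  show "lin (underlying (tensor_module N M (tensor_module N M' M'')))
     (underlying (tensor_module N (tensor_module N M M') M'')) unassoc_fun"
    unfolding underlying_tensor by (rule lu)
  show "unassoc_fun (assoc_fun t) = t" if "t \<in> underlying (tensor_module N (tensor_module N M M') M'')" for t
    by (rule lin_eq_on_tensor3[OF lin_compose[OF la lu] lin_id[OF subset_refl] _ that[unfolded underlying_tensor]])
      (simp add: assoc_fun_tensor unassoc_fun_tensor)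
  show "assoc_fun (unassoc_fun t) = t" if "t \<in> underlying (tensor_module N M (tensor_module N M' M''))" for t
    by (rule lin_eq_on_tensor3'[OF lin_compose[OF lu la] lin_id[OF subset_refl] _ that[unfolded underlying_tensor]])
      (simp add: assoc_fun_tensor unassoc_fun_tensor)
qed (use assms in \<open>auto intro: is_so_module_tensor equivariant_assoc_fun\<close>)

lemma underlying_trivial: "underlying (trivial_module N) = cfun.span {unit_tensor}"
  by (simp add: trivial_module_def)

lemma act_trivial: "g \<in> so N \<Longrightarrow> w \<in> underlying (trivial_module N) \<Longrightarrow> act (trivial_module N) g w = 0"
  by (simp add: trivial_module_def)

lemma unit_tensor_simps: "unit_tensor (Idx []) = 1" "unit_tensor (Tensor p q) = 0"
  by (simp_all add: unit_tensor_def)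

lemma span_unit: "w \<in> cfun.span {unit_tensor} \<longleftrightarrow> (\<exists>c. w = vscale c unit_tensor)"
  by (auto simp: cfun.span_singleton)

lemma lunit_tensor: "(\<lambda>p. (vscale c unit_tensor \<otimes>\<^sub>v x) (Tensor (Idx []) p)) = vscale c x"
  and runit_tensor: "(\<lambda>p. (x \<otimes>\<^sub>v vscale c unit_tensor) (Tensor p (Idx []))) = vscale c x"
  by (auto simp: slice_simps pw unit_tensor_simps)

lemma iso_lunit:
  assumes M: "is_so_module N M"
  shows "equivariant N (tensor_module N (trivial_module N) M) M (\<lambda>t p. t (Tensor (Idx []) p))" (is "equivariant N ?S M ?f")
    and "iso_ar (so_mod N) (tensor_module N (trivial_module N) M) M (lunit (so_mod N) M)"
proof -
  note S = is_so_module_tensor[OF is_so_module_trivial M]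
  have u: "cfun.subspace (cfun.span {unit_tensor})" by simp
  have lin: "lin (underlying ?S) (underlying M) ?f"
    unfolding underlying_tensor underlying_trivial
    by (rule linI) (auto simp: slice_simps tensor_space_slices(2)[OF _ u so_moduleD(2)[OF M]])
  show h: "equivariant N ?S M ?f"
  proof (rule equivariant_tensorI[OF is_so_module_trivial M M lin])
    fix g w x assume g: "g \<in> so N" and w: "w \<in> underlying (trivial_module N)" and x: "x \<in> underlying M"
    then obtain c where c: "w = vscale c unit_tensor" by (auto simp: underlying_trivial span_unit)
    show "?f (act (trivial_module N) g w \<otimes>\<^sub>v x) + ?f (w \<otimes>\<^sub>v act M g x) = act M g (?f (w \<otimes>\<^sub>v x))"
      unfolding act_trivial[OF g w] unfolding c lunit_tensor tensor_vec_zero slice_simps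
      using lin_scale[OF so_moduleD(3)[OF M g] x] by simp
  qed
  have lin': "lin (underlying M) (underlying ?S) (\<lambda>x. unit_tensor \<otimes>\<^sub>v x)"
    unfolding underlying_tensor underlying_trivial by (rule lin_tensor_right) (simp add: cfun.span_base)
  show "iso_ar (so_mod N) ?S M (lunit (so_mod N) M)"
    unfolding so_mod_simps
  proof (rule iso_mkI[OF S M h lin'])
    show "?f (unit_tensor \<otimes>\<^sub>v w) = w" for w
      using lunit_tensor[of 1 w] by simp
    fix t assume t: "t \<in> underlying ?S"
    show "unit_tensor \<otimes>\<^sub>v ?f t = t"
    proof (rule lin_eq_on_tensor[OF lin_compose[OF lin lin', unfolded underlying_tensor] lin_id[OF subset_refl]
          _ t[unfolded underlying_tensor]])
      fix w x assume "w \<in> underlying (trivial_module N)"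
      then obtain c where c: "w = vscale c unit_tensor" by (auto simp: underlying_trivial span_unit)
      show "unit_tensor \<otimes>\<^sub>v ?f (w \<otimes>\<^sub>v x) = w \<otimes>\<^sub>v x"
        unfolding c lunit_tensor unfolding tensor_vec_scale ..
    qed
  qed
qed

lemma iso_runit:
  assumes M: "is_so_module N M"
  shows "equivariant N (tensor_module N M (trivial_module N)) M (\<lambda>t p. t (Tensor p (Idx [])))" (is "equivariant N ?S M ?f")
    and "iso_ar (so_mod N) (tensor_module N M (trivial_module N)) M (runit (so_mod N) M)"
proof -
  note S = is_so_module_tensor[OF M is_so_module_trivial]
  have u: "cfun.subspace (cfun.span {unit_tensor})" by simp
  have lin: "lin (underlying ?S) (underlying M) ?f"
    unfolding underlying_tensor underlying_trivial
    by (rule linI) (auto simp: slice_simps tensor_space_slices(3)[OF _ so_moduleD(2)[OF M] u])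
  show h: "equivariant N ?S M ?f"
  proof (rule equivariant_tensorI[OF M is_so_module_trivial M lin])
    fix g w x assume g: "g \<in> so N" and w: "w \<in> underlying (trivial_module N)" and x: "x \<in> underlying M"
    then obtain c where c: "w = vscale c unit_tensor" by (auto simp: underlying_trivial span_unit)
    show "?f (act M g x \<otimes>\<^sub>v w) + ?f (x \<otimes>\<^sub>v act (trivial_module N) g w) = act M g (?f (x \<otimes>\<^sub>v w))"
      unfolding act_trivial[OF g w] unfolding c runit_tensor tensor_vec_zero slice_simps
      using lin_scale[OF so_moduleD(3)[OF M g] x] by simp
  qed
  have lin': "lin (underlying M) (underlying ?S) (\<lambda>x. x \<otimes>\<^sub>v unit_tensor)"
    unfolding underlying_tensor underlying_trivial by (rule lin_tensor_left) (simp add: cfun.span_base)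
  show "iso_ar (so_mod N) ?S M (runit (so_mod N) M)"
    unfolding so_mod_simps
  proof (rule iso_mkI[OF S M h lin'])
    show "?f (w \<otimes>\<^sub>v unit_tensor) = w" for w
      using runit_tensor[of w 1] by simp
    fix t assume t: "t \<in> underlying ?S"
    show "?f t \<otimes>\<^sub>v unit_tensor = t"
    proof (rule lin_eq_on_tensor[OF lin_compose[OF lin lin', unfolded underlying_tensor] lin_id[OF subset_refl]
          _ t[unfolded underlying_tensor]])
      fix w x assume "x \<in> underlying (trivial_module N)"
      then obtain c where c: "x = vscale c unit_tensor" by (auto simp: underlying_trivial span_unit)
      show "?f (w \<otimes>\<^sub>v x) \<otimes>\<^sub>v unit_tensor = w \<otimes>\<^sub>v x"
        unfolding c runit_tensor unfolding tensor_vec_scale ..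
    qed
  qed
qed


lemma mk_in_iff: "is_so_module N M \<Longrightarrow> f \<in> so_maps N M M' \<longleftrightarrow> (\<exists>h. f = mk M M' h \<and> equivariant N M M' h)"
  by (auto elim: so_mapsE intro: mk_in_so_maps)

lemma mk_tensor_eq:
  assumes "is_so_module N M" "is_so_module N M'"
    and "equivariant N (tensor_module N M M') K f" "equivariant N (tensor_module N M M') K h"
    and "\<And>w x. w \<in> underlying M \<Longrightarrow> x \<in> underlying M' \<Longrightarrow> f (w \<otimes>\<^sub>v x) = h (w \<otimes>\<^sub>v x)"
  shows "mk (tensor_module N M M') K f = mk (tensor_module N M M') K h"
proof (rule mk_cong)
  fix t assume t: "t \<in> underlying (tensor_module N M M')"
  show "f t = h t"
    by (rule lin_eq_on_tensor[OF equivariantD(1)[OF assms(3), unfolded underlying_tensor]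
      equivariantD(1)[OF assms(4), unfolded underlying_tensor] assms(5) t[unfolded underlying_tensor]])
qed

lemma mk_tensor3_eq:
  assumes "equivariant N (tensor_module N (tensor_module N M M') M'') K f"
      "equivariant N (tensor_module N (tensor_module N M M') M'') K h"
    and "\<And>w x y. w \<in> underlying M \<Longrightarrow> x \<in> underlying M' \<Longrightarrow> y \<in> underlying M'' \<Longrightarrow>
      f ((w \<otimes>\<^sub>v x) \<otimes>\<^sub>v y) = h ((w \<otimes>\<^sub>v x) \<otimes>\<^sub>v y)"
  shows "mk (tensor_module N (tensor_module N M M') M'') K f = mk (tensor_module N (tensor_module N M M') M'') K h"
proof (rule mk_cong)
  fix t assume t: "t \<in> underlying (tensor_module N (tensor_module N M M') M'')"
  show "f t = h t"
    by (rule lin_eq_on_tensor3[OF equivariantD(1)[OF assms(1), unfolded underlying_tensor]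
      equivariantD(1)[OF assms(2), unfolded underlying_tensor] assms(3) t[unfolded underlying_tensor]])
qed

lemma mk_tensor4_eq:
  assumes "equivariant N (tensor_module N (tensor_module N (tensor_module N L M) M') M'') K f"
      "equivariant N (tensor_module N (tensor_module N (tensor_module N L M) M') M'') K h"
    and "\<And>v w x y. v \<in> underlying L \<Longrightarrow> w \<in> underlying M \<Longrightarrow> x \<in> underlying M' \<Longrightarrow> y \<in> underlying M'' \<Longrightarrow>
      f (((v \<otimes>\<^sub>v w) \<otimes>\<^sub>v x) \<otimes>\<^sub>v y) = h (((v \<otimes>\<^sub>v w) \<otimes>\<^sub>v x) \<otimes>\<^sub>v y)"
  shows "mk (tensor_module N (tensor_module N (tensor_module N L M) M') M'') K f =
    mk (tensor_module N (tensor_module N (tensor_module N L M) M') M'') K h"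
proof (rule mk_cong)
  fix t assume t: "t \<in> underlying (tensor_module N (tensor_module N (tensor_module N L M) M') M'')"
  show "f t = h t"
    by (rule lin_eq_on_tensor4[OF equivariantD(1)[OF assms(1), unfolded underlying_tensor]
      equivariantD(1)[OF assms(2), unfolded underlying_tensor] assms(3) t[unfolded underlying_tensor]])
qed

lemma tensor_fun_equivariant:
  "equivariant N M K f \<Longrightarrow> equivariant N M' K' h \<Longrightarrow> w \<in> underlying M \<Longrightarrow> x \<in> underlying M' \<Longrightarrow>
    tensor_fun f h (w \<otimes>\<^sub>v x) = f w \<otimes>\<^sub>v h x"
  by (rule tensor_fun_simple[OF equivariantD(1) equivariantD(1)])

text \<open>The cases follow the order of the locale axioms. Interchange, bilinearity of the tensor
  product and the coherence laws are compared on pure tensors.\<close>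

theorem so_mod_category: "linear_monoidal_category (so_mod N)"
proof (unfold_locales, goal_cases)
  case 1 then show ?case by (simp add: so_mod_simps mk_in_so_maps equivariant_id)
next
  case (2 x y z f g) then show ?case
    by (auto simp: so_mod_simps mk_in_iff cmp_mk intro: equivariant_compose)
next
  case (3 x y f) then show ?case
    by (auto simp: so_mod_simps mk_in_iff cmp_mk equivariant_id)
next
  case (4 w x y z f g h) then show ?case
    by (auto simp: so_mod_simps mk_in_iff cmp_mk equivariant_compose)
next
  case 5 then show ?case by (simp add: so_mod_simps mk_in_so_maps equivariant_zero)
next
  case 6 then show ?case by (auto simp: so_mod_simps mk_in_iff intro: equivariant_plus)
next
  case 7 then show ?case by (auto simp: so_mod_simps mk_in_iff intro: equivariant_scale)
next
  case 8 then show ?case by (auto simp: so_mod_simps mk_in_iff add.assoc)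
next
  case 9 then show ?case by (auto simp: so_mod_simps mk_in_iff add.commute)
next
  case 10 then show ?case by (auto simp: so_mod_simps mk_in_iff)
next
  case 11 then show ?case
    by (auto simp: so_mod_simps mk_in_iff)
next
  case 12 then show ?case by (auto simp: so_mod_simps mk_in_iff)
next
  case 13 then show ?case by (auto simp: so_mod_simps mk_in_iff)
next
  case 14 then show ?case by (auto simp: so_mod_simps mk_in_iff cfun.scale_left_distrib)
next
  case 15 then show ?case by (auto simp: so_mod_simps mk_in_iff cfun.scale_right_distrib)
next
  case (16 x y z f g h) then show ?case
    by (auto simp: so_mod_simps mk_in_iff cmp_mk)
next
  case (17 x y z f g h) then show ?case
    by (auto simp: so_mod_simps mk_in_iff cmp_mk equivariant_plus equivariantD lin_add[OF equivariantD(1)] intro!: mk_cong)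
next
  case (18 x y z f g c) then show ?case
    by (auto simp: so_mod_simps mk_in_iff cmp_mk equivariant_scale equivariantD lin_scale[OF equivariantD(1)] intro!: mk_cong)
next
  case 19 then show ?case by (simp add: so_mod_simps is_so_module_trivial)
next
  case 20 then show ?case by (simp add: so_mod_simps is_so_module_tensor)
next
  case 21 then show ?case by (auto simp: so_mod_simps mk_in_iff tensor_mk is_so_module_tensor equivariant_tensor_fun)
next
  \<comment> \<open>\<open>tensor_fun\<close> of two identities changes a vector only at labels of
    the form \<open>Idx k\<close>, where elements of a tensor space vanish.\<close>
  case (22 x y) then show ?case
    by (auto simp: so_mod_simps tensor_mk equivariant_id underlying_tensor tensor_fun_simps
        tensor_space_slices(1)[OF _ so_moduleD(2) so_moduleD(2)] intro!: mk_cong label_eqI)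
next
  case (23 x x' x'' y y' y'' f h g k)
  then obtain f1 h1 g1 k1 where m: "f = mk x' x'' f1" "h = mk x x' h1" "g = mk y' y'' g1" "k = mk y y' k1"
    and e: "equivariant N x' x'' f1" "equivariant N x x' h1" "equivariant N y' y'' g1" "equivariant N y y' k1"
    and o: "is_so_module N x" "is_so_module N x'" "is_so_module N x''"
      "is_so_module N y" "is_so_module N y'" "is_so_module N y''"
    by (auto simp: so_mod_simps mk_in_iff)
  have "mk (tensor_module N x y) (tensor_module N x'' y'') (\<lambda>w. tensor_fun f1 g1 (tensor_fun h1 k1 w)) =
      mk (tensor_module N x y) (tensor_module N x'' y'') (tensor_fun (\<lambda>w. f1 (h1 w)) (\<lambda>w. g1 (k1 w)))"
    by (rule mk_tensor_eq) (use e o in \<open>simp_all add: equivariant_compose[OF equivariant_tensor_fun equivariant_tensor_fun]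
        equivariant_compose equivariant_tensor_fun tensor_fun_equivariant equivariantD(2)
        tensor_fun_equivariant[OF equivariant_compose equivariant_compose]\<close>)
  then show ?case
    using o e by (simp add: m so_mod_simps tensor_mk cmp_mk equivariant_tensor_fun equivariant_compose)
next
  case (24 x x' y y' f g h)
  then obtain f1 g1 h1 where m: "f = mk x x' f1" "g = mk x x' g1" "h = mk y y' h1"
    and e: "equivariant N x x' f1" "equivariant N x x' g1" "equivariant N y y' h1"
    and o: "is_so_module N x" "is_so_module N x'" "is_so_module N y" "is_so_module N y'"
    by (auto simp: so_mod_simps mk_in_iff)
  have "mk (tensor_module N x y) (tensor_module N x' y') (tensor_fun (\<lambda>w. f1 w + g1 w) h1) =
      mk (tensor_module N x y) (tensor_module N x' y') (\<lambda>w. tensor_fun f1 h1 w + tensor_fun g1 h1 w)"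
    by (rule mk_tensor_eq) (use e o in \<open>simp_all add: equivariant_plus equivariant_tensor_fun
       is_so_module_tensor tensor_fun_equivariant tensor_fun_equivariant[OF equivariant_plus] tensor_vec_add\<close>)
  then show ?case
    using o e by (simp add: m so_mod_simps tensor_mk)
next
  case (25 x x' y y' f g h)
  then obtain f1 g1 h1 where m: "f = mk x x' f1" "g = mk y y' g1" "h = mk y y' h1"
    and e: "equivariant N x x' f1" "equivariant N y y' g1" "equivariant N y y' h1"
    and o: "is_so_module N x" "is_so_module N x'" "is_so_module N y" "is_so_module N y'"
    by (auto simp: so_mod_simps mk_in_iff)
  have "mk (tensor_module N x y) (tensor_module N x' y') (tensor_fun f1 (\<lambda>w. g1 w + h1 w)) =
      mk (tensor_module N x y) (tensor_module N x' y') (\<lambda>w. tensor_fun f1 g1 w + tensor_fun f1 h1 w)"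
    by (rule mk_tensor_eq) (use e o in \<open>simp_all add: equivariant_plus equivariant_tensor_fun
       is_so_module_tensor tensor_fun_equivariant tensor_fun_equivariant[OF _ equivariant_plus] tensor_vec_add\<close>)
  then show ?case
    using o e by (simp add: m so_mod_simps tensor_mk equivariant_plus)
next
  case (26 x x' y y' f g c)
  then obtain f1 g1 where m: "f = mk x x' f1" "g = mk y y' g1"
    and e: "equivariant N x x' f1" "equivariant N y y' g1"
    and o: "is_so_module N x" "is_so_module N x'" "is_so_module N y" "is_so_module N y'"
    by (auto simp: so_mod_simps mk_in_iff)
  have "mk (tensor_module N x y) (tensor_module N x' y') (tensor_fun (\<lambda>w. vscale c (f1 w)) g1) =
      mk (tensor_module N x y) (tensor_module N x' y') (\<lambda>w. vscale c (tensor_fun f1 g1 w))"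
    "mk (tensor_module N x y) (tensor_module N x' y') (tensor_fun f1 (\<lambda>w. vscale c (g1 w))) =
      mk (tensor_module N x y) (tensor_module N x' y') (\<lambda>w. vscale c (tensor_fun f1 g1 w))"
    by (rule mk_tensor_eq; use e o in \<open>simp add: equivariant_scale equivariant_tensor_fun
       is_so_module_tensor tensor_fun_equivariant tensor_fun_equivariant[OF _ equivariant_scale]
       tensor_fun_equivariant[OF equivariant_scale] tensor_vec_scale\<close>)+
  then show ?case
    using o e by (simp add: m so_mod_simps tensor_mk equivariant_scale)
next
  case 27 then show ?case by (simp add: so_mod_simps(1,7) iso_assoc)
next
  case 28 then show ?case by (simp add: so_mod_simps(1,7,8) iso_lunit)
next
  case 29 then show ?case by (simp add: so_mod_simps(1,7,8) iso_runit)
next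
  case (30 x x' y y' z z' f g h)
  then obtain f1 g1 h1 where m: "f = mk x x' f1" "g = mk y y' g1" "h = mk z z' h1"
    and e: "equivariant N x x' f1" "equivariant N y y' g1" "equivariant N z z' h1"
    and o: "is_so_module N x" "is_so_module N x'" "is_so_module N y" "is_so_module N y'"
      "is_so_module N z" "is_so_module N z'"
    by (auto simp: so_mod_simps mk_in_iff)
  note t = is_so_module_tensor and tf = equivariant_tensor_fun
  have fg: "equivariant N (tensor_module N x y) (tensor_module N x' y') (tensor_fun f1 g1)"
    "equivariant N (tensor_module N y z) (tensor_module N y' z') (tensor_fun g1 h1)"
    using o e by (simp_all add: tf)
  have fgh: "equivariant N (tensor_module N (tensor_module N x y) z) (tensor_module N (tensor_module N x' y') z')
      (tensor_fun (tensor_fun f1 g1) h1)"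
    "equivariant N (tensor_module N x (tensor_module N y z)) (tensor_module N x' (tensor_module N y' z'))
      (tensor_fun f1 (tensor_fun g1 h1))"
    using o e by (simp_all add: tf t)
  have "mk (tensor_module N (tensor_module N x y) z) (tensor_module N x' (tensor_module N y' z'))
        (\<lambda>w. assoc_fun (tensor_fun (tensor_fun f1 g1) h1 w)) =
      mk (tensor_module N (tensor_module N x y) z) (tensor_module N x' (tensor_module N y' z'))
        (\<lambda>w. tensor_fun f1 (tensor_fun g1 h1) (assoc_fun w))"
    by (rule mk_tensor3_eq[OF equivariant_compose[OF fgh(1) equivariant_assoc_fun]
          equivariant_compose[OF equivariant_assoc_fun fgh(2)]])
      (use e o in \<open>simp_all add: tensor_fun_equivariant[OF e(1,2)] tensor_fun_equivariant[OF e(2,3)]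
        tensor_fun_equivariant[OF fg(1) e(3)] tensor_fun_equivariant[OF e(1) fg(2)] assoc_fun_tensor
        underlying_tensor tensor_vec_in\<close>)
  then show ?case
    using o e fg fgh by (simp add: m so_mod_simps tensor_mk t cmp_mk equivariant_assoc_fun)
next
  case (31 x y f)
  then obtain f1 where m: "f = mk x y f1" and e: "equivariant N x y f1"
    and o: "is_so_module N x" "is_so_module N y"
    by (auto simp: so_mod_simps mk_in_iff)
  note i = equivariant_id[OF is_so_module_trivial]
  note tf = equivariant_tensor_fun[OF is_so_module_trivial o(1) is_so_module_trivial o(2) i e]
  have "mk (tensor_module N (trivial_module N) x) y (\<lambda>w p. tensor_fun (\<lambda>w. w) f1 w (Tensor (Idx []) p)) =
     mk (tensor_module N (trivial_module N) x) y (\<lambda>w. f1 (\<lambda>p. w (Tensor (Idx []) p)))"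
  proof (rule mk_tensor_eq[OF is_so_module_trivial o(1) equivariant_compose[OF tf iso_lunit(1)[OF o(2)]]
        equivariant_compose[OF iso_lunit(1)[OF o(1)] e]])
    fix w v assume w: "w \<in> underlying (trivial_module N)" and v: "v \<in> underlying x"
    then obtain c where c: "w = vscale c unit_tensor" by (auto simp: underlying_trivial span_unit)
    show "(\<lambda>p. tensor_fun (\<lambda>w. w) f1 (w \<otimes>\<^sub>v v) (Tensor (Idx []) p)) = f1 (\<lambda>p. (w \<otimes>\<^sub>v v) (Tensor (Idx []) p))"
      unfolding tensor_fun_equivariant[OF i e w v] unfolding c lunit_tensor
      using lin_scale[OF equivariantD(1)[OF e] v] by simp
  qed
  then show ?case
    using o e tf i by (simp add: m so_mod_simps tensor_mk is_so_module_trivial cmp_mk iso_lunit)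
next
  case (32 x y f)
  then obtain f1 where m: "f = mk x y f1" and e: "equivariant N x y f1"
    and o: "is_so_module N x" "is_so_module N y"
    by (auto simp: so_mod_simps mk_in_iff)
  note i = equivariant_id[OF is_so_module_trivial]
  note tf = equivariant_tensor_fun[OF o(1) is_so_module_trivial o(2) is_so_module_trivial e i]
  have "mk (tensor_module N x (trivial_module N)) y (\<lambda>w p. tensor_fun f1 (\<lambda>w. w) w (Tensor p (Idx []))) =
     mk (tensor_module N x (trivial_module N)) y (\<lambda>w. f1 (\<lambda>p. w (Tensor p (Idx []))))"
  proof (rule mk_tensor_eq[OF o(1) is_so_module_trivial equivariant_compose[OF tf iso_runit(1)[OF o(2)]]
        equivariant_compose[OF iso_runit(1)[OF o(1)] e]])
    fix v w assume w: "w \<in> underlying (trivial_module N)" and v: "v \<in> underlying x"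
    then obtain c where c: "w = vscale c unit_tensor" by (auto simp: underlying_trivial span_unit)
    show "(\<lambda>p. tensor_fun f1 (\<lambda>w. w) (v \<otimes>\<^sub>v w) (Tensor p (Idx []))) = f1 (\<lambda>p. (v \<otimes>\<^sub>v w) (Tensor p (Idx [])))"
      unfolding tensor_fun_equivariant[OF e i v w] unfolding c runit_tensor
      using lin_scale[OF equivariantD(1)[OF e] v] by simp
  qed
  then show ?case
    using o e tf i by (simp add: m so_mod_simps tensor_mk is_so_module_trivial cmp_mk iso_runit)
next
  case (33 w x y z)
  then have o: "is_so_module N w" "is_so_module N x" "is_so_module N y" "is_so_module N z"
    by (auto simp: so_mod_simps)
  note t = is_so_module_tensor
  let ?T = "tensor_module N"
  note a1 = equivariant_assoc_fun[OF o(1,2) t[OF o(3,4)]] and a2 = equivariant_assoc_fun[OF t[OF o(1,2)] o(3,4)]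
  note a3 = equivariant_assoc_fun[OF o(2-4)] and a4 = equivariant_assoc_fun[OF o(1) t[OF o(2,3)] o(4)]
  note a5 = equivariant_assoc_fun[OF o(1-3)]
  note i = equivariant_id[OF o(1)] and i' = equivariant_id[OF o(4)]
  note t3 = equivariant_tensor_fun[OF o(1) t[OF t[OF o(2,3)] o(4)] o(1) t[OF o(2) t[OF o(3,4)]] i a3]
  note t5 = equivariant_tensor_fun[OF t[OF t[OF o(1,2)] o(3)] o(4) t[OF o(1) t[OF o(2,3)]] o(4) a5 i']
  have "mk (?T (?T (?T w x) y) z) (?T w (?T x (?T y z))) (\<lambda>v. assoc_fun (assoc_fun v)) =
    mk (?T (?T (?T w x) y) z) (?T w (?T x (?T y z)))
      (\<lambda>v. tensor_fun (\<lambda>w. w) assoc_fun (assoc_fun (tensor_fun assoc_fun (\<lambda>w. w) v)))"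
    by (rule mk_tensor4_eq[OF equivariant_compose[OF a2 a1] equivariant_compose[OF equivariant_compose[OF t5 a4] t3]])
      (simp add: assoc_fun_tensor tensor_fun_equivariant[OF i a3] tensor_fun_equivariant[OF a5 i']
        underlying_tensor tensor_vec_in)
  then show ?case
    using o by (simp add: so_mod_simps tensor_mk t i i' a1 a2 a3 a4 a5 t3 t5 cmp_mk[OF a2] cmp_mk[OF t5] cmp_mk[OF equivariant_compose[OF t5 a4]] cmp_mk[OF a4] cmp_mk)
next
  case (34 x y)
  then have o: "is_so_module N x" "is_so_module N y"
    by (auto simp: so_mod_simps)
  note tr = is_so_module_trivial and t = is_so_module_tensor
  let ?T = "tensor_module N"
  note a = equivariant_assoc_fun[OF o(1) tr o(2)]
  note l = iso_lunit(1)[OF o(2)] and r = iso_runit(1)[OF o(1)]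
  note i = equivariant_id[OF o(1)] and i' = equivariant_id[OF o(2)]
  note t3 = equivariant_tensor_fun[OF o(1) t[OF tr o(2)] o(1) o(2) i l]
  note t5 = equivariant_tensor_fun[OF t[OF o(1) tr] o(2) o(1) o(2) r i']
  have "mk (?T (?T x (trivial_module N)) y) (?T x y)
      (\<lambda>v. tensor_fun (\<lambda>w. w) (\<lambda>t p. t (Tensor (Idx []) p)) (assoc_fun v)) =
    mk (?T (?T x (trivial_module N)) y) (?T x y) (tensor_fun (\<lambda>t p. t (Tensor p (Idx []))) (\<lambda>w. w))"
  proof (rule mk_tensor3_eq[OF equivariant_compose[OF a t3] t5])
    fix v w u assume v: "v \<in> underlying x" and w: "w \<in> underlying (trivial_module N)" and u: "u \<in> underlying y"
    then obtain c where c: "w = vscale c unit_tensor" by (auto simp: underlying_trivial span_unit)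
    have 1: "w \<otimes>\<^sub>v u \<in> underlying (?T (trivial_module N) y)" "v \<otimes>\<^sub>v w \<in> underlying (?T x (trivial_module N))"
      using u v w by (simp_all add: underlying_tensor tensor_vec_in)
    show "tensor_fun (\<lambda>w. w) (\<lambda>t p. t (Tensor (Idx []) p)) (assoc_fun ((v \<otimes>\<^sub>v w) \<otimes>\<^sub>v u)) =
        tensor_fun (\<lambda>t p. t (Tensor p (Idx []))) (\<lambda>w. w) ((v \<otimes>\<^sub>v w) \<otimes>\<^sub>v u)"
      unfolding assoc_fun_tensor tensor_fun_equivariant[OF i l v 1(1)] tensor_fun_equivariant[OF r i' 1(2) u]
      unfolding c lunit_tensor runit_tensor unfolding tensor_vec_scale ..
  qed
  then show ?case
    using o by (simp add: so_mod_simps tensor_mk t i i' tr l r a cmp_mk[OF a])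
qed

section \<open>The category of webs\<close>

lemma web_class_refl: "wt f \<Longrightarrow> f \<in> web_class N f"
  by (simp add: web_class_def web_eq.refl)

lemma web_class_eqI: "web_eq N f g \<Longrightarrow> web_class N f = web_class N g"
  by (auto simp: web_class_def intro: web_eq.trans web_eq.sym)

text \<open>The composite of two classes is a union over representatives. By congruence all members
  of the union are the same class, and reflexivity shows that the union is not empty.\<close>

lemma web_class_cmp:
  assumes "wt (f \<odot>\<odot> g)"
  shows "cmp (web_cat N) (web_class N f) (web_class N g) = web_class N (f \<odot>\<odot> g)"
proof -
  have "web_class N (f' \<odot>\<odot> g') = web_class N (f \<odot>\<odot> g)" if "f' \<in> web_class N f" "g' \<in> web_class N g" for f' g'
    using that assms by (intro web_class_eqI[symmetric] web_eq.comp_cong) (auto simp: web_class_def)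
  then show ?thesis
    using assms by (auto simp: web_cat_def dest: web_class_refl[of _ N])
qed

lemma web_class_tensor:
  assumes "wt f" "wt g"
  shows "tensor_ar (web_cat N) (web_class N f) (web_class N g) = web_class N (f \<otimes>\<otimes> g)"
proof -
  have "web_class N (f' \<otimes>\<otimes> g') = web_class N (f \<otimes>\<otimes> g)" if "f' \<in> web_class N f" "g' \<in> web_class N g" for f' g'
    using that assms by (intro web_class_eqI[symmetric] web_eq.tens_cong) (auto simp: web_class_def)
  then show ?thesis
    using assms by (auto simp: web_cat_def dest: web_class_refl[of _ N])
qed

lemma web_class_add:
  assumes "wt (f \<oplus>\<oplus> g)"
  shows "add_ar (web_cat N) (web_class N f) (web_class N g) = web_class N (f \<oplus>\<oplus> g)"
proof -
  have "web_class N (f' \<oplus>\<oplus> g') = web_class N (f \<oplus>\<oplus> g)" if "f' \<in> web_class N f" "g' \<in> web_class N g" for f' g'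
    using that assms by (intro web_class_eqI[symmetric] web_eq.add_cong) (auto simp: web_class_def)
  then show ?thesis
    using assms by (auto simp: web_cat_def dest: web_class_refl[of _ N])
qed

lemma web_class_scale:
  assumes "wt f"
  shows "scale_ar (web_cat N) c (web_class N f) = web_class N (Scale c f)"
proof -
  have "web_class N (Scale c f') = web_class N (Scale c f)" if "f' \<in> web_class N f" for f'
    using that assms by (intro web_class_eqI[symmetric] web_eq.scale_cong) (auto simp: web_class_def)
  then show ?thesis
    using assms by (auto simp: web_cat_def dest: web_class_refl[of _ N])
qed

lemma web_cat_simps:
  "Ob (web_cat N) = web_ob"
  "ide (web_cat N) x = web_class N (Ident x)"
  "zero_ar (web_cat N) x y = web_class N (Zero x y)"
  "tensor_ob (web_cat N) = (@)"
  "unit_ob (web_cat N) = []"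
  "assoc (web_cat N) x y z = web_class N (Ident (x @ y @ z))"
  "lunit (web_cat N) x = web_class N (Ident x)"
  "runit (web_cat N) x = web_class N (Ident x)"
  by (simp_all add: web_cat_def)

lemma web_arrows: "A \<in> Arrows (web_cat N) x y \<longleftrightarrow> (\<exists>f. A = web_class N f \<and> wt f \<and> web_dom f = x \<and> web_cod f = y)"
  by (auto simp: web_cat_def)

lemmas web_cat_ops = web_cat_simps web_class_cmp web_class_tensor web_class_add web_class_scale web_arrows

lemma web_class_Ident: 
  assumes "wt f"
  shows "web_class N (Ident (web_cod f) \<odot>\<odot> f) = web_class N f"
    "web_class N (f \<odot>\<odot> Ident (web_dom f)) = web_class N f"
    "web_class N (Ident [] \<otimes>\<otimes> f) = web_class N f"
    "web_class N (f \<otimes>\<otimes> Ident []) = web_class N f"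
  using assms by (auto intro!: web_class_eqI web_eq.comp_id_left web_eq.comp_id_right
      web_eq.tens_unit_left web_eq.tens_unit_right)

lemma iso_Ident:
  assumes "x \<in> web_ob"
  shows "iso_ar (web_cat N) x x (web_class N (Ident x))"
proof -
  have c: "cmp (web_cat N) (web_class N (Ident x)) (web_class N (Ident x)) = web_class N (Ident x)"
    using assms web_class_Ident(1)[of "Ident x" N] by (simp add: web_class_cmp)
  have "web_class N (Ident x) \<in> Arrows (web_cat N) x x"
    using assms unfolding web_arrows by (intro exI[of _ "Ident x"]) simp
  then show ?thesis
    unfolding iso_ar_def web_cat_simps using c by blast
qed

text \<open>The algebraic axioms are typing facts or clauses of \<open>web_eq\<close>. The coherence
  isomorphisms are classes of identities, so their laws reduce to the unit laws,
  \<open>tens_id\<close> and \<open>tens_assoc\<close>.\<close>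

theorem web_cat_category: "linear_monoidal_category (web_cat N)"
proof (unfold_locales, goal_cases)
  case 1 then show ?case by (auto simp: web_cat_ops)
next
  case (2 x y z f g) then show ?case
    by (auto simp: web_cat_ops)
next
  case (3 x y f) then show ?case
    by (auto simp: web_cat_ops web_class_Ident)
next
  case (4 w x y z f g h) then show ?case
    by (clarsimp simp: web_cat_ops) (intro conjI web_class_eqI web_eq.comp_assoc; simp)
next
  case 5 then show ?case by (auto simp: web_cat_ops intro: exI[of _ "Zero _ _"])
next
  case (6 x y f g) then show ?case
    by (auto simp: web_cat_ops)
next
  case (7 x y f c) then show ?case
    by (auto simp: web_cat_ops)
next
  case 8 then show ?case by (clarsimp simp: web_cat_ops) (intro conjI web_class_eqI web_eq.add_assoc; simp)
next
  case 9 then show ?case by (clarsimp simp: web_cat_ops) (intro conjI web_class_eqI web_eq.add_comm; simp)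
next
  case 10 then show ?case by (clarsimp simp: web_cat_ops) (intro conjI web_class_eqI web_eq.add_zero; simp)
next
  case 11 then show ?case by (clarsimp simp: web_cat_ops) (intro conjI web_class_eqI web_eq.add_inverse; simp)
next
  case 12 then show ?case by (clarsimp simp: web_cat_ops) (intro conjI web_class_eqI web_eq.scale_one; simp)
next
  case 13 then show ?case by (clarsimp simp: web_cat_ops) (intro conjI web_class_eqI web_eq.scale_scale; simp)
next
  case 14 then show ?case by (clarsimp simp: web_cat_ops) (intro conjI web_class_eqI web_eq.scale_add_left; simp)
next
  case 15 then show ?case by (clarsimp simp: web_cat_ops) (intro conjI web_class_eqI web_eq.scale_add_right; simp)
next
  case 16 then show ?case by (clarsimp simp: web_cat_ops) (intro conjI web_class_eqI web_eq.comp_add_left; simp)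
next
  case 17 then show ?case by (clarsimp simp: web_cat_ops) (intro conjI web_class_eqI web_eq.comp_add_right; simp)
next
  case 18 then show ?case
    by (clarsimp simp: web_cat_ops) (intro conjI web_class_eqI web_eq.comp_scale_left web_eq.comp_scale_right; simp)
next
  case 19 then show ?case by (auto simp: web_cat_ops web_ob_append)
next
  case 20 then show ?case by (auto simp: web_cat_ops web_ob_append)
next
  case (21 x x' y y' f g) then show ?case
    by (auto simp: web_cat_ops)
next
  case 22 then show ?case by (clarsimp simp: web_cat_ops) (intro conjI web_class_eqI web_eq.tens_id; simp)
next
  case 23 then show ?case by (clarsimp simp: web_cat_ops) (intro conjI web_class_eqI web_eq.interchange; simp)
next
  case 24 then show ?case by (clarsimp simp: web_cat_ops) (intro conjI web_class_eqI web_eq.tens_add_left; simp)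
next
  case 25 then show ?case by (clarsimp simp: web_cat_ops) (intro conjI web_class_eqI web_eq.tens_add_right; simp)
next
  case 26 then show ?case
    by (clarsimp simp: web_cat_ops) (intro conjI web_class_eqI web_eq.tens_scale_left web_eq.tens_scale_right; simp)
next
  case 27 then show ?case by (simp add: web_cat_ops web_ob_append iso_Ident)
next
  case 28 then show ?case by (simp add: web_cat_ops web_ob_append iso_Ident)
next
  case 29 then show ?case by (simp add: web_cat_ops web_ob_append iso_Ident)
next
  case (30 x x' y y' z z' f g h)
  then obtain f1 g1 h1 where m: "f = web_class N f1" "g = web_class N g1" "h = web_class N h1"
    "wt f1" "wt g1" "wt h1" "web_dom f1 = x" "web_cod f1 = x'" "web_dom g1 = y" "web_cod g1 = y'"
    "web_dom h1 = z" "web_cod h1 = z'"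
    by (auto simp: web_cat_ops)
  have a: "web_class N (f1 \<otimes>\<otimes> g1 \<otimes>\<otimes> h1) = web_class N (f1 \<otimes>\<otimes> (g1 \<otimes>\<otimes> h1))"
    using m by (intro web_class_eqI web_eq.tens_assoc) auto
  have "web_class N (Ident (x' @ y' @ z') \<odot>\<odot> (f1 \<otimes>\<otimes> g1 \<otimes>\<otimes> h1)) = web_class N (f1 \<otimes>\<otimes> g1 \<otimes>\<otimes> h1)"
    "web_class N (f1 \<otimes>\<otimes> (g1 \<otimes>\<otimes> h1) \<odot>\<odot> Ident (x @ y @ z)) = web_class N (f1 \<otimes>\<otimes> g1 \<otimes>\<otimes> h1)"
    using a m web_class_Ident(1)[of "f1 \<otimes>\<otimes> g1 \<otimes>\<otimes> h1" N] web_class_Ident(2)[of "f1 \<otimes>\<otimes> (g1 \<otimes>\<otimes> h1)" N] by auto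
  then show ?case using m 30 by (simp add: web_cat_simps web_class_cmp web_class_tensor web_ob_append)
next
  case (31 x y f)
  then obtain f1 where m: "f = web_class N f1" "wt f1" "web_dom f1 = x" "web_cod f1 = y"
    by (auto simp: web_cat_ops)
  have "web_class N (Ident y \<odot>\<odot> (Ident [] \<otimes>\<otimes> f1)) = web_class N (Ident [] \<otimes>\<otimes> f1)"
    using m web_class_Ident(1)[of "Ident [] \<otimes>\<otimes> f1" N] by (auto simp: web_ob_append)
  then show ?case using m 31 web_class_Ident[of f1 N] by (simp add: web_cat_ops web_ob_append)
next
  case (32 x y f)
  then obtain f1 where m: "f = web_class N f1" "wt f1" "web_dom f1 = x" "web_cod f1 = y"
    by (auto simp: web_cat_ops)
  have "web_class N (Ident y \<odot>\<odot> (f1 \<otimes>\<otimes> Ident [])) = web_class N (f1 \<otimes>\<otimes> Ident [])"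
    using m web_class_Ident(1)[of "f1 \<otimes>\<otimes> Ident []" N] by (auto simp: web_ob_append)
  then show ?case using m 32 web_class_Ident[of f1 N] by (simp add: web_cat_ops web_ob_append)
next
  case (33 w x y z)
  have t: "web_class N (Ident u \<otimes>\<otimes> Ident v) = web_class N (Ident (u @ v))" if "u \<in> web_ob" "v \<in> web_ob" for u v
    using that by (intro web_class_eqI web_eq.tens_id)
  have i: "cmp (web_cat N) (web_class N (Ident u)) (web_class N (Ident u)) = web_class N (Ident u)" if "u \<in> web_ob" for u
    using that web_class_Ident(1)[of "Ident u" N] by (simp add: web_class_cmp)
  have u: "w @ x @ y @ z \<in> web_ob" using 33 by (simp add: web_cat_ops web_ob_append)
  show ?case using 33 i[OF u] by (simp add: web_cat_simps web_class_tensor t web_ob_append)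
next
  case (34 x y)
  have t: "web_class N (Ident u \<otimes>\<otimes> Ident v) = web_class N (Ident (u @ v))" if "u \<in> web_ob" "v \<in> web_ob" for u v
    using that by (intro web_class_eqI web_eq.tens_id)
  have i: "cmp (web_cat N) (web_class N (Ident u)) (web_class N (Ident u)) = web_class N (Ident u)" if "u \<in> web_ob" for u
    using that web_class_Ident(1)[of "Ident u" N] by (simp add: web_class_cmp)
  show ?case using 34 i[of "x @ y"] by (simp add: web_cat_simps web_class_tensor t web_ob_append)
qed

section \<open>Signed unshuffles and deconcatenations\<close>

text \<open>
  \<open>unsh g k\<close> sums \<open>g p q\<close> over all pairs of complementary subwords \<open>p\<close>, \<open>q\<close> of \<open>k\<close>, with the sign
  \<open>(-1)\<^sup>m\<close> for \<open>m\<close> the number of pairs of a letter of \<open>q\<close> standing in front of a letter of \<open>p\<close>. The map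
  \<open>der G I\<close> is the derivation of the tensor algebra on the letters \<open>I\<close> with matrix \<open>G\<close>.
\<close>

fun unsh :: "('a list \<Rightarrow> 'a list \<Rightarrow> complex) \<Rightarrow> 'a list \<Rightarrow> complex" where
  "unsh g [] = g [] []"
| "unsh g (x # k) = unsh (\<lambda>p q. g (x # p) q + (-1) ^ length p * g p (x # q)) k"

text \<open>The deconcatenation coproduct, tested against \<open>g\<close>. It recurses on the first
  letter like \<open>unsh\<close>, so that both coproducts are handled by parallel
  inductions.\<close>

fun splits :: "('a list \<Rightarrow> 'a list \<Rightarrow> complex) \<Rightarrow> 'a list \<Rightarrow> complex" where
  "splits g [] = g [] []"
| "splits g (x # k) = g [] (x # k) + splits (\<lambda>p q. g (x # p) q) k"

fun der :: "(int \<Rightarrow> int \<Rightarrow> complex) \<Rightarrow> int set \<Rightarrow> (int list \<Rightarrow> complex) \<Rightarrow> int list \<Rightarrow> complex" where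
  "der G I f [] = 0"
| "der G I f (x # k) = (\<Sum>j\<in>I. G x j * f (j # k)) + der G I (\<lambda>k'. f (x # k')) k"

lemma unsh_cong:
  "(\<And>p q. mset p + mset q = mset k \<Longrightarrow> g p q = h p q) \<Longrightarrow> unsh g k = unsh h k"
proof (induction k arbitrary: g h)
  case (Cons x k)
  show ?case
    unfolding unsh.simps by (rule Cons.IH) (simp add: Cons.prems)
qed simp

lemma unsh_length:
  "(\<And>p q. length p + length q = length k \<Longrightarrow> g p q = h p q) \<Longrightarrow> unsh g k = unsh h k"
  by (rule unsh_cong) (metis size_mset size_union)

lemma unsh_add: "unsh (\<lambda>p q. g p q + h p q) k = unsh g k + unsh h k"
proof (induction k arbitrary: g h)
  case (Cons x k)
  show ?case
    unfolding unsh.simps by (subst Cons.IH[symmetric]) (simp add: algebra_simps)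
qed simp

lemma unsh_scale: "unsh (\<lambda>p q. c * g p q) k = c * unsh g k"
proof (induction k arbitrary: g)
  case (Cons x k)
  show ?case
    unfolding unsh.simps by (subst Cons.IH[symmetric]) (simp add: algebra_simps)
qed simp

lemma unsh_scale_right: "unsh (\<lambda>p q. g p q * c) k = unsh g k * c"
  using unsh_scale[of c g k] by (simp add: mult.commute)

lemma unsh_zero [simp]: "unsh (\<lambda>p q. 0) k = 0"
  using unsh_scale[of 0 "\<lambda>p q. 0" k] by simp

lemma unsh_sum: "unsh (\<lambda>p q. \<Sum>a\<in>A. g a p q) k = (\<Sum>a\<in>A. unsh (g a) k)"
  by (induction A rule: infinite_finite_induct) (simp_all add: unsh_add)

lemma unsh_swap: "unsh (\<lambda>p q. unsh (\<lambda>r s. g p q r s) l) k = unsh (\<lambda>r s. unsh (\<lambda>p q. g p q r s) k) l"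
proof (induction k arbitrary: g)
  case (Cons x k)
  show ?case by (simp add: Cons.IH flip: unsh_add unsh_scale)
qed simp

lemma unsh_map: "unsh g (map f k) = unsh (\<lambda>p q. g (map f p) (map f q)) k"
  by (induction k arbitrary: g) simp_all

text \<open>An unshuffle of \<open>k @ l\<close> is a pair of unshuffles. The only new sign comes
  from letters of \<open>k\<close> sent right, the word \<open>q\<close>, that stand in front of
  letters of \<open>l\<close> sent left, the word \<open>r\<close>. This is the compatibility of
  deconcatenation with signed shuffles.\<close>

lemma unsh_append:
  "unsh g (k @ l) = unsh (\<lambda>p q. unsh (\<lambda>r s. (-1) ^ (length q * length r) * g (p @ r) (q @ s)) l) k"
proof (induction k arbitrary: g)
  case (Cons x k)
  show ?case
    unfolding append_Cons unsh.simps Cons.IH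
    by (simp add: unsh_add[symmetric] unsh_scale[symmetric] power_add algebra_simps)
qed simp

text \<open>Both sides distribute the letters over three words. The first letter joins one of the
  three and passes all letters of the earlier ones, which explains the exponents in the three-term
  sums of the proof.\<close>

lemma unsh_coassoc:
  "unsh (\<lambda>p q. unsh (\<lambda>a b. g a b q) p) k = unsh (\<lambda>p q. unsh (\<lambda>b c. g p b c) q) k"
proof (induction k arbitrary: g)
  case (Cons x k)
  have "unsh (\<lambda>p q. unsh (\<lambda>a b. g a b q) p) (x # k) =
    unsh (\<lambda>p q. unsh (\<lambda>a b. g (x # a) b q + (-1) ^ length a * g a (x # b) q
      + (-1) ^ (length a + length b) * g a b (x # q)) p) k"
    by (simp, rule unsh_cong)
      (simp add: unsh_add[symmetric] unsh_scale[symmetric], rule unsh_length, simp)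
  also have "\<dots> = unsh (\<lambda>p q. unsh (\<lambda>b c. g (x # p) b c + (-1) ^ length p * g p (x # b) c
      + (-1) ^ (length p + length b) * g p b (x # c)) q) k"
    by (rule Cons.IH)
  also have "\<dots> = unsh (\<lambda>p q. unsh (\<lambda>b c. g p b c) q) (x # k)"
    by (simp add: unsh_add[symmetric] unsh_scale[symmetric] power_add algebra_simps)
  finally show ?case .
qed simp

lemma splits_add: "splits (\<lambda>p q. g p q + h p q) k = splits g k + splits h k"
  by (induction k arbitrary: g h) simp_all

lemma splits_scale: "splits (\<lambda>p q. c * g p q) k = c * splits g k"
  by (induction k arbitrary: g) (simp_all add: distrib_left)

lemma splits_assoc:
  "splits (\<lambda>p q. splits (\<lambda>a b. g a b q) p) k = splits (\<lambda>p q. splits (\<lambda>b c. g p b c) q) k"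
  by (induction k arbitrary: g) (simp_all add: splits_add)

text \<open>If \<open>g\<close> is homogeneous in its first argument, a single cut survives.
  Products with a homogeneous left factor can then be evaluated by \<open>take\<close> and
  \<open>drop\<close>.\<close>

lemma splits_eq:
  "(\<And>p q. length p \<noteq> m \<Longrightarrow> g p q = 0) \<Longrightarrow> splits g k = (if m \<le> length k then g (take m k) (drop m k) else 0)"
proof (induction k arbitrary: g m)
  case (Cons x k)
  show ?case
  proof (cases m)
    case 0
    have "splits (\<lambda>p q. g (x # p) q) k = splits (\<lambda>p q. 0) k"
      using Cons.prems 0 by simp
    also have "\<dots> = 0" using splits_scale[of 0 "\<lambda>p q. 0"] by simp
    finally show ?thesis using 0 by simp
  next
    case (Suc n)
    have "splits (\<lambda>p q. g (x # p) q) k = (if n \<le> length k then g (x # take n k) (drop n k) else 0)"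
      by (rule Cons.IH) (simp add: Cons.prems Suc)
    then show ?thesis using Cons.prems[of "[]"] Suc by simp
  qed
qed simp

lemma der_add: "der G I (\<lambda>k. f k + h k) k = der G I f k + der G I h k"
  by (induction k arbitrary: f h) (simp_all add: algebra_simps sum.distrib)

lemma der_scale: "der G I (\<lambda>k. c * f k) k = c * der G I f k"
  by (induction k arbitrary: f) (simp_all add: algebra_simps sum_distrib_left)

lemma der_cong: "(\<And>l. length l = length k \<Longrightarrow> f l = h l) \<Longrightarrow> der G I f k = der G I h k"
proof (induction k arbitrary: f h)
  case (Cons x k)
  have "der G I (\<lambda>k'. f (x # k')) k = der G I (\<lambda>k'. h (x # k')) k"
    by (rule Cons.IH) (simp add: Cons.prems)
  then show ?case by (simp add: Cons.prems)
qed simp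

lemma der_sign: "der G I (\<lambda>k. (-1) ^ length k * f k) k = (-1) ^ length k * der G I f k"
  using der_cong[of k "\<lambda>l. (-1) ^ length l * f l" "\<lambda>l. (-1) ^ length k * f l"] by (simp add: der_scale)

text \<open>A derivation replaces letters in place, while the sign of an unshuffle depends only on
  positions; so replacing a letter before or after unshuffling gives the same sum.\<close>

lemma der_unsh:
  "der G I (unsh g) k = unsh (\<lambda>p q. der G I (\<lambda>p'. g p' q) p + der G I (g p) q) k"
proof (induction k arbitrary: g)
  case (Cons x k)
  show ?case
    by (simp add: Cons.IH unsh_sum[symmetric] unsh_scale[symmetric] unsh_add[symmetric])
      (rule unsh_cong, simp add: der_add der_scale der_sign sum.distrib algebra_simps sum_distrib_left)
qed simp

lemma der_splits:
  "der G I (splits g) k = splits (\<lambda>p q. der G I (\<lambda>p'. g p' q) p + der G I (g p) q) k"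
proof (induction k arbitrary: g)
  case (Cons x k)
  have s: "splits (\<lambda>p q. \<Sum>a\<in>A. h a p q) k = (\<Sum>a\<in>A. splits (h a) k)" for h :: "'b \<Rightarrow> int list \<Rightarrow> int list \<Rightarrow> complex" and A
    using splits_scale[of 0 "\<lambda>p q. 0" k]
    by (induction A rule: infinite_finite_induct) (simp_all add: splits_add)
  show ?case
    by (simp add: Cons.IH der_add s splits_add splits_scale distrib_left sum.distrib)
qed simp

section \<open>Concatenation, shuffle product and wedges\<close>

definition on_words :: "(int list \<Rightarrow> complex) \<Rightarrow> vec" where
  "on_words f = (\<lambda>l. case l of Idx k \<Rightarrow> f k | Tensor _ _ \<Rightarrow> 0)"

lemma on_words_simps: "on_words f (Idx k) = f k" "on_words f (Tensor p q) = 0"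
  by (simp_all add: on_words_def)

definition star :: "vec \<Rightarrow> vec \<Rightarrow> vec"  (infixr "\<star>" 75) where
  "t \<star> u = on_words (splits (\<lambda>p q. t (Idx p) * u (Idx q)))"

definition shuf :: "vec \<Rightarrow> vec \<Rightarrow> vec" where
  "shuf t u = on_words (unsh (\<lambda>p q. t (Idx p) * u (Idx q)))"

text \<open>
  In contrast to \<open>deriv_fun\<close>, the derivation \<open>dv N g\<close> never applies \<open>g\<close> outside \<open>V\<close>, so that its Leibniz
  rules hold for all tensors.
\<close>

definition dv :: "nat \<Rightarrow> endo \<Rightarrow> vec \<Rightarrow> vec" where
  "dv N g t = on_words (der (\<lambda>i j. g (vb j) i) (idx N) (\<lambda>k. t (Idx k)))"

definition words :: "nat \<Rightarrow> nat \<Rightarrow> int list set" where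
  "words N n = {k. length k = n \<and> set k \<subseteq> idx N}"

text \<open>The full tensor power of \<open>V\<close> of exponent \<open>n\<close>, as the functions
  supported on its basis labels.\<close>

definition tens :: "nat \<Rightarrow> nat \<Rightarrow> vec set" where
  "tens N n = {t. (\<forall>p q. t (Tensor p q) = 0) \<and> (\<forall>k. t (Idx k) \<noteq> 0 \<longrightarrow> k \<in> words N n)}"

section \<open>Homogeneous tensors with their two products and the derivation\<close>

lemma vec_eqI:
  assumes "\<And>k. t (Idx k) = u (Idx k)" "\<And>p q. t (Tensor p q) = 0" "\<And>p q. u (Tensor p q) = 0"
  shows "t = (u :: vec)"
  using assms by (intro label_eqI) auto

lemma star_Tensor [simp]: "(t \<star> u) (Tensor p q) = 0"
  and shuf_Tensor [simp]: "shuf t u (Tensor p q) = 0"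
  and dv_Tensor [simp]: "dv N g t (Tensor p q) = 0"
  by (simp_all add: star_def shuf_def dv_def on_words_simps)

lemma finite_idx [simp]: "finite (idx N)"
  by (simp add: idx_def)

lemma idx_uminus: "- i \<in> idx N \<longleftrightarrow> i \<in> idx N"
  by (auto simp: idx_def)

lemma card_idx: "card (idx N) = N"
proof (cases "odd N")
  case True
  then have "2 * (N div 2) + 1 = N" by presburger
  then have "nat (2 * int (N div 2) + 1) = N" by linarith
  then show ?thesis using True by (simp add: idx_def)
next
  case False
  then have "2 * (N div 2) = N" by simp
  then have "nat (2 * int (N div 2) + 1) = N + 1" by linarith
  then show ?thesis using False by (simp add: idx_def card_Diff_singleton)
qed

lemma finite_words [simp]: "finite (words N n)"
  using finite_lists_length_eq[OF finite_idx[of N], of n] by (simp add: words_def conj_commute)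

lemma words_append: "p @ q \<in> words N (m + n) \<and> length p = m \<longleftrightarrow> p \<in> words N m \<and> q \<in> words N n"
  by (auto simp: words_def)

lemma subspace_tens: "cfun.subspace (tens N n)"
  by (auto simp: cfun.subspace_def tens_def pw) (metis add_0)

lemma tensD:
  "t \<in> tens N n \<Longrightarrow> t (Tensor p q) = 0"
  "t \<in> tens N n \<Longrightarrow> k \<notin> words N n \<Longrightarrow> t (Idx k) = 0"
  "t \<in> tens N n \<Longrightarrow> length k \<noteq> n \<Longrightarrow> t (Idx k) = 0"
  "t \<in> tens N n \<Longrightarrow> \<not> set k \<subseteq> idx N \<Longrightarrow> t (Idx k) = 0"
  by (auto simp: tens_def words_def)

lemma tens_eqI:
  assumes "t \<in> tens N n" "u \<in> tens N n" "\<And>k. k \<in> words N n \<Longrightarrow> t (Idx k) = u (Idx k)"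
  shows "t = u"
  using assms by (intro vec_eqI) (metis tensD(2), auto dest: tensD)

lemma star_add: "(t + t') \<star> u = t \<star> u + t' \<star> u" "t \<star> (u + u') = t \<star> u + t \<star> u'"
  and star_scale: "vscale c t \<star> u = vscale c (t \<star> u)" "t \<star> vscale c u = vscale c (t \<star> u)"
  by (rule label_eqI; simp add: star_def on_words_simps pw algebra_simps
      flip: splits_add splits_scale)+

lemma shuf_add: "shuf (t + t') u = shuf t u + shuf t' u" "shuf t (u + u') = shuf t u + shuf t u'"
  and shuf_scale: "shuf (vscale c t) u = vscale c (shuf t u)" "shuf t (vscale c u) = vscale c (shuf t u)"
  by (rule label_eqI; simp add: shuf_def on_words_simps pw algebra_simps
      flip: unsh_add unsh_scale)+

lemma star_zero [simp]: "0 \<star> u = 0" "t \<star> 0 = 0"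
  using star_scale(1)[of 0 0 u] star_scale(2)[of t 0 0] by simp_all

lemma star_assoc: "(t \<star> u) \<star> v = t \<star> (u \<star> v)"
  by (rule label_eqI) (simp_all add: star_def on_words_simps splits_assoc mult.assoc
      flip: splits_scale splits_scale[of "v (Idx q)" for q, unfolded mult.commute[of "v (Idx q)" for q]])

lemma shuf_assoc: "shuf (shuf t u) v = shuf t (shuf u v)"
  by (rule label_eqI) (simp_all add: shuf_def on_words_simps unsh_coassoc mult.assoc
      flip: unsh_scale unsh_scale_right)

lemma star_tens_left:
  assumes "t \<in> tens N m"
  shows "(t \<star> u) (Idx k) = t (Idx (take m k)) * u (Idx (drop m k))"
proof -
  have "splits (\<lambda>p q. t (Idx p) * u (Idx q)) k = (if m \<le> length k then t (Idx (take m k)) * u (Idx (drop m k)) else 0)"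
    by (rule splits_eq) (simp add: tensD[OF assms])
  moreover have "t (Idx (take m k)) = 0" if "\<not> m \<le> length k"
    using that by (simp add: tensD(3)[OF assms])
  ultimately show ?thesis by (simp add: star_def on_words_simps)
qed

lemma star_append: "t \<in> tens N (length p) \<Longrightarrow> (t \<star> u) (Idx (p @ q)) = t (Idx p) * u (Idx q)"
  by (simp add: star_tens_left)

lemma star_in_tens:
  assumes "t \<in> tens N m" "u \<in> tens N n"
  shows "t \<star> u \<in> tens N (m + n)"
proof -
  have "k \<in> words N (m + n)" if "(t \<star> u) (Idx k) \<noteq> 0" for k
  proof -
    from that have "take m k \<in> words N m" "drop m k \<in> words N n"
      using assms by (auto simp: star_tens_left[OF assms(1)] dest: tensD)
    then show ?thesis
      using words_append[of "take m k" "drop m k" N m n] by simp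
  qed
  then show ?thesis by (auto simp: tens_def)
qed

lemma shuf_in_tens:
  assumes "t \<in> tens N m" "u \<in> tens N n"
  shows "shuf t u \<in> tens N (m + n)"
proof -
  have "shuf t u (Idx k) = 0" if k: "k \<notin> words N (m + n)" for k
  proof -
    have "unsh (\<lambda>p q. t (Idx p) * u (Idx q)) k = unsh (\<lambda>p q. 0) k"
    proof (rule unsh_cong)
      fix p q assume pq: "mset p + mset q = mset k"
      then have "length p + length q = length k" "set p \<union> set q = set k"
        by (metis size_mset size_union) (metis pq set_mset_mset set_mset_union)
      then have "\<not> (p \<in> words N m \<and> q \<in> words N n)"
        using k by (auto simp: words_def)
      then show "t (Idx p) * u (Idx q) = 0"
        using assms tensD(2) by (metis mult_zero_left mult_zero_right)
    qed
    then show ?thesis by (simp add: shuf_def on_words_simps)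
  qed
  then show ?thesis by (auto simp: tens_def)
qed

lemma dv_in_tens:
  assumes g: "g \<in> so N" and t: "t \<in> tens N n"
  shows "dv N g t \<in> tens N n"
proof -
  \<comment> \<open>Stated for every matrix that preserves \<open>V\<close> and for all degrees at
    once, because the induction strips letters from \<open>f\<close> and lowers the degree.\<close>
  have *: "der G (idx N) f k = 0"
    if "\<And>k. k \<notin> words N n \<Longrightarrow> f k = 0" "k \<notin> words N n" "\<And>i j. i \<notin> idx N \<Longrightarrow> j \<in> idx N \<Longrightarrow> G i j = 0"
    for G f k n
    using that
  proof (induction k arbitrary: n f)
    case (Cons x k)
    have "G x j * f (j # k) = 0" if "j \<in> idx N" for j
      using Cons.prems that by (cases "x \<in> idx N") (auto simp: words_def)
    moreover have "der G (idx N) (\<lambda>k'. f (x # k')) k = 0"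
    proof (cases "x \<in> idx N \<and> n > 0")
      case True
      then show ?thesis
        using Cons.prems by (intro Cons.IH[of "n - 1"]) (auto simp: words_def)
    next
      case False
      then have "f (x # k') = 0" for k' using Cons.prems(1) by (auto simp: words_def)
      then show ?thesis using der_scale[of G "idx N" 0 "\<lambda>k. 0" k] by simp
    qed
    ultimately show ?case by (simp add: sum.neutral)
  qed simp
  have v: "g (vb j) \<in> Vspace N" if "j \<in> idx N" for j
    using that by (intro lin_in[OF soE(1)[OF g]]) (auto simp: Vspace_def vb_def)
  have "dv N g t (Idx k) = 0" if "k \<notin> words N n" for k
    unfolding dv_def on_words_simps
    by (rule *[OF _ that]) (use v in \<open>auto simp: tensD[OF t] Vspace_def\<close>)
  then show ?thesis by (auto simp: tens_def)
qed

lemma dv_star: "dv N g (t \<star> u) = dv N g t \<star> u + t \<star> dv N g u"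
  by (rule label_eqI) (simp_all add: dv_def star_def on_words_simps pw der_splits der_scale splits_add
      der_scale[of _ _ "u (Idx q)" for q, unfolded mult.commute[of "u (Idx q)" for q]])

lemma dv_shuf: "dv N g (shuf t u) = shuf (dv N g t) u + shuf t (dv N g u)"
  by (rule label_eqI) (simp_all add: dv_def shuf_def on_words_simps pw der_unsh der_scale unsh_add
      der_scale[of _ _ "u (Idx q)" for q, unfolded mult.commute[of "u (Idx q)" for q]])

lemma dv_add: "dv N g (t + u) = dv N g t + dv N g u"
  and dv_scale: "dv N g (vscale c t) = vscale c (dv N g t)"
  by (rule label_eqI; simp add: dv_def on_words_simps pw der_add der_scale)+

lemma unit_star [simp]: "t \<in> tens N n \<Longrightarrow> unit_tensor \<star> t = t" "t \<in> tens N n \<Longrightarrow> t \<star> unit_tensor = t"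
proof -
  assume t: "t \<in> tens N n"
  have u: "unit_tensor \<in> tens N 0" by (simp add: tens_def words_def unit_tensor_def)
  show "unit_tensor \<star> t = t"
    by (rule vec_eqI) (simp_all add: star_tens_left[OF u] unit_tensor_simps tensD[OF t])
  show "t \<star> unit_tensor = t"
    by (rule vec_eqI) (auto simp: star_tens_left[OF t] unit_tensor_def tensD[OF t] not_le)
qed

lemma unit_in_tens: "unit_tensor \<in> tens N 0"
  by (simp add: tens_def words_def unit_tensor_def)

lemma dv_unit: "dv N g unit_tensor = 0"
proof (rule label_eqI)
  fix k
  have "der G I (\<lambda>k. 0) k = 0" for G I and k :: "int list"
    using der_scale[of G I 0 "\<lambda>k. 0" k] by simp
  then show "dv N g unit_tensor (Idx k) = 0 (Idx k)"
    by (cases k) (simp_all add: dv_def on_words_simps pw unit_tensor_def)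
qed (simp add: pw)

section \<open>Vectors in degree one and wedges as iterated shuffle products\<close>

definition vec1 :: "(int \<Rightarrow> complex) \<Rightarrow> vec" where
  "vec1 y = on_words (\<lambda>k. case k of [x] \<Rightarrow> y x | _ \<Rightarrow> 0)"

lemma vec1_simps: "vec1 y (Idx []) = 0" "vec1 y (Idx [x]) = y x" "vec1 y (Idx (x # x' # k)) = 0"
  "vec1 y (Tensor p q) = 0" "length k \<noteq> 1 \<Longrightarrow> vec1 y (Idx k) = 0"
  by (auto simp: vec1_def on_words_simps split: list.split)

lemma vec1_in_tens: "y \<in> Vspace N \<Longrightarrow> vec1 y \<in> tens N 1"
  by (auto simp: tens_def vec1_def on_words_simps words_def Vspace_def split: list.splits)

lemma vec1_Cons: "vec1 y (Idx (x # k)) = (if k = [] then y x else 0)"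
  by (cases k) (simp_all add: vec1_simps)

lemma Vspace_expand: "y \<in> Vspace N \<Longrightarrow> y = (\<Sum>j\<in>idx N. vscale (y j) (vb j))"
proof
  fix i assume y: "y \<in> Vspace N"
  have "(\<Sum>j\<in>idx N. vscale (y j) (vb j)) i = (\<Sum>j\<in>idx N. if j = i then y j else 0)"
    by (induction rule: infinite_finite_induct) (auto simp: pw vb_def)
  then show "y i = (\<Sum>j\<in>idx N. vscale (y j) (vb j)) i"
    using y by (simp add: Vspace_def)
qed

lemma sum_pw: "(\<Sum>a\<in>A. f a) i = (\<Sum>a\<in>A. (f a i :: complex))"
  by (induction A rule: infinite_finite_induct) (simp_all add: pw)

lemma vb_in [simp]: "j \<in> idx N \<Longrightarrow> vb j \<in> Vspace N"
  unfolding Vspace_def vb_def by fastforce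

lemma so_matrix:
  assumes g: "g \<in> so N" and y: "y \<in> Vspace N"
  shows "g y i = (\<Sum>j\<in>idx N. g (vb j) i * y j)"
proof -
  have "g y = g (\<Sum>j\<in>idx N. vscale (y j) (vb j))" using Vspace_expand[OF y] by simp
  also have "\<dots> = (\<Sum>j\<in>idx N. g (vscale (y j) (vb j)))"
    by (rule lin_sum[OF soE(1)[OF g] subspace_Vspace])
      (auto intro: cfun.subspace_scale subspace_Vspace)
  also have "\<dots> = (\<Sum>j\<in>idx N. vscale (y j) (g (vb j)))"
    by (intro sum.cong HOL.refl lin_scale[OF soE(1)[OF g]]) simp
  finally show ?thesis by (simp add: sum_pw pw mult.commute)
qed

lemma dv_vec1:
  assumes g: "g \<in> so N" and y: "y \<in> Vspace N"
  shows "dv N g (vec1 y) = vec1 (g y)"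
proof (rule label_eqI)
  fix k
  have z: "der G I (\<lambda>k. 0) k = 0" for G I and k :: "int list"
    using der_scale[of G I 0 "\<lambda>k. 0" k] by simp
  show "dv N g (vec1 y) (Idx k) = vec1 (g y) (Idx k)"
  proof (cases k)
    case (Cons x k')
    show ?thesis
    proof (cases k')
      case (Cons x' k'')
      then show ?thesis using \<open>k = x # k'\<close>
        by (simp add: dv_def on_words_simps vec1_Cons z)
    qed (use \<open>k = x # k'\<close> in \<open>simp add: dv_def on_words_simps vec1_Cons so_matrix[OF assms]\<close>)
  qed (simp add: dv_def on_words_simps vec1_simps)
qed (simp add: vec1_simps)

lemma der_update: "der G I f k = (\<Sum>p<length k. \<Sum>j\<in>I. G (k ! p) j * f (k[p := j]))"
  by (induction k arbitrary: f) (simp_all add: sum.lessThan_Suc_shift del: sum.lessThan_Suc)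

text \<open>Varying one letter of a tensor over \<open>idx N\<close> gives a vector of
  \<open>V\<close>, and there \<open>g\<close> is multiplication by the matrix that
  \<open>dv\<close> uses.\<close>

lemma deriv_fun_dv:
  assumes g: "g \<in> so N" and t: "t \<in> tens N n"
  shows "deriv_fun g t = dv N g t"
proof (rule label_eqI)
  fix k
  have "(\<lambda>j. t (Idx (k[p := j]))) \<in> Vspace N" if "p < length k" for p
    using that set_update_memI[of p k] by (auto simp: Vspace_def intro!: tensD(4)[OF t])
  then show "deriv_fun g t (Idx k) = dv N g t (Idx k)"
    by (simp add: deriv_fun_def dv_def on_words_simps der_update so_matrix[OF g])
qed (simp add: deriv_fun_def)

lemma unsh_Nil_left: "(\<And>p q. p \<noteq> [] \<Longrightarrow> g p q = 0) \<Longrightarrow> unsh g k = g [] k"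
proof (induction k arbitrary: g)
  case (Cons x k)
  have "unsh g (x # k) = g [x] k + g [] (x # k)"
    unfolding unsh.simps by (subst Cons.IH) (simp_all add: Cons.prems)
  then show ?case by (simp add: Cons.prems)
qed simp

lemma unsh_Nil_right: "(\<And>p q. q \<noteq> [] \<Longrightarrow> g p q = 0) \<Longrightarrow> unsh g k = g k []"
proof (induction k arbitrary: g)
  case (Cons x k)
  show ?case
    unfolding unsh.simps by (subst Cons.IH) (simp_all add: Cons.prems)
qed simp

text \<open>The one letter sent left, at position \<open>i\<close>, has exactly \<open>i\<close>
  letters of the right word in front of it.\<close>

lemma unsh_singleton:
  "(\<And>p q. length p \<noteq> 1 \<Longrightarrow> g p q = 0) \<Longrightarrow>
    unsh g k = (\<Sum>i<length k. (-1) ^ i * g [k ! i] (take i k @ drop (Suc i) k))"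
proof (induction k arbitrary: g)
  case (Cons x k)
  have "unsh g (x # k) = unsh (\<lambda>p q. g (x # p) q) k + unsh (\<lambda>p q. - 1 * g p (x # q)) k"
    unfolding unsh.simps unsh_add[symmetric]
  proof (rule unsh_cong)
    fix p q
    show "g (x # p) q + (-1) ^ length p * g p (x # q) = g (x # p) q + - 1 * g p (x # q)"
      using Cons.prems[of p "x # q"] by (cases "length p = 1") simp_all
  qed
  also have "unsh (\<lambda>p q. g (x # p) q) k = g [x] k"
    by (rule unsh_Nil_left) (simp add: Cons.prems)
  also have "unsh (\<lambda>p q. - 1 * g p (x # q)) k =
      (\<Sum>i<length k. (-1) ^ i * (- 1 * g [k ! i] (x # (take i k @ drop (Suc i) k))))"
    by (rule Cons.IH) (simp add: Cons.prems)
  finally show ?case by (simp add: sum.lessThan_Suc_shift del: sum.lessThan_Suc)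
qed (simp add: Cons)

lemma wedge_Nil: "wedge [] = unit_tensor"
  by (rule label_eqI) (simp_all add: wedge_def unit_tensor_def)

lemma wedge_Tensor [simp]: "wedge ys (Tensor p q) = 0"
  by (simp add: wedge_def)

lemma wedge_length: "length k \<noteq> length ys \<Longrightarrow> wedge ys (Idx k) = 0"
  by (simp add: wedge_def)

text \<open>Rows are positions of the word and columns are the vectors. In this form the Laplace
  expansion along a column becomes available.\<close>

lemma wedge_det:
  assumes "length k = n" "length ys = n"
  shows "wedge ys (Idx k) = det (mat n n (\<lambda>(p, q). (ys ! q) (k ! p)))"
proof -
  have "det (mat n n (\<lambda>(p, q). (ys ! q) (k ! p))) =
     (\<Sum>\<sigma> | \<sigma> permutes {0..<n}. of_int (sign \<sigma>) * (\<Prod>p = 0..<n. mat n n (\<lambda>(p, q). (ys ! q) (k ! p)) $$ (p, \<sigma> p)))"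
    by (rule det_def') simp
  also have "\<dots> = (\<Sum>\<sigma> | \<sigma> permutes {0..<n}. of_int (sign \<sigma>) * (\<Prod>p = 0..<n. (ys ! \<sigma> p) (k ! p)))"
    by (intro sum.cong HOL.refl arg_cong2[of _ _ _ _ "(*)"] prod.cong) (auto dest: permutes_in_image[THEN iffD2, rotated])
  finally show ?thesis
    using assms by (simp add: wedge_def atLeast0LessThan)
qed

text \<open>In the expansion along column \<open>0\<close>, choosing row \<open>i\<close> amounts to
  sending letter \<open>i\<close> left in an unshuffle, with the same sign. Facts about wedges can
  then be proved by induction on the list of vectors.\<close>

lemma wedge_Cons: "wedge (y # ys) = shuf (vec1 y) (wedge ys)"
proof (rule label_eqI)
  fix k
  let ?n = "length ys"
  have s: "shuf (vec1 y) (wedge ys) (Idx k) =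
      (\<Sum>i<length k. (-1) ^ i * (y (k ! i) * wedge ys (Idx (take i k @ drop (Suc i) k))))"
    unfolding shuf_def on_words_simps by (subst unsh_singleton) (simp_all add: vec1_simps)
  show "wedge (y # ys) (Idx k) = shuf (vec1 y) (wedge ys) (Idx k)"
  proof (cases "length k = Suc ?n")
    case False
    then have "wedge ys (Idx (take i k @ drop (Suc i) k)) = 0" if "i < length k" for i
      using that by (intro wedge_length) auto
    then show ?thesis using False unfolding s by (simp add: wedge_length)
  next
    case True
    let ?A = "mat (Suc ?n) (Suc ?n) (\<lambda>(p, q). ((y # ys) ! q) (k ! p))"
    have "wedge (y # ys) (Idx k) = det ?A"
      using True by (intro wedge_det) simp_all
    also have "\<dots> = (\<Sum>i<Suc ?n. ?A $$ (i, 0) * cofactor ?A i 0)"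
      by (rule laplace_expansion_column) auto
    also have "\<dots> = (\<Sum>i<Suc ?n. (-1) ^ i * (y (k ! i) * wedge ys (Idx (take i k @ drop (Suc i) k))))"
    proof (rule sum.cong[OF HOL.refl])
      fix i assume i: "i \<in> {..<Suc ?n}"
      have "mat_delete ?A i 0 = mat ?n ?n (\<lambda>(p, q). (ys ! q) ((take i k @ drop (Suc i) k) ! p))"
        using i True by (auto simp: mat_delete_def nth_append intro!: eq_matI)
      then have "cofactor ?A i 0 = (-1) ^ i * wedge ys (Idx (take i k @ drop (Suc i) k))"
        using i True by (subst wedge_det[of _ ?n]) (auto simp: cofactor_def)
      then show "?A $$ (i, 0) * cofactor ?A i 0 = (-1) ^ i * (y (k ! i) * wedge ys (Idx (take i k @ drop (Suc i) k)))"
        using i by simp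
    qed
    finally show ?thesis unfolding s True .
  qed
qed simp

section \<open>Alternating tensors\<close>

lemma shuf_unit: "(\<And>p q. t (Tensor p q) = 0) \<Longrightarrow> shuf unit_tensor t = t"
proof (rule vec_eqI)
  fix k
  have "unsh (\<lambda>p q. unit_tensor (Idx p) * t (Idx q)) k = unit_tensor (Idx []) * t (Idx k)"
    by (rule unsh_Nil_left) (simp add: unit_tensor_def)
  then show "shuf unit_tensor t (Idx k) = t (Idx k)"
    by (simp add: shuf_def on_words_simps unit_tensor_simps)
qed simp_all

lemma wedge_append: "wedge (xs @ ys) = shuf (wedge xs) (wedge ys)"
  by (induction xs) (simp_all add: wedge_Nil wedge_Cons shuf_unit shuf_assoc)

lemma wedge_in_tens: "set ys \<subseteq> Vspace N \<Longrightarrow> wedge ys \<in> tens N (length ys)"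
proof (induction ys)
  case (Cons y ys)
  then show ?case
    using shuf_in_tens[OF vec1_in_tens[of y N], of "wedge ys" "length ys"] by (simp add: wedge_Cons)
qed (simp add: wedge_Nil unit_in_tens)

text \<open>The generalized Laplace expansion along two blocks of rows. Here the list of vectors is
  unshuffled and the index word is cut; in \<open>wedge_append\<close> the roles are
  reversed.\<close>

lemma wedge_split:
  "wedge ys (Idx (k @ l)) = unsh (\<lambda>p q. wedge p (Idx k) * wedge q (Idx l)) ys"
proof (induction ys arbitrary: k l)
  case Nil
  show ?case by (auto simp: wedge_Nil unit_tensor_def)
next
  case (Cons y ys)
  let ?Y = "\<lambda>p. vec1 y (Idx p)" and ?W = "\<lambda>p. wedge ys (Idx p)"
  \<comment> \<open>The factor of \<open>y\<close> needs a word of length one, so its letter comes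
    either from the first block, with \<open>r\<close> empty, or from the second, with
    \<open>p\<close> empty. Only the second choice passes the letters of \<open>q\<close>.\<close>
  have inner: "unsh (\<lambda>r s. (-1) ^ (length q * length r) * (?Y (p @ r) * ?W (q @ s))) l =
     ?Y p * ?W (q @ l) + (if p = [] then (-1) ^ length q * unsh (\<lambda>r s. ?Y r * ?W (q @ s)) l else 0)"
    for p q
  proof -
    have "unsh (\<lambda>r s. (-1) ^ (length q * length r) * (?Y (p @ r) * ?W (q @ s))) l =
      unsh (\<lambda>r s. (if r = [] then ?Y p * ?W (q @ s) else 0) +
        (if p = [] then (-1) ^ length q else 0) * (?Y r * ?W (q @ s))) l"
    proof (rule unsh_cong)
      fix r s
      show "(-1) ^ (length q * length r) * (?Y (p @ r) * ?W (q @ s)) =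
        (if r = [] then ?Y p * ?W (q @ s) else 0) + (if p = [] then (-1) ^ length q else 0) * (?Y r * ?W (q @ s))"
        by (cases p; cases r) (auto simp: vec1_Cons vec1_simps)
    qed
    also have "\<dots> = ?Y p * ?W (q @ l) + (if p = [] then (-1) ^ length q else 0) * unsh (\<lambda>r s. ?Y r * ?W (q @ s)) l"
      by (simp add: unsh_add unsh_scale unsh_Nil_left)
    finally show ?thesis by simp
  qed
  have "wedge (y # ys) (Idx (k @ l)) =
      unsh (\<lambda>p q. ?Y p * ?W (q @ l) + (if p = [] then (-1) ^ length q * unsh (\<lambda>r s. ?Y r * ?W (q @ s)) l else 0)) k"
    by (simp add: wedge_Cons shuf_def on_words_simps unsh_append inner)
  also have "\<dots> = unsh (\<lambda>p q. ?Y p * ?W (q @ l)) k + (-1) ^ length k * unsh (\<lambda>r s. ?Y r * ?W (k @ s)) l"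
    by (simp add: unsh_add unsh_Nil_left)
  also have "unsh (\<lambda>p q. ?Y p * ?W (q @ l)) k = unsh (\<lambda>a b. wedge (y # a) (Idx k) * wedge b (Idx l)) ys"
    by (simp add: Cons.IH wedge_Cons shuf_def on_words_simps mult.assoc unsh_swap[where l = ys]
        flip: unsh_scale unsh_scale_right)
  also have "(-1) ^ length k * unsh (\<lambda>r s. ?Y r * ?W (k @ s)) l =
      unsh (\<lambda>a b. (-1) ^ length k * (wedge a (Idx k) * wedge (y # b) (Idx l))) ys"
    by (simp add: Cons.IH wedge_Cons shuf_def on_words_simps mult.left_commute unsh_swap[where l = ys]
        flip: unsh_scale)
  \<comment> \<open>The wedge of \<open>a\<close> vanishes at \<open>k\<close> unless the lengths
    agree, so the constant sign may be replaced by the one that occurs in the recursion of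
    \<open>unsh\<close>.\<close>
  also have "\<dots> = unsh (\<lambda>a b. (-1) ^ length a * (wedge a (Idx k) * wedge (y # b) (Idx l))) ys"
  proof (rule unsh_cong)
    fix a b
    show "(-1) ^ length k * (wedge a (Idx k) * wedge (y # b) (Idx l)) =
        (-1) ^ length a * (wedge a (Idx k) * wedge (y # b) (Idx l))"
      by (cases "length k = length a") (simp_all add: wedge_length)
  qed
  finally show ?case by (simp add: unsh_add)
qed

text \<open>Adjacent transpositions generate all permutations, and they suit inductions on words
  better than a condition on arbitrary permutations.\<close>

definition alt :: "(int list \<Rightarrow> complex) \<Rightarrow> bool" where
  "alt f \<longleftrightarrow> (\<forall>p x y q. f (p @ x # y # q) = - f (p @ y # x # q))"

lemma altD: "alt f \<Longrightarrow> f (p @ x # y # q) = - f (p @ y # x # q)"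
  unfolding alt_def by blast

lemma alt_add: "alt f \<Longrightarrow> alt h \<Longrightarrow> alt (\<lambda>k. f k + h k)"
  and alt_scale: "alt f \<Longrightarrow> alt (\<lambda>k. c * f k)"
  unfolding alt_def by (metis minus_add_distrib) (metis mult_minus_right)

lemma alt_zero_fun: "alt (\<lambda>k. 0)"
  by (simp add: alt_def)

lemma alt_sum: "(\<And>a. a \<in> A \<Longrightarrow> alt (f a)) \<Longrightarrow> alt (\<lambda>k. \<Sum>a\<in>A. f a k)"
  by (induction A rule: infinite_finite_induct) (simp_all add: alt_zero_fun alt_add)

lemma alt_Cons: "alt f \<Longrightarrow> alt (\<lambda>k. f (x # k))"
  unfolding alt_def by (metis append_Cons)

lemma alt_move:
  assumes "alt f"
  shows "f (p @ x # k @ q) = (-1) ^ length k * f (p @ k @ x # q)"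
proof (induction k arbitrary: p)
  case (Cons z k)
  show ?case
    using altD[OF assms, of p x z "k @ q"] Cons.IH[of "p @ [z]"] by simp
qed simp

lemma alt_not_distinct:
  assumes "alt f" "\<not> distinct k"
  shows "f k = 0"
proof -
  obtain p x q r where k: "k = p @ [x] @ q @ [x] @ r"
    using not_distinct_decomp[OF assms(2)] by blast
  have "f (p @ q @ x # x # r) = 0"
    using altD[OF assms(1), of "p @ q" x x r] by simp
  then show ?thesis using alt_move[OF assms(1), of p x q "x # r"] k by simp
qed

text \<open>Insertion sort. The case \<open>c = -1\<close> serves alternating functions, the case
  \<open>c = 1\<close> serves products of two of them; the fixed prefix \<open>p\<close> is what the
  induction needs.\<close>

lemma swap_sort:
  assumes f: "\<And>p x y q. f (p @ x # y # q) = c * f (p @ y # x # q)" and c: "c = 1 \<or> c = (-1 :: complex)"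
  shows "f (p @ k) = f (p @ sort k) \<or> f (p @ k) = c * f (p @ sort k)"
proof -
  have cc: "c * (c * z) = z" for z using c by auto
  have ins: "f (p @ x # k) = f (p @ insort x k) \<or> f (p @ x # k) = c * f (p @ insort x k)" for p x k
  proof (induction k arbitrary: p)
    case (Cons z k)
    show ?case
      using f[of p x z k] Cons.IH[of "p @ [z]"] by (auto simp: cc)
  qed simp
  show ?thesis
  proof (induction k arbitrary: p)
    case (Cons x k)
    show ?case
      using Cons.IH[of "p @ [x]"] ins[of p x "sort k"] by (auto simp: cc)
  qed simp
qed

lemma alt_swap: "alt f \<Longrightarrow> f (p @ x # y # q) = - 1 * f (p @ y # x # q)"
  unfolding mult_minus1 by (rule altD)

text \<open>Sorting changes a value at most by a sign, and a repeated letter forces the value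
  zero.\<close>

lemma alt_zero:
  assumes f: "alt f" and z: "\<And>k. sorted_wrt (<) k \<Longrightarrow> f k = 0"
  shows "f k = 0"
proof (cases "distinct k")
  case True
  then have "f (sort k) = 0" by (intro z) (simp add: strict_sorted_iff)
  then show ?thesis
    using swap_sort[of f "-1" "[]" k, OF alt_swap[OF f]] by auto
next
  case False
  then show ?thesis by (rule alt_not_distinct[OF f])
qed

abbreviation alt_vec :: "vec \<Rightarrow> bool" where
  "alt_vec t \<equiv> alt (\<lambda>k. t (Idx k))"

text \<open>If an unshuffle sends \<open>x\<close> and \<open>y\<close> to the same side, that
  factor is alternating. If it separates them, exchanging the letters matches it with the opposite
  separation, which has one inverted pair more or less.\<close>

lemma alt_shuf:
  assumes t: "alt_vec t" and u: "alt_vec u"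
  shows "alt_vec (shuf t u)"
  unfolding alt_def
proof (intro allI)
  fix p x y q
  let ?g = "\<lambda>p q. t (Idx p) * u (Idx q)"
  have "unsh (\<lambda>r s. (-1) ^ (length q' * length r) * ?g (p' @ r) (q' @ s)) (x # y # q) =
     - 1 * unsh (\<lambda>r s. (-1) ^ (length q' * length r) * ?g (p' @ r) (q' @ s)) (y # x # q)" for p' q'
    unfolding unsh.simps unsh_scale[symmetric]
    by (rule unsh_cong)
      (simp add: altD[OF t, of p' x y] altD[OF u, of q' x y] algebra_simps)
  then have "unsh ?g (p @ x # y # q) = - 1 * unsh ?g (p @ y # x # q)"
    unfolding unsh_append[of ?g p] unsh_scale[symmetric] by simp
  then show "shuf t u (Idx (p @ x # y # q)) = - shuf t u (Idx (p @ y # x # q))"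
    by (simp add: shuf_def on_words_simps)
qed

lemma alt_wedge: "alt_vec (wedge ys)"
proof (induction ys)
  case Nil
  show ?case by (simp add: wedge_Nil unit_tensor_def alt_def)
next
  case (Cons y ys)
  have "alt_vec (vec1 y)" by (auto simp: alt_def vec1_simps(5))
  then show ?case unfolding wedge_Cons using Cons by (rule alt_shuf)
qed

section \<open>Bases and a characterization of exterior powers\<close>

definition incs :: "nat \<Rightarrow> nat \<Rightarrow> int list set" where
  "incs N n = {k. length k = n \<and> set k \<subseteq> idx N \<and> sorted_wrt (<) k}"

lemma incs_words: "incs N n \<subseteq> words N n"
  by (auto simp: incs_def words_def)

lemma finite_incs [simp]: "finite (incs N n)"
  using finite_subset[OF incs_words] by simp

lemma wedge_vb_mset: "wedge_vb i (Idx k) \<noteq> 0 \<Longrightarrow> mset k = mset i"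
proof (induction i arbitrary: k)
  case Nil
  then show ?case by (auto simp: wedge_Nil unit_tensor_def split: if_splits)
next
  case (Cons x i)
  show ?case
  proof (rule ccontr)
    assume k: "mset k \<noteq> mset (x # i)"
    have "unsh (\<lambda>p q. vec1 (vb x) (Idx p) * wedge_vb i (Idx q)) k = unsh (\<lambda>p q. 0) k"
    proof (rule unsh_cong)
      fix p q assume pq: "mset p + mset q = mset k"
      show "vec1 (vb x) (Idx p) * wedge_vb i (Idx q) = 0"
      proof (rule ccontr)
        assume *: "\<not> ?thesis"
        then obtain z where p: "p = [z]"
          using vec1_simps(5)[of p "vb x"] by (auto simp: length_Suc_conv)
        with * have "z = x" by (auto simp: vec1_simps vb_def split: if_splits)
        moreover have "mset q = mset i" using * Cons.IH by auto
        ultimately show False using pq k p by simp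
      qed
    qed
    then show False using Cons.prems by (simp add: wedge_Cons shuf_def on_words_simps)
  qed
qed

lemma wedge_vb_diag: "distinct i \<Longrightarrow> wedge_vb i (Idx i) = 1"
proof (induction i)
  case (Cons x i)
  have "unsh (\<lambda>p q. vec1 (vb x) (Idx (x # p)) * wedge_vb i (Idx q) +
      (-1) ^ length p * (vec1 (vb x) (Idx p) * wedge_vb i (Idx (x # q)))) i =
    unsh (\<lambda>p q. if p = [] then wedge_vb i (Idx q) else 0) i"
  proof (rule unsh_cong)
    fix p q assume pq: "mset p + mset q = mset i"
    then have "x \<notin> set p" using Cons.prems by (metis distinct.simps(2) set_mset_mset union_iff)
    then have "vec1 (vb x) (Idx p) = 0"
      by (cases p) (auto simp: vec1_Cons vec1_simps vb_def)
    then show "vec1 (vb x) (Idx (x # p)) * wedge_vb i (Idx q) +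
        (-1) ^ length p * (vec1 (vb x) (Idx p) * wedge_vb i (Idx (x # q))) = (if p = [] then wedge_vb i (Idx q) else 0)"
      by (simp add: vec1_Cons) (simp add: vb_def)
  qed
  also have "\<dots> = wedge_vb i (Idx i)" by (subst unsh_Nil_left) simp_all
  finally show ?case using Cons by (simp add: wedge_Cons shuf_def on_words_simps)
qed (simp add: wedge_Nil unit_tensor_simps)

lemma wedge_vb_incs:
  assumes "sorted_wrt (<) i" "sorted_wrt (<) k"
  shows "wedge_vb i (Idx k) = (if i = k then 1 else 0)"
proof (cases "i = k")
  case True
  then show ?thesis using assms wedge_vb_diag[of i] by (simp add: strict_sorted_iff)
next
  case False
  have "mset k \<noteq> mset i"
    using assms False by (metis strict_sorted_iff properties_for_sort sorted_sort_id)
  then show ?thesis using False wedge_vb_mset[of i k] by auto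
qed

lemma wedge_vb_in_tens: "set i \<subseteq> idx N \<Longrightarrow> wedge_vb i \<in> tens N (length i)"
  using wedge_in_tens[of "map vb i" N] by (force intro!: vb_in)

text \<open>The difference of the two sides is alternating, and it vanishes on increasing words
  because the wedges there form a dual basis.\<close>

lemma alt_expand:
  assumes t: "t \<in> tens N n" and a: "alt_vec t"
  shows "t = (\<Sum>i\<in>incs N n. vscale (t (Idx i)) (wedge_vb i))"
proof (rule vec_eqI)
  fix k
  have s: "(\<Sum>i\<in>A. vscale (t (Idx i)) (wedge_vb i)) (Idx k) = (\<Sum>i\<in>A. t (Idx i) * wedge_vb i (Idx k))" for A k
    by (simp add: sum_pw pw)
  have "alt (\<lambda>k. \<Sum>i\<in>incs N n. t (Idx i) * wedge_vb i (Idx k))"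
    by (intro alt_sum alt_scale alt_wedge)
  then have "alt (\<lambda>k. t (Idx k) + - 1 * (\<Sum>i\<in>incs N n. t (Idx i) * wedge_vb i (Idx k)))"
    by (intro alt_add a alt_scale)
  moreover have "t (Idx k) + - 1 * (\<Sum>i\<in>incs N n. t (Idx i) * wedge_vb i (Idx k)) = 0" if k: "sorted_wrt (<) k" for k
  proof -
    have "(\<Sum>i\<in>incs N n. t (Idx i) * wedge_vb i (Idx k)) = (\<Sum>i\<in>incs N n. if i = k then t (Idx k) else 0)"
      using k by (intro sum.cong HOL.refl) (auto simp: incs_def wedge_vb_incs)
    also have "\<dots> = t (Idx k)"
    proof -
      have "t (Idx k) = 0" if "k \<notin> incs N n"
        using that k by (intro tensD(2)[OF t]) (auto simp: incs_def words_def)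
      then show ?thesis by auto
    qed
    finally show ?thesis by simp
  qed
  ultimately have "t (Idx k) + - 1 * (\<Sum>i\<in>incs N n. t (Idx i) * wedge_vb i (Idx k)) = 0"
    by (rule alt_zero)
  then show "t (Idx k) = (\<Sum>i\<in>incs N n. vscale (t (Idx i)) (wedge_vb i)) (Idx k)"
    by (simp add: s)
qed (simp_all add: sum_pw pw tensD[OF t])

text \<open>This replaces membership in a span by two pointwise conditions, which are easy to check
  after each operation.\<close>

lemma ext_space_iff: "t \<in> ext_space N n \<longleftrightarrow> t \<in> tens N n \<and> alt_vec t"
proof
  have sub: "cfun.subspace {t. t \<in> tens N n \<and> alt_vec t}"
    unfolding cfun.subspace_def
    using subspace_tens[of N n, unfolded cfun.subspace_def]
    by (auto simp: pw alt_add alt_scale) (simp add: alt_def pw)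
  assume "t \<in> ext_space N n"
  moreover have "ext_space N n \<subseteq> {t. t \<in> tens N n \<and> alt_vec t}"
    unfolding ext_space_def
    by (rule cfun.span_minimal[OF _ sub]) (auto simp: alt_wedge wedge_in_tens)
  ultimately show "t \<in> tens N n \<and> alt_vec t" by auto
next
  assume "t \<in> tens N n \<and> alt_vec t"
  then have "t = (\<Sum>i\<in>incs N n. vscale (t (Idx i)) (wedge_vb i))" by (intro alt_expand) auto
  moreover have "(\<Sum>i\<in>incs N n. vscale (t (Idx i)) (wedge_vb i)) \<in> ext_space N n"
    unfolding ext_space_def
    by (intro cfun.span_sum cfun.span_scale cfun.span_base) (fastforce simp: incs_def intro!: exI[of _ "map vb i" for i])
  ultimately show "t \<in> ext_space N n" by simp
qed

section \<open>Sums over words and unshuffles with a prescribed left length\<close>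

lemma sum_words_0: "(\<Sum>k\<in>words N 0. f k) = f []"
proof -
  have "words N 0 = {[]}" by (auto simp: words_def)
  then show ?thesis by simp
qed

lemma sum_words_Suc: "(\<Sum>k\<in>words N (Suc n). f k) = (\<Sum>x\<in>idx N. \<Sum>k\<in>words N n. f (x # k))"
proof -
  have "(\<Sum>k\<in>words N (Suc n). f k) = (\<Sum>(x, k)\<in>idx N \<times> words N n. f (x # k))"
    by (rule sum.reindex_bij_witness[of _ "\<lambda>(x, k). x # k" "\<lambda>k. (hd k, tl k)"])
      (auto simp: words_def length_Suc_conv)
  then show ?thesis by (simp add: sum.cartesian_product)
qed

lemma sum_words_append: "(\<Sum>k\<in>words N (m + n). f k) = (\<Sum>p\<in>words N m. \<Sum>q\<in>words N n. f (p @ q))"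
  by (induction m arbitrary: f) (simp_all add: sum_words_0 sum_words_Suc)

text \<open>The component of an unshuffle with \<open>a\<close> letters on the left. It lets the
  merge map act on one tensor, without being given the two factors.\<close>

definition restr :: "nat \<Rightarrow> ('a list \<Rightarrow> 'a list \<Rightarrow> complex) \<Rightarrow> 'a list \<Rightarrow> 'a list \<Rightarrow> complex" where
  "restr a g p q = (if length p = a then g p q else 0)"

lemma unsh_restr_0: "unsh (restr 0 g) k = g [] k"
  by (subst unsh_Nil_left) (simp_all add: restr_def)

lemma unsh_restr_all: "unsh (restr (length k) g) k = g k []"
proof -
  have "unsh (restr (length k) g) k = unsh (\<lambda>p q. if q = [] then g p q else 0) k"
    by (rule unsh_length) (auto simp: restr_def)
  then show ?thesis by (simp add: unsh_Nil_right)
qed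

text \<open>The shape of Pascal's rule: the first letter goes left or right. In the second case the
  sign is constant because the length of \<open>p\<close> is prescribed.\<close>

lemma unsh_restr_Suc: "unsh (restr (Suc a) g) (x # k) =
  unsh (restr a (\<lambda>p q. g (x # p) q)) k + unsh (restr (Suc a) (\<lambda>p q. (-1) ^ Suc a * g p (x # q))) k"
  unfolding unsh.simps unsh_add[symmetric] by (rule unsh_cong) (simp add: restr_def)

text \<open>The sign of an unshuffle is undone by moving the letters back under \<open>f\<close>, so
  only the number of unshuffles remains. The prefix \<open>l\<close> collects letters already sent
  right and moved to the front by \<open>alt_move\<close>.\<close>

lemma unsh_alt:
  assumes "alt f"
  shows "unsh (restr a (\<lambda>p q. f (l @ p @ q))) k = of_nat (length k choose a) * f (l @ k)"
proof (induction k arbitrary: a l)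
  case Nil
  then show ?case by (cases a) (simp_all add: restr_def)
next
  case (Cons x k)
  show ?case
  proof (cases a)
    case 0
    then show ?thesis unfolding 0 unsh_restr_0 by simp
  next
    case (Suc b)
    have "unsh (restr (Suc b) (\<lambda>p q. (-1) ^ Suc b * f (l @ p @ x # q))) k =
        unsh (restr (Suc b) (\<lambda>p q. f ((l @ [x]) @ p @ q))) k"
    proof (rule unsh_cong)
      fix p q
      show "restr (Suc b) (\<lambda>p q. (-1) ^ Suc b * f (l @ p @ x # q)) p q =
          restr (Suc b) (\<lambda>p q. f ((l @ [x]) @ p @ q)) p q"
        using alt_move[OF assms, of l x p q] by (simp add: restr_def)
    qed
    then show ?thesis
      using Cons.IH[of b "l @ [x]"] Cons.IH[of "Suc b" "l @ [x]"]
      unfolding Suc unsh_restr_Suc by (simp add: distrib_right)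
  qed
qed

text \<open>Up to a binomial coefficient, unshuffling is adjoint to concatenation when paired with
  an alternating function: \<open>y\<close> absorbs the signs. The first letter is split off on
  either side, and the two binomials add up by Pascal's rule.\<close>

lemma alt_adjoint:
  assumes "alt y"
  shows "(\<Sum>k\<in>words N (a + b). y k * unsh (restr a g) k) =
    of_nat ((a + b) choose a) * (\<Sum>p\<in>words N a. \<Sum>q\<in>words N b. y (p @ q) * g p q)"
  using assms
proof (induction "a + b" arbitrary: a b g y)
  case 0
  then show ?case by (simp add: sum_words_0 restr_def)
next
  case (Suc n)
  show ?case
  proof (cases a)
    case 0
    then show ?thesis by (simp add: unsh_restr_0 sum_words_0)
  next
    case (Suc a')
    show ?thesis
    proof (cases b)
      case 0
      have "unsh (restr a g) k = g k []" if "k \<in> words N a" for k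
        using that unsh_restr_all[of k g] by (simp add: words_def)
      then show ?thesis using 0 by (simp add: sum_words_0)
    next
      case (Suc b')
      note a' = \<open>a = Suc a'\<close>
      have n: "n = a' + b" "n = a + b'" using \<open>Suc n = a + b\<close> a' Suc by simp_all
      have 1: "(\<Sum>k\<in>words N (a' + b). y (x # k) * unsh (restr a' (\<lambda>p q. g (x # p) q)) k) =
        of_nat ((a' + b) choose a') * (\<Sum>p\<in>words N a'. \<Sum>q\<in>words N b. y (x # p @ q) * g (x # p) q)" for x
        using Suc.hyps(1)[OF n(1) alt_Cons[OF Suc.prems]] by simp
      have 2: "(\<Sum>k\<in>words N (a + b'). y (x # k) * unsh (restr a (\<lambda>p q. (-1) ^ a * g p (x # q))) k) =
        of_nat ((a + b') choose a) * (\<Sum>p\<in>words N a. \<Sum>q\<in>words N b'. y (p @ x # q) * g p (x # q))" for x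
      proof -
        have "(\<Sum>k\<in>words N (a + b'). y (x # k) * unsh (restr a (\<lambda>p q. (-1) ^ a * g p (x # q))) k) =
          of_nat ((a + b') choose a) * (\<Sum>p\<in>words N a. \<Sum>q\<in>words N b'. y (x # p @ q) * ((-1) ^ a * g p (x # q)))"
          using Suc.hyps(1)[OF n(2) alt_Cons[OF Suc.prems]] by simp
        also have "(\<Sum>p\<in>words N a. \<Sum>q\<in>words N b'. y (x # p @ q) * ((-1) ^ a * g p (x # q))) =
            (\<Sum>p\<in>words N a. \<Sum>q\<in>words N b'. y (p @ x # q) * g p (x # q))"
        proof (intro sum.cong HOL.refl)
          fix p q assume "p \<in> words N a"
          then show "y (x # p @ q) * ((-1) ^ a * g p (x # q)) = y (p @ x # q) * g p (x # q)"
            using alt_move[OF Suc.prems, of "[]" x p q] by (simp add: words_def)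
        qed
        finally show ?thesis .
      qed
      have s: "(\<Sum>x\<in>idx N. \<Sum>p\<in>words N a'. \<Sum>q\<in>words N b. y (x # p @ q) * g (x # p) q) =
          (\<Sum>p\<in>words N a. \<Sum>q\<in>words N b. y (p @ q) * g p q)"
        "(\<Sum>x\<in>idx N. \<Sum>p\<in>words N a. \<Sum>q\<in>words N b'. y (p @ x # q) * g p (x # q)) =
          (\<Sum>p\<in>words N a. \<Sum>q\<in>words N b. y (p @ q) * g p q)"
        by (simp add: a' sum_words_Suc) (subst sum.swap, simp add: Suc sum_words_Suc)
      have "(\<Sum>k\<in>words N (a + b). y k * unsh (restr a g) k) =
        (\<Sum>x\<in>idx N. (\<Sum>k\<in>words N (a' + b). y (x # k) * unsh (restr a' (\<lambda>p q. g (x # p) q)) k) +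
          (\<Sum>k\<in>words N (a + b'). y (x # k) * unsh (restr a (\<lambda>p q. (-1) ^ a * g p (x # q))) k))"
        using a' Suc by (simp add: sum_words_Suc unsh_restr_Suc distrib_left sum.distrib del: unsh.simps)
      also have "\<dots> = of_nat ((a' + b) choose a') * (\<Sum>p\<in>words N a. \<Sum>q\<in>words N b. y (p @ q) * g p q) +
          of_nat ((a + b') choose a) * (\<Sum>p\<in>words N a. \<Sum>q\<in>words N b. y (p @ q) * g p q)"
        unfolding 1 2 sum.distrib sum_distrib_left[symmetric] s ..
      also have "\<dots> = of_nat ((a + b) choose a) * (\<Sum>p\<in>words N a. \<Sum>q\<in>words N b. y (p @ q) * g p q)"
        using a' Suc by (simp add: algebra_simps)
      finally show ?thesis .
    qed
  qed
qed

text \<open>The index word dual to \<open>k\<close>: the form pairs \<open>i\<close> with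
  \<open>- i\<close>, and nested caps pair the last letter on the left with the first one on the
  right, hence the reversal.\<close>

definition rho :: "int list \<Rightarrow> int list" where
  "rho k = rev (map uminus k)"

lemma rho_simps [simp]: "rho [] = []" "rho (p @ q) = rho q @ rho p" "rho (x # k) = rho k @ [- x]"
  "rho (rho k) = k" "length (rho k) = length k"
  by (simp_all add: rho_def rev_map comp_def)

lemma rho_words [simp]: "rho k \<in> words N n \<longleftrightarrow> k \<in> words N n"
  by (auto simp: rho_def words_def idx_uminus)

text \<open>Negation and reversal each turn the order around, so together they preserve increasing
  words.\<close>

lemma rho_incs [simp]: "rho k \<in> incs N n \<longleftrightarrow> k \<in> incs N n"
proof -
  have "sorted_wrt (<) (rho k) \<longleftrightarrow> sorted_wrt (<) k"
    by (simp add: rho_def sorted_wrt_rev sorted_wrt_map)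
  then show ?thesis by (auto simp: incs_def rho_def idx_uminus)
qed

lemma sum_rho: "(\<Sum>k\<in>words N n. f (rho k)) = (\<Sum>k\<in>words N n. f k)"
  by (rule sum.reindex_bij_witness[of _ rho rho]) auto

lemma alt_rho:
  assumes "alt f"
  shows "alt (\<lambda>k. f (rho k))"
  unfolding alt_def
proof (intro allI)
  fix p x y q
  show "f (rho (p @ x # y # q)) = - f (rho (p @ y # x # q))"
    using altD[OF assms, of "rho q" "- y" "- x" "rho p"] by simp
qed

text \<open>The product of two alternating functions is symmetric and vanishes on words with a
  repeated letter, so each increasing word stands for its \<open>n\<close>! rearrangements.\<close>

lemma sum_words_incs:
  assumes f: "alt f" and h: "alt h"
  shows "(\<Sum>k\<in>words N n. f k * h k) = fact n * (\<Sum>i\<in>incs N n. f i * h i)"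
proof -
  let ?D = "{k \<in> words N n. distinct k}"
  have "(\<Sum>k\<in>words N n. f k * h k) = (\<Sum>k\<in>?D. f k * h k)"
    by (rule sum.mono_neutral_right) (auto simp: alt_not_distinct[OF f])
  also have "\<dots> = (\<Sum>i\<in>incs N n. \<Sum>k\<in>{k \<in> ?D. sort k = i}. f k * h k)"
    by (rule sum.group[symmetric, OF _ finite_incs]) (simp, auto simp: incs_def words_def strict_sorted_iff)
  also have "\<dots> = (\<Sum>i\<in>incs N n. \<Sum>k\<in>permutations_of_set (set i). f i * h i)"
  proof (intro sum.cong)
    fix i assume i: "i \<in> incs N n"
    show "{k \<in> ?D. sort k = i} = permutations_of_set (set i)"
    proof (intro Set.set_eqI iffI)
      fix k assume "k \<in> permutations_of_set (set i)"
      then have k: "set k = set i" "distinct k" by (auto simp: permutations_of_set_def)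
      have "sort k = i"
        using i k by (intro sorted_distinct_set_unique) (auto simp: incs_def strict_sorted_iff)
      then show "k \<in> {k \<in> ?D. sort k = i}"
        using i k by (auto simp: incs_def words_def)
    qed (auto simp: permutations_of_set_def)
    fix k assume "k \<in> permutations_of_set (set i)"
    then have k: "set k = set i" "distinct k" by (auto simp: permutations_of_set_def)
    have s: "sort k = i"
      using i k by (intro sorted_distinct_set_unique) (auto simp: incs_def strict_sorted_iff)
    have "f k * h k = f (sort k) * h (sort k)"
    proof -
      have "f (p @ x # y # q) * h (p @ x # y # q) = 1 * (f (p @ y # x # q) * h (p @ y # x # q))" for p x y q
        by (simp add: altD[OF f, of p x y q] altD[OF h, of p x y q])
      then show ?thesis
        using swap_sort[of "\<lambda>k. f k * h k" 1 "[]" k] by simp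
    qed
    then show "f k * h k = f i * h i" by (simp add: s)
  qed simp
  also have "\<dots> = fact n * (\<Sum>i\<in>incs N n. f i * h i)"
    unfolding sum_distrib_left
    by (intro sum.cong HOL.refl) (auto simp: incs_def strict_sorted_iff distinct_card)
  finally show ?thesis .
qed

section \<open>Length and minimal coset representatives\<close>

definition inversions :: "nat \<Rightarrow> (nat \<Rightarrow> nat) \<Rightarrow> (nat \<times> nat) set" where
  "inversions n w = {(i, j). i < j \<and> j < n \<and> w j < w i}"

abbreviation adj :: "nat \<Rightarrow> nat \<Rightarrow> nat" where
  "adj j \<equiv> Transposition.transpose j (Suc j)"

lemma finite_inversions [simp]: "finite (inversions n w)"
  by (rule finite_subset[of _ "{..<n} \<times> {..<n}"]) (auto simp: inversions_def)

lemma adj_less: "i < k \<Longrightarrow> (i, k) \<noteq> (j, Suc j) \<Longrightarrow> adj j i < adj j k"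
  by (auto simp: transpose_def)

text \<open>An adjacent swap preserves the order of every pair of positions except
  \<open>(j, Suc j)\<close>, so it carries the other inversions over bijectively.\<close>

lemma inversions_adj:
  assumes j: "Suc j < n"
  shows "inversions n (w \<circ> adj j) - {(j, Suc j)} = map_prod (adj j) (adj j) ` (inversions n w - {(j, Suc j)})"
proof (intro equalityI subsetI)
  have lt: "adj j k < n" if "k < n" for k using j that by (auto simp: transpose_def)
  have ne: "(adj j i, adj j k) \<noteq> (j, Suc j)" if "i < k" for i k
    using that by (auto simp: transpose_def split: if_splits)
  {
    fix x assume "x \<in> inversions n (w \<circ> adj j) - {(j, Suc j)}"
    then obtain i k where x: "x = (i, k)" "i < k" "k < n" "w (adj j k) < w (adj j i)" "(i, k) \<noteq> (j, Suc j)"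
      by (auto simp: inversions_def)
    then have "(adj j i, adj j k) \<in> inversions n w - {(j, Suc j)}"
      using adj_less[of i k j] lt ne[of i k] by (auto simp: inversions_def)
    then show "x \<in> map_prod (adj j) (adj j) ` (inversions n w - {(j, Suc j)})"
      unfolding x by (intro image_eqI[of _ _ "(adj j i, adj j k)"]) simp_all
  }
  fix x assume "x \<in> map_prod (adj j) (adj j) ` (inversions n w - {(j, Suc j)})"
  then obtain i k where x: "x = (adj j i, adj j k)" "i < k" "k < n" "w k < w i" "(i, k) \<noteq> (j, Suc j)"
    by (auto simp: inversions_def)
  then show "x \<in> inversions n (w \<circ> adj j) - {(j, Suc j)}"
    using adj_less[of i k j] lt ne[of i k] by (auto simp: inversions_def)
qed

lemma card_inversions_adj:
  assumes "Suc j < n"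
  shows "w (Suc j) < w j \<Longrightarrow> card (inversions n w) = Suc (card (inversions n (w \<circ> adj j)))"
    and "\<not> w (Suc j) < w j \<Longrightarrow> card (inversions n (w \<circ> adj j)) \<le> Suc (card (inversions n w))"
proof -
  have inj: "inj (map_prod (adj j) (adj j))"
    by (intro prod.inj_map inj_on_inverseI[of _ "adj j"]) simp_all
  have eq: "card (inversions n (w \<circ> adj j) - {(j, Suc j)}) = card (inversions n w - {(j, Suc j)})"
    unfolding inversions_adj[OF assms] by (rule card_image[OF inj_on_subset[OF inj subset_UNIV]])
  {
    assume "w (Suc j) < w j"
    then have x: "(j, Suc j) \<in> inversions n w" "(j, Suc j) \<notin> inversions n (w \<circ> adj j)"
      using assms by (auto simp: inversions_def)
    have "inversions n (w \<circ> adj j) - {(j, Suc j)} = inversions n (w \<circ> adj j)"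
      using x(2) by (rule Diff_insert0[of _ _ "{}", unfolded Diff_empty])
    then show "card (inversions n w) = Suc (card (inversions n (w \<circ> adj j)))"
      unfolding card.remove[OF finite_inversions x(1)] using eq by metis
  }
  assume "\<not> w (Suc j) < w j"
  then have "(j, Suc j) \<notin> inversions n w"
    by (auto simp: inversions_def)
  then have "inversions n w - {(j, Suc j)} = inversions n w"
    by (rule Diff_insert0[of _ _ "{}", unfolded Diff_empty])
  then have "card (inversions n w) = card (inversions n (w \<circ> adj j) - {(j, Suc j)})"
    using eq by metis
  then show "card (inversions n (w \<circ> adj j)) \<le> Suc (card (inversions n w))"
    using card_Diff_singleton_if[of "inversions n (w \<circ> adj j)" "(j, Suc j)"]
    by (auto simp del: o_apply split: if_splits)
qed

definition word :: "nat list \<Rightarrow> nat \<Rightarrow> nat" where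
  "word js = foldr (\<circ>) (map adj js) id"

lemma word_snoc: "word (js @ [j]) = word js \<circ> adj j"
proof -
  have "foldr (\<circ>) fs f = foldr (\<circ>) fs id \<circ> f" for fs and f :: "nat \<Rightarrow> nat"
    by (induction fs) (simp_all add: Fun.comp_assoc)
  from this[of "map adj js" "adj j"] show ?thesis by (simp add: word_def)
qed

lemma inversions_word: "\<forall>j\<in>set js. Suc j < n \<Longrightarrow> card (inversions n (word js)) \<le> length js"
proof (induction js rule: rev_induct)
  case Nil
  have "inversions n (word []) = {}" by (auto simp: inversions_def word_def)
  then show ?case by simp
next
  case (snoc j js)
  then show ?case
    using card_inversions_adj[of j n "word js"] unfolding word_snoc
    by (cases "word js (Suc j) < word js j") (auto simp del: o_apply)
qed

lemma adj_permutes: "Suc j < n \<Longrightarrow> adj j permutes {..<n}"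
  by (rule permutes_swap_id) auto

text \<open>Used for the two blocks of a coset representative: increase inside a block makes the
  values there recoverable from their set.\<close>

lemma map_permutes_sorted:
  assumes w: "w permutes {..<n}" and ab: "a \<le> b" "b \<le> n" and inc: "\<And>i. a \<le> i \<Longrightarrow> Suc i < b \<Longrightarrow> w i < w (Suc i)"
  shows "map w [a..<b] = sorted_list_of_set (w ` {a..<b})"
proof -
  have mono: "w i < w j" if "a \<le> i" "i < j" "j < b" for i j
    using that(2,1,3)
  proof (induction rule: less_Suc_induct)
    case (1 i)
    then show ?case using inc by simp
  next
    case (2 i j k)
    then show ?case by simp
  qed
  have "sorted_wrt (<) (map w [a..<b])"
    by (auto simp: sorted_wrt_iff_nth_less intro!: mono)
  then have "map w [a..<b] = sorted_list_of_set (set (map w [a..<b]))"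
    using sorted_list_of_set.idem_if_sorted_distinct strict_sorted_iff by metis
  then show ?thesis by simp
qed

lemma permutes_increasing_id:
  assumes w: "w permutes {..<n}" and inc: "\<And>i. Suc i < n \<Longrightarrow> w i < w (Suc i)"
  shows "w = id"
proof
  fix i
  have "map w [0..<n] = sorted_list_of_set (w ` {0..<n})"
    by (rule map_permutes_sorted[OF w]) (use inc in auto)
  also have "w ` {0..<n} = {0..<n}"
    using permutes_image[OF w] by (simp add: lessThan_atLeast0)
  finally have "map w [0..<n] = [0..<n]" by simp
  then have "w i = i" if "i < n"
    using that by (metis diff_zero length_upt nth_map nth_upt plus_nat.add_0)
  moreover have "w i = i" if "\<not> i < n"
    using permutes_not_in[OF w] that by simp
  ultimately show "w i = id i" by auto
qed

text \<open>Bubble sort: a permutation without descents is the identity, and a swap at a descent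
  removes exactly one inversion.\<close>

lemma word_exists:
  assumes "w permutes {..<n}"
  shows "\<exists>js. length js = card (inversions n w) \<and> (\<forall>j\<in>set js. Suc j < n) \<and> w = word js"
  using assms
proof (induction "card (inversions n w)" arbitrary: w)
  case 0
  have "w i < w (Suc i)" if "Suc i < n" for i
  proof -
    have "(i, Suc i) \<notin> inversions n w" using 0(1) by simp
    then have "\<not> w (Suc i) < w i" using that by (auto simp: inversions_def)
    moreover have "w (Suc i) \<noteq> w i" using permutes_inj[OF 0(2)] by (metis injD n_not_Suc_n)
    ultimately show ?thesis by simp
  qed
  then have "w = id" by (rule permutes_increasing_id[OF 0(2)])
  then show ?case using 0(1) by (intro exI[of _ "[]"]) (simp add: word_def)
next
  case (Suc m)
  have "\<exists>j. Suc j < n \<and> w (Suc j) < w j"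
  proof (rule ccontr)
    assume no: "\<not> ?thesis"
    have "w i < w (Suc i)" if "Suc i < n" for i
    proof -
      have "w (Suc i) \<noteq> w i" using permutes_inj[OF Suc(3)] by (metis injD n_not_Suc_n)
      then show ?thesis using no that by fastforce
    qed
    then have "w = id" by (rule permutes_increasing_id[OF Suc(3)])
    then have "inversions n w = {}" by (auto simp: inversions_def)
    then show False using Suc(2) by simp
  qed
  then obtain j where j: "Suc j < n" "w (Suc j) < w j" by blast
  have c: "card (inversions n w) = Suc (card (inversions n (w \<circ> adj j)))"
    by (rule card_inversions_adj(1)[OF j])
  have "w \<circ> adj j permutes {..<n}"
    using Suc(3) adj_permutes[OF j(1)] by (rule permutes_compose[rotated])
  then obtain js where js: "length js = m" "\<forall>j\<in>set js. Suc j < n" "w \<circ> adj j = word js"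
    using Suc(1)[of "w \<circ> adj j"] Suc(2) c by auto
  have "w = word (js @ [j])"
    unfolding word_snoc js(3)[symmetric] by (simp add: fun_eq_iff)
  then show ?case using js(1,2) j(1) Suc(2) by (intro exI[of _ "js @ [j]"]) auto
qed

lemma perm_length_inversions:
  assumes "w permutes {..<n}"
  shows "perm_length n w = card (inversions n w)"
  unfolding perm_length_def word_def[symmetric]
proof (rule Least_equality, rule word_exists[OF assms])
  fix k assume "\<exists>js. length js = k \<and> (\<forall>j\<in>set js. Suc j < n) \<and> w = word js"
  then obtain js where "length js = k" "\<forall>j\<in>set js. Suc j < n" "w = word js" by blast
  then show "card (inversions n w) \<le> k" using inversions_word[of js n] by simp
qed

text \<open>Minimal length rules out descents inside either block; the representative is then
  determined by the image of the first block.\<close>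

lemma min_coset_repsD:
  assumes w: "w \<in> min_coset_reps a b"
  shows "w permutes {..<a + b}"
    and "map w [0..<a] = sorted_list_of_set (w ` {..<a})"
    and "map w [a..<a + b] = sorted_list_of_set ({..<a + b} - w ` {..<a})"
proof -
  show p: "w permutes {..<a + b}" using w by (simp add: min_coset_reps_def)
  have inc: "w i < w (Suc i)" if i: "Suc i < a \<or> a \<le> i \<and> Suc i < a + b" for i
  proof (rule ccontr)
    assume "\<not> w i < w (Suc i)"
    moreover have "w (Suc i) \<noteq> w i" using permutes_inj[OF p] by (metis injD n_not_Suc_n)
    ultimately have d: "w (Suc i) < w i" by simp
    have lt: "Suc i < a + b" using i by auto
    \<comment> \<open>The swap at a descent inside one block stabilizes the first block, so it leads
      to an element of the same coset with fewer inversions.\<close>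
    have "adj i ` {..<a} = {..<a}"
    proof (cases "Suc i < a")
      case True
      then show ?thesis by (intro permutes_image adj_permutes)
    next
      case False
      then have "adj i x = x" if "x < a" for x using i that by (auto simp: transpose_def)
      then show ?thesis by simp
    qed
    then have "perm_length (a + b) w \<le> perm_length (a + b) (w \<circ> adj i)"
      using w adj_permutes[OF lt] by (simp add: min_coset_reps_def)
    moreover have "w \<circ> adj i permutes {..<a + b}"
      using p adj_permutes[OF lt] by (rule permutes_compose[rotated])
    ultimately show False
      using card_inversions_adj(1)[OF lt, of w] d by (simp add: perm_length_inversions p)
  qed
  have "map w [0..<a] = sorted_list_of_set (w ` {0..<a})"
    by (rule map_permutes_sorted[OF p]) (use inc in auto)
  then show "map w [0..<a] = sorted_list_of_set (w ` {..<a})"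
    by (simp add: lessThan_atLeast0)
  have "map w [a..<a + b] = sorted_list_of_set (w ` {a..<a + b})"
    by (rule map_permutes_sorted[OF p]) (use inc in auto)
  moreover have "w ` {a..<a + b} = {..<a + b} - w ` {..<a}"
  proof -
    have "{a..<a + b} = {..<a + b} - {..<a}" by auto
    then have "w ` {a..<a + b} = w ` {..<a + b} - w ` {..<a}"
      using image_set_diff[OF permutes_inj[OF p]] by metis
    then show ?thesis by (simp add: permutes_image[OF p])
  qed
  ultimately show "map w [a..<a + b] = sorted_list_of_set ({..<a + b} - w ` {..<a})" by simp
qed

lemma min_coset_reps_eqI:
  assumes "w \<in> min_coset_reps a b" "w' permutes {..<a + b}"
    and "map w' [0..<a] = map w [0..<a]" "map w' [a..<a + b] = map w [a..<a + b]"
  shows "w' = w"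
proof
  fix i
  have "map w' [0..<a + b] = map w [0..<a + b]"
    using assms(3,4) by (metis le_add1 map_append upt_add_eq_append zero_le)
  then have "w' i = w i" if "i < a + b"
    using that by (metis atLeastLessThan_iff map_eq_conv set_upt zero_le)
  then show "w' i = w i"
    using permutes_not_in[OF assms(2)] permutes_not_in[OF min_coset_repsD(1)[OF assms(1)]]
    by (cases "i < a + b") auto
qed

text \<open>Start with the permutation that lists \<open>S\<close> and then its complement, and
  multiply it on the right by a stabilizing permutation for which the length becomes least.\<close>

lemma min_coset_reps_exists:
  assumes S: "S \<subseteq> {..<a + b}" "card S = a"
  shows "\<exists>w\<in>min_coset_reps a b. w ` {..<a} = S"
proof -
  let ?n = "a + b"
  have "finite S" using S finite_subset by blast
  then have "\<exists>v. v permutes {..<?n} \<and> v ` {..<a} = S"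
  proof -
    let ?l = "sorted_list_of_set S @ sorted_list_of_set ({..<?n} - S)"
    let ?v = "\<lambda>i. if i < ?n then ?l ! i else i"
    have d: "distinct ?l" using \<open>finite S\<close> by auto
    have s: "set ?l = {..<?n}" using \<open>finite S\<close> S by auto
    have l: "length ?l = ?n" using distinct_card[OF d] s by simp
    have "bij_betw ((!) ?l) {..<?n} {..<?n}"
      using bij_betw_nth[OF d] l s by metis
    then have "bij_betw ?v {..<?n} {..<?n}"
      by (rule bij_betw_cong[THEN iffD1, rotated]) simp
    then have "?v permutes {..<?n}"
      by (rule bij_imp_permutes) simp
    moreover have "?v ` {..<a} = S"
    proof -
      have "?v i = sorted_list_of_set S ! i" if "i < a" for i
        using that S by (simp add: nth_append)
      then have "?v ` {..<a} = (!) (sorted_list_of_set S) ` {..<a}" by (intro image_cong) auto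
      also have "\<dots> = set (sorted_list_of_set S)"
        using S by (auto simp: set_conv_nth)
      finally show ?thesis using \<open>finite S\<close> by simp
    qed
    ultimately show ?thesis by blast
  qed
  then obtain v where v: "v permutes {..<?n}" "v ` {..<a} = S" by blast
  let ?P = "\<lambda>u. u permutes {..<?n} \<and> u ` {..<a} = {..<a}"
  have "?P id" by (simp add: permutes_id)
  then obtain u where u: "?P u" and min: "\<And>u'. ?P u' \<Longrightarrow> perm_length ?n (v \<circ> u) \<le> perm_length ?n (v \<circ> u')"
    using ex_has_least_nat[of ?P id "\<lambda>u. perm_length ?n (v \<circ> u)"] by blast
  have "v \<circ> u \<in> min_coset_reps a b"
    unfolding min_coset_reps_def
  proof (intro CollectI conjI allI impI)
    show "v \<circ> u permutes {..<?n}" using u v permutes_compose by blast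
    fix u' assume u': "u' permutes {..<?n} \<and> u' ` {..<a} = {..<a}"
    moreover have "(u \<circ> u') ` {..<a} = u ` (u' ` {..<a})" by (simp only: image_comp)
    ultimately have "?P (u \<circ> u')" using u permutes_compose[of u' _ u] by (simp del: o_apply)
    then show "perm_length ?n (v \<circ> u) \<le> perm_length ?n (v \<circ> u \<circ> u')"
      unfolding Fun.comp_assoc by (rule min)
  qed
  moreover have "(v \<circ> u) ` {..<a} = S" using u v by (simp only: image_comp[symmetric])
  ultimately show ?thesis by blast
qed

section \<open>Unshuffles as signed sums over coset representatives\<close>

definition crossings :: "nat set \<Rightarrow> nat set \<Rightarrow> nat" where
  "crossings A B = card {(i, j). i \<in> A \<and> j \<in> B \<and> j < i}"

text \<open>Both blocks are increasing, so an inversion joins a position of the first block to one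
  of the second; \<open>w\<close> carries these pairs to pairs of values.\<close>

lemma card_inversions_coset:
  assumes w: "w \<in> min_coset_reps a b"
  shows "card (inversions (a + b) w) = crossings (w ` {..<a}) ({..<a + b} - w ` {..<a})"
proof -
  note p = min_coset_repsD(1)[OF w]
  have inj: "w i = w j \<longleftrightarrow> i = j" for i j using permutes_inj[OF p] by (auto dest: injD)
  have s1: "sorted_wrt (<) (map w [0..<a])" "sorted_wrt (<) (map w [a..<a + b])"
    unfolding min_coset_repsD[OF w] by (rule strict_sorted_list_of_set)+
  have inc: "w i < w j" if "i < j" "j < a \<or> a \<le> i \<and> j < a + b" for i j
  proof (cases "j < a")
    case True
    then show ?thesis using s1(1) that by (auto simp: sorted_wrt_iff_nth_less)
  next
    case False
    then show ?thesis
      using sorted_wrt_nth_less[OF s1(2), of "i - a" "j - a"] that by auto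
  qed
  have "bij_betw (map_prod w w) (inversions (a + b) w)
      {(i, j). i \<in> w ` {..<a} \<and> j \<in> {..<a + b} - w ` {..<a} \<and> j < i}"
    unfolding bij_betw_def
  proof (intro conjI equalityI subsetI)
    show "inj_on (map_prod w w) (inversions (a + b) w)" by (auto simp: inj_on_def inj)
    fix x
    {
      assume "x \<in> map_prod w w ` inversions (a + b) w"
      then obtain i j where x: "x = (w i, w j)" "i < j" "j < a + b" "w j < w i"
        by (auto simp: inversions_def)
      then have "i < a" "\<not> j < a" using inc[of i j] by fastforce+
      moreover have "w j < a + b" using x permutes_in_image[OF p, of j] by simp
      ultimately show "x \<in> {(i, j). i \<in> w ` {..<a} \<and> j \<in> {..<a + b} - w ` {..<a} \<and> j < i}"
        using x by (auto simp: inj)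
    }
    assume "x \<in> {(i, j). i \<in> w ` {..<a} \<and> j \<in> {..<a + b} - w ` {..<a} \<and> j < i}"
    then obtain i y where x: "x = (w i, y)" "i < a" "y < a + b" "y \<notin> w ` {..<a}" "y < w i" by auto
    obtain j where j: "y = w j" "j < a + b" using x(3) permutes_image[OF p] by (metis imageE lessThan_iff)
    have "\<not> j < a" using x(4) j by auto
    then have "(i, j) \<in> inversions (a + b) w" using x j by (auto simp: inversions_def)
    then show "x \<in> map_prod w w ` inversions (a + b) w" using x j by (auto intro!: image_eqI)
  qed
  then show ?thesis unfolding crossings_def by (rule bij_betw_same_card)
qed

text \<open>In an increasing word a subword is a subset \<open>S\<close>, and a letter outside
  \<open>S\<close> stands in front of one inside exactly when it is smaller.\<close>

lemma unsh_subsets: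
  assumes "sorted_wrt (<) k"
  shows "unsh g k = (\<Sum>S\<in>Pow (set k). (-1) ^ crossings S (set k - S) *
    g (sorted_list_of_set S) (sorted_list_of_set (set k - S)))"
  using assms
proof (induction k arbitrary: g)
  case Nil
  then show ?case by (simp add: crossings_def)
next
  case (Cons x k)
  let ?K = "set k" and ?l = sorted_list_of_set
  have x: "x \<notin> ?K" "\<And>y. y \<in> ?K \<Longrightarrow> x < y" using Cons.prems by auto
  have ins: "?l (insert x S) = x # ?l S" if "S \<subseteq> ?K" for S
  proof -
    have "finite S" using that finite_subset by blast
    moreover have "x \<notin> S" "\<forall>y\<in>S. x \<le> y" using that x by (auto intro: less_imp_le)
    ultimately show ?thesis
      by (simp add: insort_is_Cons sorted_list_of_set_insert)
  qed
  have c1: "crossings (insert x S) (set (x # k) - insert x S) = crossings S (?K - S)" if "S \<subseteq> ?K" for S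
    unfolding crossings_def using that x by (intro arg_cong[of _ _ card]) (auto dest: x(2))
  \<comment> \<open>\<open>x\<close> is smaller than all other letters, so leaving it outside
    \<open>S\<close> adds one crossing with each element of \<open>S\<close>.\<close>
  have c2: "crossings S (set (x # k) - S) = card S + crossings S (?K - S)" if "S \<subseteq> ?K" for S
  proof -
    have "{(i, j). i \<in> S \<and> j \<in> set (x # k) - S \<and> j < i} =
        (\<lambda>i. (i, x)) ` S \<union> {(i, j). i \<in> S \<and> j \<in> ?K - S \<and> j < i}"
      using that x by auto
    moreover have "finite S" using that finite_subset by blast
    moreover have "finite {(i, j). i \<in> S \<and> j \<in> ?K - S \<and> j < i}"
      by (rule finite_subset[of _ "S \<times> ?K"]) (use \<open>finite S\<close> in auto)
    moreover have "(\<lambda>i. (i, x)) ` S \<inter> {(i, j). i \<in> S \<and> j \<in> ?K - S \<and> j < i} = {}"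
      using x by auto
    moreover have "card ((\<lambda>i. (i, x)) ` S) = card S"
      by (intro card_image) (auto simp: inj_on_def)
    ultimately show ?thesis unfolding crossings_def by (simp add: card_Un_disjoint)
  qed
  have "unsh g (x # k) = (\<Sum>S\<in>Pow ?K. (-1) ^ crossings S (?K - S) *
      (g (x # ?l S) (?l (?K - S)) + (-1) ^ length (?l S) * g (?l S) (x # ?l (?K - S))))"
    using Cons by simp
  also have "\<dots> = (\<Sum>S\<in>Pow ?K. (-1) ^ crossings (insert x S) (set (x # k) - insert x S) *
        g (?l (insert x S)) (?l (set (x # k) - insert x S))) +
      (\<Sum>S\<in>Pow ?K. (-1) ^ crossings S (set (x # k) - S) * g (?l S) (?l (set (x # k) - S)))"
    unfolding sum.distrib[symmetric]
  proof (rule sum.cong[OF HOL.refl])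
    fix S assume "S \<in> Pow ?K"
    then have S: "S \<subseteq> ?K" by simp
    have e: "set (x # k) - insert x S = ?K - S" "set (x # k) - S = insert x (?K - S)" using S x by auto
    show "(-1) ^ crossings S (?K - S) * (g (x # ?l S) (?l (?K - S)) + (-1) ^ length (?l S) * g (?l S) (x # ?l (?K - S))) =
        (-1) ^ crossings (insert x S) (set (x # k) - insert x S) * g (?l (insert x S)) (?l (set (x # k) - insert x S)) +
        (-1) ^ crossings S (set (x # k) - S) * g (?l S) (?l (set (x # k) - S))"
      unfolding c1[OF S] c2[OF S] unfolding e
      using ins[OF S] ins[of "?K - S"] by (simp add: power_add algebra_simps)
  qed
  also have "\<dots> = (\<Sum>S\<in>Pow (set (x # k)). (-1) ^ crossings S (set (x # k) - S) * g (?l S) (?l (set (x # k) - S)))"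
  proof -
    have "inj_on (insert x) (Pow ?K)"
      using x(1) by (intro inj_onI) (metis Pow_iff insert_ident subsetD)
    then show ?thesis
      unfolding list.set(2) Pow_insert using x
      by (subst sum.union_disjoint) (auto simp: sum.reindex add.commute)
  qed
  finally show ?case .
qed

lemma finite_min_coset_reps: "finite (min_coset_reps a b)"
  by (rule finite_subset[OF _ finite_permutations[of "{..<a + b}"]]) (auto simp: min_coset_reps_def)

text \<open>Minimal representatives correspond to subsets with \<open>a\<close> elements through the
  image of the first block, and length becomes the crossing number.\<close>

lemma unsh_min_coset_reps:
  "unsh (restr a g) [0..<a + b] =
    (\<Sum>w\<in>min_coset_reps a b. (-1) ^ perm_length (a + b) w * g (map w [0..<a]) (map w [a..<a + b]))"
proof -
  let ?n = "a + b" and ?l = sorted_list_of_set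
  let ?S = "{S \<in> Pow {..<?n}. card S = a}"
  have "unsh (restr a g) [0..<?n] = (\<Sum>S\<in>Pow {..<?n}. (-1) ^ crossings S ({..<?n} - S) *
      restr a g (?l S) (?l ({..<?n} - S)))"
    using unsh_subsets[of "[0..<?n]" "restr a g"] by (simp add: lessThan_atLeast0)
  also have "\<dots> = (\<Sum>S\<in>?S. (-1) ^ crossings S ({..<?n} - S) * g (?l S) (?l ({..<?n} - S)))"
    by (rule sum.mono_neutral_cong_right) (auto simp: restr_def)
  also have "\<dots> = (\<Sum>w\<in>min_coset_reps a b. (-1) ^ perm_length ?n w * g (map w [0..<a]) (map w [a..<?n]))"
  proof (rule sum.reindex_bij_betw[symmetric, THEN HOL.trans])
    show "bij_betw (\<lambda>w. w ` {..<a}) (min_coset_reps a b) ?S"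
      unfolding bij_betw_def
    proof (intro conjI equalityI subsetI)
      show "inj_on (\<lambda>w. w ` {..<a}) (min_coset_reps a b)"
      proof (rule inj_onI)
        fix w w' assume w: "w \<in> min_coset_reps a b" and w': "w' \<in> min_coset_reps a b"
          and eq: "w ` {..<a} = w' ` {..<a}"
        show "w = w'"
          by (rule min_coset_reps_eqI[OF w' min_coset_repsD(1)[OF w]])
            (simp_all only: min_coset_repsD(2,3)[OF w] min_coset_repsD(2,3)[OF w'] eq)
      qed
      fix S
      show "S \<in> (\<lambda>w. w ` {..<a}) ` min_coset_reps a b" if "S \<in> ?S"
      proof -
        have "S \<subseteq> {..<?n}" "card S = a" using that by auto
        then obtain w where "w \<in> min_coset_reps a b" "w ` {..<a} = S"
          using min_coset_reps_exists by blast
        then show ?thesis by blast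
      qed
      show "S \<in> ?S" if "S \<in> (\<lambda>w. w ` {..<a}) ` min_coset_reps a b"
      proof -
        obtain w where w: "w \<in> min_coset_reps a b" "S = w ` {..<a}" using \<open>S \<in> _\<close> by auto
        note p = min_coset_repsD(1)[OF w(1)]
        have "S \<subseteq> w ` {..<?n}" unfolding w(2) by (intro image_mono) auto
        moreover have "card S = a" unfolding w(2) using card_image[OF permutes_inj_on[OF p]] by simp
        ultimately show ?thesis by (simp add: permutes_image[OF p])
      qed
    qed
    show "(\<Sum>w\<in>min_coset_reps a b. (-1) ^ crossings (w ` {..<a}) ({..<?n} - w ` {..<a}) *
        g (?l (w ` {..<a})) (?l ({..<?n} - w ` {..<a}))) =
      (\<Sum>w\<in>min_coset_reps a b. (-1) ^ perm_length ?n w * g (map w [0..<a]) (map w [a..<?n]))"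
      by (intro sum.cong HOL.refl)
        (simp add: perm_length_inversions[OF min_coset_repsD(1)] card_inversions_coset min_coset_repsD)
  qed
  finally show ?thesis .
qed

text \<open>\<open>wedge_split\<close> is applied to \<open>ys\<close> written as the image of the
  positions \<open>[0..<a + b]\<close>; the positions form an increasing word, so its unshuffles are
  the coset representatives.\<close>

theorem wedge_coset:
  assumes ys: "length ys = a + b" "set ys \<subseteq> Vspace N"
  shows "wedge ys = (\<Sum>w\<in>min_coset_reps a b. vscale ((-1) ^ perm_length (a + b) w)
     (wedge (map (\<lambda>k. ys ! w k) [0..<a]) \<star> wedge (map (\<lambda>k. ys ! w k) [a..<a + b])))"
    (is "_ = ?R")
proof (rule vec_eqI)
  let ?y = "(!) ys"
  have mem: "wedge (map (\<lambda>k. ys ! w k) [0..<a]) \<in> tens N a" if "w \<in> min_coset_reps a b" for w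
  proof -
    have "w k < a + b" if "k < a" for k
      using that permutes_in_image[OF min_coset_repsD(1)[OF \<open>w \<in> _\<close>], of k] by simp
    then have "set (map (\<lambda>k. ys ! w k) [0..<a]) \<subseteq> Vspace N" using ys by auto
    then show ?thesis using wedge_in_tens by fastforce
  qed
  fix k
  have "?R (Idx k) = (\<Sum>w\<in>min_coset_reps a b. (-1) ^ perm_length (a + b) w *
      (wedge (map ?y (map w [0..<a])) (Idx (take a k)) * wedge (map ?y (map w [a..<a + b])) (Idx (drop a k))))"
    by (simp add: sum_pw pw star_tens_left[OF mem] comp_def)
  also have "\<dots> = unsh (restr a (\<lambda>p q. wedge (map ?y p) (Idx (take a k)) * wedge (map ?y q) (Idx (drop a k)))) [0..<a + b]"
    by (rule unsh_min_coset_reps[symmetric])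
  also have "\<dots> = wedge ys (Idx k)"
  proof (cases "length k = a + b")
    case True
    have "wedge (map ?y [0..<length ys]) (Idx (take a k @ drop a k)) =
       unsh (\<lambda>p q. wedge (map ?y p) (Idx (take a k)) * wedge (map ?y q) (Idx (drop a k))) [0..<length ys]"
      unfolding wedge_split unsh_map ..
    moreover have "\<dots> = unsh (restr a (\<lambda>p q. wedge (map ?y p) (Idx (take a k)) * wedge (map ?y q) (Idx (drop a k)))) [0..<length ys]"
      using True by (intro unsh_cong) (auto simp: restr_def wedge_length)
    moreover have "map ?y [0..<length ys] = ys" by (rule map_nth)
    ultimately show ?thesis by (simp add: ys)
  next
    case False
    have "unsh (restr a (\<lambda>p q. wedge (map ?y p) (Idx (take a k)) * wedge (map ?y q) (Idx (drop a k)))) [0..<a + b] =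
      unsh (\<lambda>p q. 0) [0..<a + b]"
    proof (rule unsh_length)
      fix p q :: "nat list" assume "length p + length q = length [0..<a + b]"
      then show "restr a (\<lambda>p q. wedge (map ?y p) (Idx (take a k)) * wedge (map ?y q) (Idx (drop a k))) p q = 0"
        using False by (cases "length (take a k) = a") (auto simp: restr_def wedge_length)
    qed
    then show ?thesis using False ys by (simp add: wedge_length)
  qed
  finally show "wedge ys (Idx k) = ?R (Idx k)" ..
qed (simp_all add: sum_pw pw)

section \<open>The modules attached to words and the maps attached to webs\<close>

primrec gens :: "nat \<Rightarrow> nat list \<Rightarrow> vec set" where
  "gens N [] = {unit_tensor}"
| "gens N (a # x) = {wedge ys \<star> u |ys u. length ys = a \<and> set ys \<subseteq> Vspace N \<and> u \<in> gens N x}"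

definition wspace :: "nat \<Rightarrow> nat list \<Rightarrow> vec set" where
  "wspace N x = cfun.span (gens N x)"

definition basis :: "int list \<Rightarrow> vec" where
  "basis l = on_words (\<lambda>k. if k = l then 1 else 0)"

definition cup :: "nat \<Rightarrow> nat \<Rightarrow> vec" where
  "cup N a = (\<Sum>i\<in>incs N a. wedge_vb i \<star> wedge_vb (rho i))"

text \<open>The shuffle product read off from the concatenation of its two factors; the degree
  \<open>a\<close> of the first factor tells where \<open>t\<close> has to be cut.\<close>

definition merge_map :: "nat \<Rightarrow> vec \<Rightarrow> vec" where
  "merge_map a t = on_words (unsh (restr a (\<lambda>p q. t (Idx (p @ q)))))"

text \<open>In the output the factor of degree \<open>b\<close> comes first, so its letters are the
  first \<open>b\<close> letters of \<open>k\<close>.\<close>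

definition cross_map :: "nat \<Rightarrow> nat \<Rightarrow> vec \<Rightarrow> vec" where
  "cross_map a b t = on_words (\<lambda>k. (-1) ^ (a * b) * t (Idx (drop b k @ take b k)))"

text \<open>The sum runs over all words instead of the increasing ones, each of which is counted
  \<open>a\<close>! times on alternating tensors. In this form the cap makes sense on arbitrary
  tensors.\<close>

definition cap_val :: "nat \<Rightarrow> nat \<Rightarrow> vec \<Rightarrow> complex" where
  "cap_val N a t = (\<Sum>k\<in>words N a. t (Idx (k @ rho k))) / fact a"

text \<open>Total on all vectors, so that linearity holds for ill-typed arguments too. For a tensor
  product of webs, words are cut at the total thickness of the domain of \<open>f\<close>, and the
  factors are evaluated on basis tensors, which need not be alternating.\<close>

primrec ev :: "nat \<Rightarrow> web \<Rightarrow> vec \<Rightarrow> vec" where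
  "ev N (Ident x) = (\<lambda>t. t)"
| "ev N (Merge a b) = merge_map a"
| "ev N (Split a b) = (\<lambda>t. t)"
| "ev N (Cross a b) = cross_map a b"
| "ev N (Cup a) = (\<lambda>t. vscale (t (Idx [])) (cup N a))"
| "ev N (Cap a) = (\<lambda>t. vscale (cap_val N a t) unit_tensor)"
| "ev N (f \<odot>\<odot> g) = (\<lambda>t. ev N f (ev N g t))"
| "ev N (f \<otimes>\<otimes> g) = (\<lambda>t. \<Sum>l\<in>words N (sum_list (web_dom f) + sum_list (web_dom g)).
     vscale (t (Idx l)) (ev N f (basis (take (sum_list (web_dom f)) l)) \<star>
       ev N g (basis (drop (sum_list (web_dom f)) l))))"
| "ev N (Zero x y) = (\<lambda>t. 0)"
| "ev N (f \<oplus>\<oplus> g) = (\<lambda>t. ev N f t + ev N g t)"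
| "ev N (Scale c f) = (\<lambda>t. vscale c (ev N f t))"

section \<open>Linearity and multiplicativity of the evaluation of webs\<close>

lemma lin_UNIV: "lin UNIV UNIV f \<longleftrightarrow> (\<forall>v w. f (v + w) = f v + f w) \<and> (\<forall>c v. f (vscale c v) = vscale c (f v))"
  by (simp add: lin_def)

lemma lin_UNIV_sum: "lin UNIV UNIV f \<Longrightarrow> f (\<Sum>a\<in>A. t a) = (\<Sum>a\<in>A. f (t a))"
  by (cases "finite A") (simp_all add: lin_sum[of UNIV UNIV] lin_zero[of UNIV UNIV])

lemma lin_star: "lin UNIV UNIV (\<lambda>t. t \<star> u)" "lin UNIV UNIV (\<lambda>u. t \<star> u)"
  and lin_shuf: "lin UNIV UNIV (\<lambda>t. shuf t u)" "lin UNIV UNIV (\<lambda>u. shuf t u)"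
  and lin_dv: "lin UNIV UNIV (dv N g)"
  by (auto simp: lin_UNIV star_add star_scale shuf_add shuf_scale dv_add dv_scale)

lemma lin_comp: "lin UNIV UNIV h \<Longrightarrow> lin UNIV UNIV f \<Longrightarrow> lin UNIV UNIV (\<lambda>w. f (h w))"
  by (rule lin_compose)

lemma lin_sum_fun: "(\<And>a. a \<in> A \<Longrightarrow> lin UNIV UNIV (f a)) \<Longrightarrow> lin UNIV UNIV (\<lambda>t. \<Sum>a\<in>A. f a t)"
  by (induction A rule: infinite_finite_induct) (auto simp: lin_const_zero lin_plus)

lemma lin_functional: 
  assumes "\<And>v w. \<phi> (v + w) = \<phi> v + \<phi> w" "\<And>c v. \<phi> (vscale c v) = c * \<phi> v"
  shows "lin UNIV UNIV (\<lambda>t. vscale (\<phi> t) u)"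
  using assms by (simp add: lin_UNIV cfun.scale_left_distrib)

lemma lin_ev: "lin UNIV UNIV (ev N f)"
proof (induction f)
  case (Merge a b)
  have "merge_map a (v + w) = merge_map a v + merge_map a w" for v w
    by (rule label_eqI) (simp_all add: merge_map_def on_words_simps pw unsh_add[symmetric],
        rule unsh_cong, simp add: restr_def)
  moreover have "merge_map a (vscale c v) = vscale c (merge_map a v)" for c v
    by (rule label_eqI) (simp_all add: merge_map_def on_words_simps pw unsh_scale[symmetric],
        rule unsh_cong, simp add: restr_def)
  ultimately show ?case by (simp add: lin_UNIV)
next
  case (Cross a b)
  have "cross_map a b (v + w) = cross_map a b v + cross_map a b w"
    "cross_map a b (vscale c v) = vscale c (cross_map a b v)" for v w c
    by (rule label_eqI; simp add: cross_map_def on_words_simps pw algebra_simps)+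
  then show ?case by (simp add: lin_UNIV)
next
  case (Cup a)
  show ?case unfolding ev.simps by (rule lin_functional) (simp_all add: pw)
next
  case (Cap a)
  show ?case unfolding ev.simps
    by (rule lin_functional) (simp_all add: cap_val_def pw sum.distrib sum_distrib_left add_divide_distrib)
next
  case (Comp f g)
  show ?case unfolding ev.simps by (rule lin_comp[OF Comp.IH(2) Comp.IH(1)])
next
  case (Tens f g)
  show ?case unfolding ev.simps by (rule lin_sum_fun, rule lin_functional) (simp_all add: pw)
next
  case (Add f g)
  show ?case unfolding ev.simps by (rule lin_plus[OF Add.IH]) simp
next
  case (Scale c f)
  show ?case unfolding ev.simps by (rule lin_vscale[OF Scale.IH]) simp
qed (auto simp: lin_UNIV)

lemma ev_add: "ev N f (t + u) = ev N f t + ev N f u"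
  and ev_scale: "ev N f (vscale c t) = vscale c (ev N f t)"
  and ev_sum: "ev N f (\<Sum>a\<in>A. s a) = (\<Sum>a\<in>A. ev N f (s a))"
  using lin_ev[of N f] lin_UNIV_sum[OF lin_ev, of N f s A] by (simp_all add: lin_UNIV)

lemma basis_in_tens: "l \<in> words N n \<Longrightarrow> basis l \<in> tens N n"
  by (auto simp: tens_def basis_def on_words_simps)

lemma basis_apply: "basis l (Idx k) = (if k = l then 1 else 0)" "basis l (Tensor p q) = 0"
  by (simp_all add: basis_def on_words_simps)

lemma tens_expand:
  assumes "t \<in> tens N n"
  shows "t = (\<Sum>l\<in>words N n. vscale (t (Idx l)) (basis l))"
proof (rule vec_eqI)
  fix k
  have "(\<Sum>l\<in>words N n. vscale (t (Idx l)) (basis l)) (Idx k) = (\<Sum>l\<in>words N n. if k = l then t (Idx l) else 0)"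
    unfolding sum_pw by (intro sum.cong) (auto simp: pw basis_apply)
  then show "t (Idx k) = (\<Sum>l\<in>words N n. vscale (t (Idx l)) (basis l)) (Idx k)"
    using tensD(2)[OF assms] by simp
qed (simp_all add: sum_pw pw basis_apply tensD[OF assms])

lemma basis_append: "p \<in> words N m \<Longrightarrow> basis (p @ q) = basis p \<star> basis q"
proof (rule vec_eqI)
  fix k assume p: "p \<in> words N m"
  have "k = p @ q \<longleftrightarrow> take m k = p \<and> drop m k = q"
    using p by (auto simp: words_def) (metis append_take_drop_id)
  then show "basis (p @ q) (Idx k) = (basis p \<star> basis q) (Idx k)"
    by (simp add: star_tens_left[OF basis_in_tens[OF p]] basis_apply)
qed (simp_all add: basis_apply)

lemma star_sum: "(\<Sum>a\<in>A. f a) \<star> u = (\<Sum>a\<in>A. f a \<star> u)" "t \<star> (\<Sum>a\<in>A. f a) = (\<Sum>a\<in>A. t \<star> f a)"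
  using lin_UNIV_sum[OF lin_star(1)] lin_UNIV_sum[OF lin_star(2)] by auto

text \<open>Only the degrees of \<open>t\<close> and \<open>u\<close> matter. Caps can therefore be
  computed on basis tensors that lie outside the word spaces.\<close>

lemma ev_tens:
  assumes t: "t \<in> tens N (sum_list (web_dom f))" and u: "u \<in> tens N (sum_list (web_dom g))"
  shows "ev N (f \<otimes>\<otimes> g) (t \<star> u) = ev N f t \<star> ev N g u"
proof -
  let ?m = "sum_list (web_dom f)" and ?n = "sum_list (web_dom g)"
  have "ev N (f \<otimes>\<otimes> g) (t \<star> u) = (\<Sum>p\<in>words N ?m. \<Sum>q\<in>words N ?n.
      vscale ((t \<star> u) (Idx (p @ q))) (ev N f (basis (take ?m (p @ q))) \<star> ev N g (basis (drop ?m (p @ q)))))"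
    unfolding ev.simps
  proof (rule label_eqI)
    fix k
    show "(\<Sum>l\<in>words N (?m + ?n). vscale ((t \<star> u) (Idx l)) (ev N f (basis (take ?m l)) \<star> ev N g (basis (drop ?m l)))) (Idx k) =
      (\<Sum>p\<in>words N ?m. \<Sum>q\<in>words N ?n.
      vscale ((t \<star> u) (Idx (p @ q))) (ev N f (basis (take ?m (p @ q))) \<star> ev N g (basis (drop ?m (p @ q))))) (Idx k)"
      unfolding sum_pw by (rule sum_words_append)
  qed (simp add: sum_pw pw)
  also have "\<dots> = (\<Sum>p\<in>words N ?m. \<Sum>q\<in>words N ?n.
      vscale (t (Idx p)) (ev N f (basis p)) \<star> vscale (u (Idx q)) (ev N g (basis q)))"
  proof (intro sum.cong HOL.refl)
    fix p q assume "p \<in> words N ?m" "q \<in> words N ?n"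
    then have "length p = ?m" by (simp add: words_def)
    then show "vscale ((t \<star> u) (Idx (p @ q))) (ev N f (basis (take ?m (p @ q))) \<star> ev N g (basis (drop ?m (p @ q)))) =
        vscale (t (Idx p)) (ev N f (basis p)) \<star> vscale (u (Idx q)) (ev N g (basis q))"
      using t by (simp add: star_append star_scale mult.commute)
  qed
  also have "\<dots> = ev N f (\<Sum>p\<in>words N ?m. vscale (t (Idx p)) (basis p)) \<star>
      ev N g (\<Sum>q\<in>words N ?n. vscale (u (Idx q)) (basis q))"
    unfolding ev_sum ev_scale star_sum(1) unfolding star_sum(2) ..
  also have "\<dots> = ev N f t \<star> ev N g u"
    using tens_expand[OF t] tens_expand[OF u] by simp
  finally show ?thesis .
qed

lemma ev_tens_id:
  assumes "\<And>t. ev N f t = t" "\<And>t. ev N g t = t" "t \<in> tens N (sum_list (web_dom f) + sum_list (web_dom g))"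
  shows "ev N (f \<otimes>\<otimes> g) t = t"
proof -
  have "basis (take (sum_list (web_dom f)) l) \<star> basis (drop (sum_list (web_dom f)) l) = basis l"
    if "l \<in> words N (sum_list (web_dom f) + sum_list (web_dom g))" for l
    using basis_append[of "take (sum_list (web_dom f)) l" N "sum_list (web_dom f)" "drop (sum_list (web_dom f)) l"] that
    by (force simp: words_def dest: in_set_takeD)
  then show ?thesis
    using tens_expand[OF assms(3)] by (simp add: assms(1,2))
qed

section \<open>The spaces attached to words\<close>

lemma gens_tens: "t \<in> gens N x \<Longrightarrow> t \<in> tens N (sum_list x)"
  by (induction x arbitrary: t) (auto simp: unit_in_tens intro!: star_in_tens wedge_in_tens)

lemma wspace_tens: "t \<in> wspace N x \<Longrightarrow> t \<in> tens N (sum_list x)"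
  using cfun.span_minimal[of "gens N x" "tens N (sum_list x)"] gens_tens subspace_tens
  by (auto simp: wspace_def)

lemma subspace_wspace [simp]: "cfun.subspace (wspace N x)"
  by (simp add: wspace_def)

text \<open>Strictness on the module side: concatenating words corresponds to multiplying
  generators, so linear maps on \<open>wspace N (x @ y)\<close> need to be compared only on
  products.\<close>

lemma gens_append: "gens N (x @ y) = {t \<star> u |t u. t \<in> gens N x \<and> u \<in> gens N y}"
proof (induction x)
  case Nil
  have "{t \<star> u |t u. t \<in> gens N [] \<and> u \<in> gens N y} = (\<lambda>u. unit_tensor \<star> u) ` gens N y" by auto
  also have "\<dots> = (\<lambda>u. u) ` gens N y"
    by (rule image_cong[OF HOL.refl]) (rule unit_star(1)[OF gens_tens])
  finally show ?case by simp
next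
  case (Cons a x)
  show ?case unfolding append_Cons gens.simps Cons
    by (auto simp: star_assoc) (metis star_assoc)+
qed

lemma lin_UNIV_eq_on_span:
  assumes "lin UNIV UNIV f" "lin UNIV UNIV h" "\<And>b. b \<in> B \<Longrightarrow> f b = h b" "t \<in> cfun.span B"
  shows "f t = h t"
  by (rule lin_eq_on_span[OF lin_weaken[OF assms(1) subset_UNIV subset_refl]
        lin_weaken[OF assms(2) subset_UNIV subset_refl] assms(3,4)])

lemma lin_UNIV_into:
  assumes "lin UNIV UNIV f" "cfun.subspace Y" "\<And>b. b \<in> B \<Longrightarrow> f b \<in> Y" "t \<in> cfun.span B"
  shows "f t \<in> Y"
  by (rule lin_in[OF lin_into[OF lin_weaken[OF assms(1) subset_UNIV subset_refl] assms(2,3)] assms(4)])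

lemma wspace_star:
  assumes t: "t \<in> wspace N x" and u: "u \<in> wspace N y"
  shows "t \<star> u \<in> wspace N (x @ y)"
proof -
  have 1: "t' \<star> u \<in> wspace N (x @ y)" if "t' \<in> gens N x" for t'
    by (rule lin_UNIV_into[OF lin_star(2) subspace_wspace _ u[unfolded wspace_def]])
      (use that in \<open>auto simp: wspace_def gens_append intro!: cfun.span_base\<close>)
  show ?thesis
    by (rule lin_UNIV_into[OF lin_star(1) subspace_wspace 1 t[unfolded wspace_def]])
qed

lemma wspace_append_eqI:
  assumes f: "lin UNIV UNIV f" and h: "lin UNIV UNIV h"
    and eq: "\<And>t u. t \<in> wspace N x \<Longrightarrow> u \<in> wspace N y \<Longrightarrow> f (t \<star> u) = h (t \<star> u)"
    and s: "s \<in> wspace N (x @ y)"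
  shows "f s = h s"
  by (rule lin_UNIV_eq_on_span[OF f h _ s[unfolded wspace_def]])
    (auto simp: gens_append wspace_def intro!: eq cfun.span_base)

lemma wspace_append_into:
  assumes f: "lin UNIV UNIV f" and Y: "cfun.subspace Y"
    and eq: "\<And>t u. t \<in> wspace N x \<Longrightarrow> u \<in> wspace N y \<Longrightarrow> f (t \<star> u) \<in> Y"
    and s: "s \<in> wspace N (x @ y)"
  shows "f s \<in> Y"
  by (rule lin_UNIV_into[OF f Y _ s[unfolded wspace_def]])
    (auto simp: gens_append wspace_def intro!: eq cfun.span_base)

lemma gens_single: "gens N [a] = {wedge ys |ys. length ys = a \<and> set ys \<subseteq> Vspace N}"
proof -
  have "wedge ys \<star> unit_tensor = wedge ys" if "set ys \<subseteq> Vspace N" for ys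
    using wedge_in_tens[OF that] by simp
  then show ?thesis by (auto simp: set_eq_iff) metis+
qed

lemma wspace_single: "wspace N [a] = ext_space N a"
  by (simp add: wspace_def gens_single ext_space_def del: gens.simps)

lemma wspace_Nil: "wspace N [] = cfun.span {unit_tensor}"
  by (simp add: wspace_def)

lemma sum_thick [simp]: "sum_list (thick a) = a"
  by (simp add: thick_def)

lemma ext_tens: "t \<in> ext_space N a \<Longrightarrow> t \<in> tens N a"
  and ext_alt: "t \<in> ext_space N a \<Longrightarrow> alt_vec t"
  by (simp_all add: ext_space_iff)

lemma eq_on_wspace2:
  assumes f: "lin UNIV UNIV f" and h: "lin UNIV UNIV h"
    and eq: "\<And>t u. t \<in> ext_space N a \<Longrightarrow> u \<in> ext_space N b \<Longrightarrow> f (t \<star> u) = h (t \<star> u)"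
    and s: "s \<in> wspace N [a, b]"
  shows "f s = h s"
  by (rule wspace_append_eqI[OF f h, of N "[a]" "[b]"]) (use eq s in \<open>simp_all add: wspace_single\<close>)

lemma eq_on_wspace3:
  assumes f: "lin UNIV UNIV f" and h: "lin UNIV UNIV h"
    and eq: "\<And>t u v. t \<in> ext_space N a \<Longrightarrow> u \<in> ext_space N b \<Longrightarrow> v \<in> ext_space N c \<Longrightarrow>
      f (t \<star> u \<star> v) = h (t \<star> u \<star> v)"
    and s: "s \<in> wspace N [a, b, c]"
  shows "f s = h s"
proof (rule wspace_append_eqI[OF f h, of N "[a]" "[b, c]"])
  fix t w assume t: "t \<in> wspace N [a]" and w: "w \<in> wspace N [b, c]"
  show "f (t \<star> w) = h (t \<star> w)"
    by (rule eq_on_wspace2[OF lin_comp[OF lin_star(2) f] lin_comp[OF lin_star(2) h] _ w])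
      (use eq t in \<open>simp add: wspace_single\<close>)
qed (use s in simp)

section \<open>Generators evaluated on products\<close>

lemma merge_map_star:
  assumes "t \<in> tens N a"
  shows "merge_map a (t \<star> u) = shuf t u"
proof (rule label_eqI)
  fix k
  show "merge_map a (t \<star> u) (Idx k) = shuf t u (Idx k)"
    unfolding merge_map_def shuf_def on_words_simps
    by (rule unsh_cong) (use assms in \<open>auto simp: restr_def star_append dest: tensD(3)\<close>)
qed (simp add: merge_map_def on_words_simps)

lemma cross_map_star:
  assumes t: "t \<in> tens N a" and u: "u \<in> tens N b"
  shows "cross_map a b (t \<star> u) = vscale ((-1) ^ (a * b)) (u \<star> t)"
proof (rule label_eqI)
  fix k
  have "(t \<star> u) (Idx (drop b k @ take b k)) = (u \<star> t) (Idx k)"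
  proof (cases "length k = a + b")
    case True
    then show ?thesis using t by (simp add: star_append star_tens_left[OF u])
  next
    case False
    then show ?thesis
      using tensD(3)[OF star_in_tens[OF t u], of "drop b k @ take b k"] tensD(3)[OF star_in_tens[OF u t], of k]
      by auto
  qed
  then show "cross_map a b (t \<star> u) (Idx k) = vscale ((-1) ^ (a * b)) (u \<star> t) (Idx k)"
    by (simp add: cross_map_def on_words_simps pw)
qed (simp add: cross_map_def on_words_simps pw)

lemma cap_val_star: "t \<in> tens N a \<Longrightarrow> cap_val N a (t \<star> u) = (\<Sum>k\<in>words N a. t (Idx k) * u (Idx (rho k))) / fact a"
  unfolding cap_val_def
  by (intro arg_cong2[of _ _ _ _ "(/)"] sum.cong HOL.refl) (auto simp: star_append words_def)

lemma cap_val_ext: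
  assumes t: "t \<in> ext_space N a" and u: "u \<in> ext_space N a"
  shows "cap_val N a (t \<star> u) = (\<Sum>i\<in>incs N a. t (Idx i) * u (Idx (rho i)))"
  using sum_words_incs[OF ext_alt[OF t] alt_rho[OF ext_alt[OF u]], of N a]
  by (simp add: cap_val_star[OF ext_tens[OF t]])

lemma incsD: "i \<in> incs N a \<Longrightarrow> sorted_wrt (<) i" "i \<in> incs N a \<Longrightarrow> length i = a" "i \<in> incs N a \<Longrightarrow> set i \<subseteq> idx N"
  by (auto simp: incs_def)

lemma wedge_vb_ext: "i \<in> incs N a \<Longrightarrow> wedge_vb i \<in> ext_space N a"
  using wedge_vb_in_tens[of i N] by (auto simp: ext_space_iff alt_wedge incs_def)

text \<open>Increasing wedges and their \<open>rho\<close>-duals are dual bases for the cap; pairing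
  with one of them extracts a coefficient.\<close>

lemma cap_val_wedge_left:
  assumes i: "i \<in> incs N a" and u: "u \<in> ext_space N a"
  shows "cap_val N a (wedge_vb i \<star> u) = u (Idx (rho i))"
proof -
  have "(\<Sum>k\<in>incs N a. wedge_vb i (Idx k) * u (Idx (rho k))) = (\<Sum>k\<in>incs N a. if i = k then u (Idx (rho k)) else 0)"
    using i by (intro sum.cong) (auto simp: wedge_vb_incs incsD)
  then show ?thesis using i by (simp add: cap_val_ext[OF wedge_vb_ext[OF i] u])
qed

lemma cap_val_wedge_right:
  assumes i: "i \<in> incs N a" and t: "t \<in> ext_space N a"
  shows "cap_val N a (t \<star> wedge_vb i) = t (Idx (rho i))"
proof -
  have "(\<Sum>k\<in>incs N a. t (Idx k) * wedge_vb i (Idx (rho k))) = (\<Sum>k\<in>incs N a. if rho i = k then t (Idx k) else 0)"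
  proof (intro sum.cong HOL.refl)
    fix k assume k: "k \<in> incs N a"
    then have "i = rho k \<longleftrightarrow> rho i = k" by (metis rho_simps(4))
    then show "t (Idx k) * wedge_vb i (Idx (rho k)) = (if rho i = k then t (Idx k) else 0)"
      using i k wedge_vb_incs[of i "rho k"] incsD(1)[of "rho k" N a] by (auto simp: incsD)
  qed
  then show ?thesis using i by (simp add: cap_val_ext[OF t wedge_vb_ext[OF i]])
qed

lemma cup_in_wspace: "cup N a \<in> wspace N [a, a]"
  unfolding cup_def
proof (rule cfun.subspace_sum[OF subspace_wspace])
  fix i assume "i \<in> incs N a"
  then show "wedge_vb i \<star> wedge_vb (rho i) \<in> wspace N [a, a]"
    using wspace_star[of "wedge_vb i" N "[a]" "wedge_vb (rho i)" "[a]"]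
    by (simp add: wspace_single wedge_vb_ext)
qed

lemma merge_map_ext:
  assumes t: "t \<in> ext_space N (a + b)"
  shows "merge_map a t = vscale (of_nat ((a + b) choose a)) t"
proof (rule label_eqI)
  fix k
  have "t (Idx k) = 0" if "length k \<noteq> a + b"
    using tensD(3)[OF ext_tens[OF t]] that by simp
  then show "merge_map a t (Idx k) = vscale (of_nat ((a + b) choose a)) t (Idx k)"
    using unsh_alt[OF ext_alt[OF t], of a "[]" k]
    by (cases "length k = a + b") (simp_all add: merge_map_def on_words_simps pw)
qed (simp add: merge_map_def on_words_simps pw tensD(1)[OF ext_tens[OF t]])

lemma unit_in_wspace: "unit_tensor \<in> wspace N []"
  by (simp add: wspace_Nil cfun.span_base)

lemma wspace_scale: "t \<in> wspace N x \<Longrightarrow> vscale c t \<in> wspace N x"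
  by (rule cfun.subspace_scale[OF subspace_wspace])

lemma ext_star: "t \<in> ext_space N a \<Longrightarrow> u \<in> ext_space N b \<Longrightarrow> t \<star> u \<in> wspace N [a, b]"
  using wspace_star[of t N "[a]" u "[b]"] by (simp add: wspace_single)

lemma shuf_ext: "t \<in> ext_space N a \<Longrightarrow> u \<in> ext_space N b \<Longrightarrow> shuf t u \<in> ext_space N (a + b)"
  by (simp add: ext_space_iff shuf_in_tens alt_shuf)

text \<open>Makes the split a well-typed inclusion: by the coset expansion each wedge is a
  combination of products of two shorter wedges.\<close>

lemma ext_split:
  assumes "t \<in> ext_space N (a + b)"
  shows "t \<in> wspace N [a, b]"
proof -
  have "wedge ys \<in> wspace N [a, b]" if ys: "length ys = a + b" "set ys \<subseteq> Vspace N" for ys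
    unfolding wedge_coset[OF ys]
  proof (intro cfun.subspace_sum[OF subspace_wspace] wspace_scale ext_star)
    fix w assume w: "w \<in> min_coset_reps a b"
    have "w k < a + b" if "k < a + b" for k
      using that permutes_in_image[OF min_coset_repsD(1)[OF w], of k] by simp
    then have "set (map (\<lambda>k. ys ! w k) [0..<a]) \<subseteq> Vspace N" "set (map (\<lambda>k. ys ! w k) [a..<a + b]) \<subseteq> Vspace N"
      using ys by auto
    then show "wedge (map (\<lambda>k. ys ! w k) [0..<a]) \<in> ext_space N a" "wedge (map (\<lambda>k. ys ! w k) [a..<a + b]) \<in> ext_space N b"
      unfolding ext_space_def by (auto intro!: cfun.span_base simp del: set_map)
  qed
  then have "ext_space N (a + b) \<subseteq> wspace N [a, b]"
    unfolding ext_space_def by (intro cfun.span_minimal) auto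
  then show ?thesis using assms by auto
qed

lemma ev_wspace: "wt f \<Longrightarrow> t \<in> wspace N (web_dom f) \<Longrightarrow> ev N f t \<in> wspace N (web_cod f)"
proof (induction f arbitrary: t)
  case (Merge a b)
  then have t: "t \<in> wspace N ([a] @ [b])" by simp
  show ?case
    by (rule wspace_append_into[OF lin_ev subspace_wspace _ t])
      (simp add: wspace_single merge_map_star[OF ext_tens] shuf_ext)
next
  case (Split a b)
  then show ?case by (simp add: wspace_single ext_split)
next
  case (Cross a b)
  then have t: "t \<in> wspace N ([a] @ [b])" by simp
  show ?case
    by (rule wspace_append_into[OF lin_ev subspace_wspace _ t])
      (simp add: wspace_single cross_map_star[OF ext_tens ext_tens] wspace_scale ext_star)
next
  case (Tens f g)
  show ?case
    by (rule wspace_append_into[OF lin_ev subspace_wspace, of N "web_dom f" "web_dom g"])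
      (use Tens in \<open>simp_all add: ev_tens wspace_tens wspace_star del: ev.simps\<close>)
qed (auto simp: wspace_scale cup_in_wspace unit_in_wspace cfun.subspace_0 cfun.subspace_add)

section \<open>Soundness of the web relations\<close>

declare ev.simps(8) [simp del]

lemma ext_expand: "t \<in> ext_space N a \<Longrightarrow> t = (\<Sum>i\<in>incs N a. vscale (t (Idx i)) (wedge_vb i))"
  by (rule alt_expand) (simp_all add: ext_space_iff)

lemma ext_expand_rho: "t \<in> ext_space N a \<Longrightarrow> t = (\<Sum>i\<in>incs N a. vscale (t (Idx (rho i))) (wedge_vb (rho i)))"
proof -
  assume t: "t \<in> ext_space N a"
  have "(\<Sum>i\<in>incs N a. vscale (t (Idx (rho i))) (wedge_vb (rho i))) = (\<Sum>i\<in>incs N a. vscale (t (Idx i)) (wedge_vb i))"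
    by (rule sum.reindex_bij_witness[of _ rho rho]) auto
  then show ?thesis using ext_expand[OF t] by simp
qed

lemma wedge_vb_tens: "i \<in> incs N a \<Longrightarrow> wedge_vb i \<in> tens N a"
  by (rule ext_tens[OF wedge_vb_ext])

text \<open>Basis tensors are not alternating, so the factor 1/a! does not cancel here. It is kept
  until several caps are combined.\<close>

lemma cap_val_basis:
  assumes q: "q \<in> words N a"
  shows "cap_val N a (basis q \<star> z) = z (Idx (rho q)) / fact a"
    and "z \<in> tens N a \<Longrightarrow> cap_val N a (z \<star> basis q) = z (Idx (rho q)) / fact a"
proof -
  have "(\<Sum>k\<in>words N a. basis q (Idx k) * z (Idx (rho k))) = (\<Sum>k\<in>words N a. if k = q then z (Idx (rho k)) else 0)"
    by (intro sum.cong) (auto simp: basis_apply)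
  then show "cap_val N a (basis q \<star> z) = z (Idx (rho q)) / fact a"
    using q by (simp add: cap_val_star[OF basis_in_tens])
  assume z: "z \<in> tens N a"
  have "(\<Sum>k\<in>words N a. z (Idx k) * basis q (Idx (rho k))) = (\<Sum>k\<in>words N a. if k = rho q then z (Idx k) else 0)"
    by (intro sum.cong) (auto simp: basis_apply)
  then show "cap_val N a (z \<star> basis q) = z (Idx (rho q)) / fact a"
    using q by (simp add: cap_val_star[OF z])
qed

lemma cap_val_sum: "cap_val N a (\<Sum>i\<in>A. t i) = (\<Sum>i\<in>A. cap_val N a (t i))"
  and cap_val_scale: "cap_val N a (vscale c s) = c * cap_val N a s"
proof -
  show "cap_val N a (\<Sum>i\<in>A. t i) = (\<Sum>i\<in>A. cap_val N a (t i))"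
    unfolding cap_val_def sum_pw by (subst sum.swap) (simp add: sum_divide_distrib)
qed (simp add: cap_val_def pw sum_distrib_left)

lemma tens_expand2:
  assumes "t \<in> tens N (m + n)"
  shows "t = (\<Sum>p\<in>words N m. \<Sum>q\<in>words N n. vscale (t (Idx (p @ q))) (basis p \<star> basis q))"
proof -
  have "(\<Sum>l\<in>words N (m + n). vscale (t (Idx l)) (basis l)) =
      (\<Sum>p\<in>words N m. \<Sum>q\<in>words N n. vscale (t (Idx (p @ q))) (basis (p @ q)))"
    by (rule ext) (simp only: sum_pw sum_words_append)
  also have "\<dots> = (\<Sum>p\<in>words N m. \<Sum>q\<in>words N n. vscale (t (Idx (p @ q))) (basis p \<star> basis q))"
    by (intro sum.cong HOL.refl) (simp add: basis_append)
  finally show ?thesis using tens_expand[OF assms] by simp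
qed

text \<open>The binomial coefficient of \<open>alt_adjoint\<close> is (a+b)!/(a! b!), which turns
  the factorial of one thick cap into those of two thinner ones. Reversal by \<open>rho\<close> puts
  the partner of \<open>z\<close> last in \<open>y\<close>.\<close>

lemma shuf_pairing:
  assumes y: "alt_vec y" and z: "z \<in> tens N a"
  shows "(\<Sum>k\<in>words N (a + b). y (Idx (rho k)) * shuf z z' (Idx k)) / fact (a + b) =
    (\<Sum>p\<in>words N b. \<Sum>q\<in>words N a. y (Idx (p @ q)) * (z (Idx (rho q)) / fact a) * (z' (Idx (rho p)) / fact b))"
proof -
  have "shuf z z' (Idx k) = unsh (restr a (\<lambda>p q. z (Idx p) * z' (Idx q))) k" for k
    unfolding shuf_def on_words_simps
    by (rule unsh_cong) (auto simp: restr_def tensD(3)[OF z])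
  then have "(\<Sum>k\<in>words N (a + b). y (Idx (rho k)) * shuf z z' (Idx k)) =
      of_nat ((a + b) choose a) * (\<Sum>p\<in>words N a. \<Sum>q\<in>words N b. y (Idx (rho (p @ q))) * (z (Idx p) * z' (Idx q)))"
    by (simp only: alt_adjoint[OF alt_rho[OF y]])
  also have "(\<Sum>p\<in>words N a. \<Sum>q\<in>words N b. y (Idx (rho (p @ q))) * (z (Idx p) * z' (Idx q))) =
      (\<Sum>q\<in>words N b. \<Sum>p\<in>words N a. y (Idx (rho q @ rho p)) * (z (Idx p) * z' (Idx q)))"
    by (subst sum.swap) simp
  also have "\<dots> = (\<Sum>q\<in>words N b. \<Sum>p\<in>words N a. y (Idx (rho q @ p)) * (z (Idx (rho p)) * z' (Idx q)))"
    by (subst (2) sum_rho[symmetric]) simp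
  also have "\<dots> = (\<Sum>q\<in>words N b. \<Sum>p\<in>words N a. y (Idx (q @ p)) * (z (Idx (rho p)) * z' (Idx (rho q))))"
    by (subst sum_rho[symmetric]) simp
  also have "of_nat ((a + b) choose a) = (fact (a + b) / (fact a * fact b) :: complex)"
    by (simp add: binomial_fact)
  finally show ?thesis
    by (simp add: sum_distrib_left sum_divide_distrib field_simps)
qed

section \<open>Splitting a merge\<close>

lemma tens_0: "t \<in> tens N 0 \<Longrightarrow> t = vscale (t (Idx [])) unit_tensor"
  by (rule vec_eqI) (auto simp: pw unit_tensor_def tens_def words_def)

lemma shuf_unit_left: "t \<in> tens N n \<Longrightarrow> shuf unit_tensor t = t"
  by (rule shuf_unit) (simp add: tensD)

lemma shuf_unit_right: "t \<in> tens N n \<Longrightarrow> shuf t unit_tensor = t"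
proof (rule vec_eqI)
  fix k
  have "unsh (\<lambda>p q. t (Idx p) * unit_tensor (Idx q)) k = t (Idx k) * unit_tensor (Idx [])"
    by (rule unsh_Nil_right) (simp add: unit_tensor_def)
  then show "shuf t unit_tensor (Idx k) = t (Idx k)"
    by (simp add: shuf_def on_words_simps unit_tensor_simps)
qed (simp_all add: tensD)

text \<open>Squares may contain strands of thickness \<open>0\<close>. The web is then an identity,
  and the corresponding tensor is a multiple of the unit for both products.\<close>

lemma ev_merge_web:
  assumes t: "t \<in> tens N a" and u: "u \<in> tens N b"
  shows "ev N (merge_web a b) (t \<star> u) = shuf t u"
proof -
  consider "a = 0" | "a > 0" "b = 0" | "a > 0" "b > 0" by auto
  then show ?thesis
  proof cases
    case 1
    then obtain c where c: "t = vscale c unit_tensor" using tens_0[of t N] t by auto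
    show ?thesis using 1 u by (simp add: c merge_web_def star_scale shuf_scale shuf_unit_left)
  next
    case 2
    then obtain c where c: "u = vscale c unit_tensor" using tens_0[of u N] u by auto
    show ?thesis using 2 t by (simp add: c merge_web_def star_scale shuf_scale shuf_unit_right)
  qed (simp add: merge_web_def merge_map_star[OF t])
qed

lemma ev_split_web: "ev N (split_web a b) t = t"
  by (simp add: split_web_def)

lemma ev_cross_web:
  assumes t: "t \<in> tens N a" and u: "u \<in> tens N b"
  shows "ev N (cross_web a b) (t \<star> u) = vscale ((-1) ^ (a * b)) (u \<star> t)"
proof -
  consider "a = 0" | "a > 0" "b = 0" | "a > 0" "b > 0" by auto
  then show ?thesis
  proof cases
    case 1
    then obtain c where c: "t = vscale c unit_tensor" using tens_0[of t N] t by auto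
    show ?thesis using 1 u by (simp add: c cross_web_def star_scale)
  next
    case 2
    then obtain c where c: "u = vscale c unit_tensor" using tens_0[of u N] u by auto
    show ?thesis using 2 t by (simp add: c cross_web_def star_scale)
  qed (simp add: cross_web_def cross_map_star[OF t u])
qed

lemma web_dom_basic: "sum_list (web_dom (merge_web a b)) = a + b" "sum_list (web_dom (split_web a b)) = a + b"
  "sum_list (web_dom (cross_web a b)) = a + b"
  by (simp_all add: merge_web_def split_web_def cross_web_def)

definition square_term :: "nat \<Rightarrow> nat \<Rightarrow> nat \<Rightarrow> nat \<Rightarrow> web" where
  "square_term a c s t = (merge_web s (c - t) \<otimes>\<otimes> merge_web (a - s) t)
        \<odot>\<odot> (strand s \<otimes>\<otimes> cross_web (a - s) (c - t) \<otimes>\<otimes> strand t)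
        \<odot>\<odot> (split_web s (a - s) \<otimes>\<otimes> split_web (c - t) t)"

lemma ev_square_term:
  assumes s: "s \<le> a" and t: "t \<le> c" and p: "p \<in> tens N s" "p' \<in> tens N (a - s)" "q \<in> tens N (c - t)" "q' \<in> tens N t"
  shows "ev N (square_term a c s t) (p \<star> p' \<star> q \<star> q') =
    vscale ((-1) ^ ((a - s) * (c - t))) (shuf p q \<star> shuf p' q')"
proof -
  have 1: "ev N (split_web s (a - s) \<otimes>\<otimes> split_web (c - t) t) (p \<star> p' \<star> q \<star> q') = (p \<star> (p' \<star> q)) \<star> q'"
    using p s t ev_tens[of "p \<star> p'" N "split_web s (a - s)" "q \<star> q'" "split_web (c - t) t"]
      star_in_tens[OF p(1,2)] star_in_tens[OF p(3,4)]
    by (simp add: web_dom_basic ev_split_web star_assoc)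
  have 2: "ev N (strand s \<otimes>\<otimes> cross_web (a - s) (c - t)) (p \<star> (p' \<star> q)) =
      p \<star> vscale ((-1) ^ ((a - s) * (c - t))) (q \<star> p')"
    using p star_in_tens[OF p(2,3)] by (subst ev_tens) (simp_all add: web_dom_basic ev_cross_web)
  have 3: "ev N (strand s \<otimes>\<otimes> cross_web (a - s) (c - t) \<otimes>\<otimes> strand t) ((p \<star> (p' \<star> q)) \<star> q') =
      (p \<star> vscale ((-1) ^ ((a - s) * (c - t))) (q \<star> p')) \<star> q'"
    using p star_in_tens[OF p(1) star_in_tens[OF p(2,3)]]
    by (subst ev_tens) (simp_all add: web_dom_basic 2)
  have 4: "ev N (merge_web s (c - t) \<otimes>\<otimes> merge_web (a - s) t) ((p \<star> q) \<star> (p' \<star> q')) = shuf p q \<star> shuf p' q'"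
    using p star_in_tens[OF p(1,3)] star_in_tens[OF p(2,4)]
    by (subst ev_tens) (simp_all add: web_dom_basic ev_merge_web)
  show ?thesis
    by (simp add: square_term_def 1[unfolded star_assoc] 3[unfolded star_assoc star_scale]
        4[unfolded star_assoc] star_assoc star_scale ev_scale)
qed

lemma ev_sum_web: "ev N (sum_web x y fs) t = (\<Sum>f\<leftarrow>fs. ev N f t)"
  by (induction fs) (simp_all add: sum_web_def)

lemma sum_square_webs:
  "(\<Sum>f\<leftarrow>square_webs a b c d. G f) = (\<Sum>s\<in>{0..min a b}. \<Sum>t\<in>{0..min c d}.
    if int t - int s = int d - int a then G (square_term a c s t) else (0 :: vec))"
proof -
  have l: "(\<Sum>x\<leftarrow>concat (map h xs). G x) = (\<Sum>s\<leftarrow>xs. \<Sum>x\<leftarrow>h s. G x)" for h :: "nat \<Rightarrow> web list" and xs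
    by (induction xs) simp_all
  have u: "(\<Sum>s\<leftarrow>[0..<Suc n]. H s) = (\<Sum>s\<in>{0..n}. H s)" for H :: "nat \<Rightarrow> vec" and n
    unfolding interv_sum_list_conv_sum_set_nat set_upt atLeastLessThanSuc_atLeastAtMost ..
  show ?thesis
    unfolding square_webs_def square_term_def[symmetric] l u
    by (intro sum.cong HOL.refl) simp
qed

text \<open>Cutting the output word into the legs \<open>k\<close> and \<open>k'\<close> distributes
  the letters over four subwords; the condition says that they reassemble to the two input
  words.\<close>

lemma shuf_basis_append:
  "shuf (basis la) (basis lc) (Idx (k @ k')) = unsh (\<lambda>p q. unsh (\<lambda>p' q'. (-1) ^ (length q * length p') *
     (if p @ p' = la \<and> q @ q' = lc then 1 else 0)) k') k"
  unfolding shuf_def on_words_simps unsh_append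
  by (intro unsh_cong) (simp add: basis_apply)

text \<open>Compare coefficients on both sides. The thicknesses \<open>s\<close> and
  \<open>t\<close> of a square record how many letters of the first input go to the first output,
  and of the second input to the second output.\<close>

lemma split_merge_sound:
  assumes ac: "a + c = b + d" and x: "x \<in> tens N a" and y: "y \<in> tens N c"
  shows "shuf x y = (\<Sum>f\<leftarrow>square_webs a b c d. ev N f (x \<star> y))"
proof -
  \<comment> \<open>Both sides are bilinear, and a basis word can be cut at any length into basis
    tensors.\<close>
  have basis: "shuf (basis la) (basis lc) = (\<Sum>f\<leftarrow>square_webs a b c d. ev N f (basis la \<star> basis lc))"
    if la: "la \<in> words N a" and lc: "lc \<in> words N c" for la lc
  proof -
    let ?ok = "\<lambda>s t. int t - int s = int d - int a"
    let ?E = "\<lambda>s t. vscale ((-1) ^ ((a - s) * (c - t))) (shuf (basis (take s la)) (basis (take (c - t) lc)) \<star>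
       shuf (basis (drop s la)) (basis (drop (c - t) lc)))"
    have ts: "take s la \<in> words N s" "drop s la \<in> words N (a - s)" if "s \<le> a" for s
      using la that by (auto simp: words_def dest: in_set_takeD in_set_dropD)
    have tt: "take (c - t) lc \<in> words N (c - t)" "drop (c - t) lc \<in> words N t" if "t \<le> c" for t
      using lc that by (auto simp: words_def dest: in_set_takeD in_set_dropD)
    have eterm: "ev N (square_term a c s t) (basis la \<star> basis lc) = ?E s t" if "s \<le> a" "t \<le> c" for s t
    proof -
      have "basis la \<star> basis lc = basis (take s la) \<star> basis (drop s la) \<star> basis (take (c - t) lc) \<star> basis (drop (c - t) lc)"
        using basis_append[OF ts(1)[OF that(1)], of "drop s la"] basis_append[OF tt(1)[OF that(2)], of "drop (c - t) lc"]
        by (simp add: star_assoc)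
      then show ?thesis
        using that by (simp add: ev_square_term basis_in_tens ts tt)
    qed
    have "(\<Sum>f\<leftarrow>square_webs a b c d. ev N f (basis la \<star> basis lc)) =
        (\<Sum>s\<in>{0..min a b}. \<Sum>t\<in>{0..min c d}. if ?ok s t then ?E s t else 0)"
      unfolding sum_square_webs by (intro sum.cong if_cong HOL.refl eterm) auto
    moreover have "(\<Sum>s\<in>{0..min a b}. \<Sum>t\<in>{0..min c d}. if ?ok s t then ?E s t else 0) = shuf (basis la) (basis lc)"
    proof (rule tens_eqI)
      show "shuf (basis la) (basis lc) \<in> tens N (b + d)"
        using shuf_in_tens[OF basis_in_tens[OF la] basis_in_tens[OF lc]] ac by simp
      show "(\<Sum>s\<in>{0..min a b}. \<Sum>t\<in>{0..min c d}. if ?ok s t then ?E s t else 0) \<in> tens N (b + d)"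
      proof (intro cfun.subspace_sum[OF subspace_tens])
        fix s t assume st: "s \<in> {0..min a b}" "t \<in> {0..min c d}"
        show "(if ?ok s t then ?E s t else 0) \<in> tens N (b + d)"
        proof (cases "?ok s t")
          case True
          then have bd: "b = s + (c - t)" "d = (a - s) + t" using st ac by auto
          have "?E s t \<in> tens N ((s + (c - t)) + ((a - s) + t))"
            using st by (intro cfun.subspace_scale[OF subspace_tens] star_in_tens shuf_in_tens basis_in_tens ts tt) auto
          then show ?thesis using True bd by metis
        qed (simp add: cfun.subspace_0[OF subspace_tens])
      qed
      fix m assume mw: "m \<in> words N (b + d)"
      obtain k k' where m: "m = k @ k'" "length k = b" "length k' = d"
        by (rule that[of "take b m" "drop b m"]) (use mw in \<open>auto simp: words_def\<close>)
      have E: "?E s t (Idx (k @ k')) = unsh (\<lambda>p q. unsh (\<lambda>p' q'. (-1) ^ ((a - s) * (c - t)) *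
          (if p = take s la \<and> q = take (c - t) lc \<and> p' = drop s la \<and> q' = drop (c - t) lc then 1 else 0)) k') k"
        if st: "s \<in> {0..min a b}" "t \<in> {0..min c d}" and "?ok s t" for s t
      proof -
        have b: "b = s + (c - t)" using st ac \<open>?ok s t\<close> by auto
        have "shuf (basis (take s la)) (basis (take (c - t) lc)) \<in> tens N (length k)"
          unfolding m(2) b using st by (intro shuf_in_tens basis_in_tens ts tt) auto
        then have "?E s t (Idx (k @ k')) = (-1) ^ ((a - s) * (c - t)) *
            (shuf (basis (take s la)) (basis (take (c - t) lc)) (Idx k) *
             shuf (basis (drop s la)) (basis (drop (c - t) lc)) (Idx k'))"
          by (simp add: pw star_append)
        also have "\<dots> = unsh (\<lambda>p q. unsh (\<lambda>p' q'. (-1) ^ ((a - s) * (c - t)) *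
            ((basis (take s la) (Idx p) * basis (take (c - t) lc) (Idx q)) *
             (basis (drop s la) (Idx p') * basis (drop (c - t) lc) (Idx q')))) k') k"
          by (simp only: shuf_def on_words_simps unsh_scale unsh_scale_right)
        also have "\<dots> = unsh (\<lambda>p q. unsh (\<lambda>p' q'. (-1) ^ ((a - s) * (c - t)) *
          (if p = take s la \<and> q = take (c - t) lc \<and> p' = drop s la \<and> q' = drop (c - t) lc then 1 else 0)) k') k"
          by (intro unsh_cong) (simp add: basis_apply)
        finally show ?thesis .
      qed
      have "(\<Sum>s\<in>{0..min a b}. \<Sum>t\<in>{0..min c d}. if ?ok s t then ?E s t else 0) (Idx m) =
        (\<Sum>s\<in>{0..min a b}. \<Sum>t\<in>{0..min c d}. unsh (\<lambda>p q. unsh (\<lambda>p' q'. if ?ok s t then (-1) ^ ((a - s) * (c - t)) *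
          (if p = take s la \<and> q = take (c - t) lc \<and> p' = drop s la \<and> q' = drop (c - t) lc then 1 else 0) else 0) k') k)"
        unfolding sum_pw m(1)
      proof (intro sum.cong HOL.refl)
        fix s t assume st: "s \<in> {0..min a b}" "t \<in> {0..min c d}"
        show "(if ?ok s t then ?E s t else 0) (Idx (k @ k')) = unsh (\<lambda>p q. unsh (\<lambda>p' q'. if ?ok s t then (-1) ^ ((a - s) * (c - t)) *
          (if p = take s la \<and> q = take (c - t) lc \<and> p' = drop s la \<and> q' = drop (c - t) lc then 1 else 0) else 0) k') k"
          using E[OF st] by (cases "?ok s t") (simp_all add: pw)
      qed
      also have "\<dots> = unsh (\<lambda>p q. unsh (\<lambda>p' q'. \<Sum>s\<in>{0..min a b}. \<Sum>t\<in>{0..min c d}. if ?ok s t then (-1) ^ ((a - s) * (c - t)) *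
          (if p = take s la \<and> q = take (c - t) lc \<and> p' = drop s la \<and> q' = drop (c - t) lc then 1 else 0) else 0) k') k"
        by (simp only: unsh_sum)
      also have "\<dots> = unsh (\<lambda>p q. unsh (\<lambda>p' q'. (-1) ^ (length q * length p') *
          (if p @ p' = la \<and> q @ q' = lc then 1 else 0)) k') k"
      proof (rule unsh_length, rule unsh_length)
        fix p q p' q' :: "int list"
        assume l: "length p + length q = length k" "length p' + length q' = length k'"
        let ?f = "\<lambda>s t. if ?ok s t then (-1) ^ ((a - s) * (c - t)) *
          (if p = take s la \<and> q = take (c - t) lc \<and> p' = drop s la \<and> q' = drop (c - t) lc then 1 else 0) else (0 :: complex)"
        show "(\<Sum>s\<in>{0..min a b}. \<Sum>t\<in>{0..min c d}. ?f s t) = (-1) ^ (length q * length p') *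
          (if p @ p' = la \<and> q @ q' = lc then 1 else 0)"
        proof (cases "p @ p' = la \<and> q @ q' = lc")
          case False
          then have "?f s t = 0" for s t by auto
          then show ?thesis using False by simp
        next
          case True
          have len: "length p + length p' = a" "length q + length q' = c"
            using True la lc by (auto simp: words_def)
          \<comment> \<open>The four subwords determine the square: \<open>s\<close> and
            \<open>t\<close> must be the lengths of \<open>p\<close> and \<open>q'\<close>. Counting
            letters shows that this pair is admissible, and its crossing exchanges \<open>p'\<close>
            with \<open>q\<close>, which gives the sign of \<open>unsh_append\<close>.\<close>
          have z: "?f s t = (if s = length p then if t = length q' then (-1) ^ (length q * length p') else 0 else 0)"
            if "s \<in> {0..min a b}" "t \<in> {0..min c d}" for s t
          proof (cases "s = length p \<and> t = length q'")
            case True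
            have "?ok s t" using True len l m ac by auto
            moreover have "a - s = length p'" "c - t = length q" using True len by auto
            ultimately show ?thesis
              using True \<open>p @ p' = la \<and> q @ q' = lc\<close> by (auto simp: mult.commute)
          next
            case False
            then have "\<not> (p = take s la \<and> q' = drop (c - t) lc)"
              using that la lc by (auto simp: words_def)
            then show ?thesis using False by auto
          qed
          \<comment> \<open>\<open>p\<close> is part of the first input and of the first output, and
            \<open>q'\<close> of the second input and the second output; these are the two
            minima.\<close>
          have mem: "length p \<in> {0..min a b}" "length q' \<in> {0..min c d}"
            using l len m by auto
          have "(\<Sum>s\<in>{0..min a b}. \<Sum>t\<in>{0..min c d}. ?f s t) =
            (\<Sum>s\<in>{0..min a b}. \<Sum>t\<in>{0..min c d}. if s = length p then if t = length q' then (-1) ^ (length q * length p') else 0 else 0)"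
            by (intro sum.cong HOL.refl z)
          also have "\<dots> = (\<Sum>s\<in>{0..min a b}. if s = length p then (-1) ^ (length q * length p') else 0)"
            using mem by (intro sum.cong HOL.refl) auto
          also have "\<dots> = (-1) ^ (length q * length p')" using mem by simp
          finally show ?thesis using True by simp
        qed
      qed
      also have "\<dots> = shuf (basis la) (basis lc) (Idx m)"
        unfolding m(1) by (rule shuf_basis_append[symmetric])
      finally show "(\<Sum>s\<in>{0..min a b}. \<Sum>t\<in>{0..min c d}. if ?ok s t then ?E s t else 0) (Idx m) =
        shuf (basis la) (basis lc) (Idx m)" .
    qed
    ultimately show ?thesis by simp
  qed
  let ?G = "\<lambda>t. \<Sum>f\<leftarrow>square_webs a b c d. ev N f t"
  have G: "lin UNIV UNIV ?G"
  proof -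
    have "?G = ev N (sum_web [] [] (square_webs a b c d))"
      by (rule ext) (rule ev_sum_web[symmetric])
    then show ?thesis by (simp only: lin_ev)
  qed
  have 1: "shuf x (basis lc) = ?G (x \<star> basis lc)" if lc: "lc \<in> words N c" for lc
  proof -
    have "shuf (\<Sum>l\<in>words N a. vscale (x (Idx l)) (basis l)) (basis lc) =
      ?G ((\<Sum>l\<in>words N a. vscale (x (Idx l)) (basis l)) \<star> basis lc)"
      unfolding lin_UNIV_sum[OF lin_shuf(1)] lin_UNIV_sum[OF lin_comp[OF lin_star(1) G]]
      using lin_scale[OF lin_comp[OF lin_star(1) G]] basis lc by (simp add: shuf_scale)
    then show ?thesis using tens_expand[OF x] by simp
  qed
  have "shuf x (\<Sum>l\<in>words N c. vscale (y (Idx l)) (basis l)) =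
      ?G (x \<star> (\<Sum>l\<in>words N c. vscale (y (Idx l)) (basis l)))"
    unfolding lin_UNIV_sum[OF lin_shuf(2)] lin_UNIV_sum[OF lin_comp[OF lin_star(2) G]]
    using lin_scale[OF lin_comp[OF lin_star(2) G]] 1 by (simp add: shuf_scale)
  then show ?thesis using tens_expand[OF y] by simp
qed


section \<open>Caps and cups\<close>

lemma card_incs: "card (incs N a) = N choose a"
proof -
  have "bij_betw set (incs N a) {S. S \<subseteq> idx N \<and> card S = a}"
  proof (rule bij_betw_byWitness[of _ sorted_list_of_set])
    show "\<forall>k\<in>incs N a. sorted_list_of_set (set k) = k"
      by (auto simp: incs_def strict_sorted_iff sorted_list_of_set.idem_if_sorted_distinct)
    show "\<forall>S\<in>{S. S \<subseteq> idx N \<and> card S = a}. set (sorted_list_of_set S) = S"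
      using finite_subset[OF _ finite_idx] by auto
    show "set ` incs N a \<subseteq> {S. S \<subseteq> idx N \<and> card S = a}"
      by (auto simp: incs_def strict_sorted_iff distinct_card)
    show "sorted_list_of_set ` {S. S \<subseteq> idx N \<and> card S = a} \<subseteq> incs N a"
      using finite_subset[OF _ finite_idx] by (auto simp: incs_def)
  qed
  then show ?thesis
    using n_subsets[OF finite_idx, of N a] by (simp add: bij_betw_same_card card_idx)
qed

lemma cap_val_cup: "cap_val N a (cup N a) = of_nat N gchoose a"
proof -
  have "cap_val N a (cup N a) = (\<Sum>i\<in>incs N a. 1)"
    unfolding cup_def cap_val_sum
    by (intro sum.cong HOL.refl) (simp add: cap_val_wedge_left wedge_vb_ext wedge_vb_incs incsD(1)[of "rho _" N a])
  then show ?thesis by (simp add: card_incs binomial_gbinomial)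
qed

text \<open>The innermost contracted letters \<open>x\<close> and \<open>- x\<close> are adjacent.
  Replacing \<open>x\<close> by \<open>- x\<close> preserves the sum, while exchanging the two
  letters negates it.\<close>

lemma cap_val_alt:
  assumes t: "alt_vec t"
  shows "cap_val N (Suc n) t = 0"
proof -
  have "(\<Sum>k\<in>words N (n + 1). t (Idx (k @ rho k))) =
      (\<Sum>p\<in>words N n. \<Sum>x\<in>idx N. t (Idx (p @ x # - x # rho p)))"
    unfolding sum_words_append by (simp add: sum_words_Suc sum_words_0)
  also have "\<dots> = 0"
  proof (rule sum.neutral, rule ballI)
    fix p
    have "(\<Sum>x\<in>idx N. t (Idx (p @ x # - x # rho p))) = (\<Sum>x\<in>idx N. t (Idx (p @ - x # x # rho p)))"
      by (rule sum.reindex_bij_witness[of _ uminus uminus]) (auto simp: idx_uminus)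
    also have "\<dots> = - (\<Sum>x\<in>idx N. t (Idx (p @ x # - x # rho p)))"
      unfolding sum_negf[symmetric] by (intro sum.cong HOL.refl altD[OF t])
    finally show "(\<Sum>x\<in>idx N. t (Idx (p @ x # - x # rho p))) = 0" by simp
  qed
  finally show ?thesis by (simp add: cap_val_def)
qed

text \<open>The cup is a sum over a basis and its dual basis, so the cap turns each summand into one
  term of the basis expansion of \<open>t\<close>.\<close>

lemma zigzag_sound:
  assumes t: "t \<in> ext_space N a"
  shows "ev N (Cap a \<otimes>\<otimes> strand a) (t \<star> cup N a) = t"
    and "ev N (strand a \<otimes>\<otimes> Cap a) (cup N a \<star> t) = t"
proof -
  note tt = ext_tens[OF t]
  have "ev N (Cap a \<otimes>\<otimes> strand a) (t \<star> cup N a) =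
      (\<Sum>i\<in>incs N a. vscale (t (Idx (rho i))) (wedge_vb (rho i)))"
    unfolding cup_def star_sum(2) ev_sum star_assoc[symmetric]
  proof (intro sum.cong HOL.refl)
    fix i assume i: "i \<in> incs N a"
    then have w: "wedge_vb i \<in> tens N a" "wedge_vb (rho i) \<in> tens N a" by (simp_all add: wedge_vb_tens)
    show "ev N (Cap a \<otimes>\<otimes> strand a) ((t \<star> wedge_vb i) \<star> wedge_vb (rho i)) =
        vscale (t (Idx (rho i))) (wedge_vb (rho i))"
      using star_in_tens[OF tt w(1)] w i
      by (subst ev_tens) (simp_all add: cap_val_wedge_right[OF i t] star_scale)
  qed
  then show "ev N (Cap a \<otimes>\<otimes> strand a) (t \<star> cup N a) = t"
    using ext_expand_rho[OF t] by simp
  have "ev N (strand a \<otimes>\<otimes> Cap a) (cup N a \<star> t) = (\<Sum>i\<in>incs N a. vscale (t (Idx i)) (wedge_vb i))"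
    unfolding cup_def star_sum(1) ev_sum star_assoc
  proof (intro sum.cong HOL.refl)
    fix i assume i: "i \<in> incs N a"
    then have w: "wedge_vb i \<in> tens N a" "wedge_vb (rho i) \<in> tens N a" by (simp_all add: wedge_vb_tens)
    show "ev N (strand a \<otimes>\<otimes> Cap a) (wedge_vb i \<star> (wedge_vb (rho i) \<star> t)) = vscale (t (Idx i)) (wedge_vb i)"
      using star_in_tens[OF w(2) tt] w i
      by (subst ev_tens) (simp_all add: cap_val_wedge_left[OF _ t] star_scale)
  qed
  then show "ev N (strand a \<otimes>\<otimes> Cap a) (cup N a \<star> t) = t"
    using ext_expand[OF t] by simp
qed

text \<open>Expand \<open>y\<close> in products of basis tensors. The inner cap then contracts one
  piece and the outer cap the other; for both orientations the result is the right-hand side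
  \<open>?R\<close> of \<open>shuf_pairing\<close>.\<close>

lemma cap_split_sound:
  assumes y: "y \<in> ext_space N (b + a)" and z: "z \<in> ext_space N a" and z': "z' \<in> ext_space N b"
  shows "cap_val N b (ev N (strand b \<otimes>\<otimes> Cap a \<otimes>\<otimes> strand b) ((y \<star> z) \<star> z')) =
      cap_val N (a + b) (y \<star> shuf z z')"
    and "cap_val N a (ev N (strand a \<otimes>\<otimes> Cap b \<otimes>\<otimes> strand a) ((z \<star> z') \<star> y)) =
      cap_val N (a + b) (shuf z z' \<star> y)"
proof -
  note t = ext_tens[OF y] ext_tens[OF z] ext_tens[OF z']
  let ?R = "\<Sum>p\<in>words N b. \<Sum>q\<in>words N a. y (Idx (p @ q)) * (z (Idx (rho q)) / fact a) * (z' (Idx (rho p)) / fact b)"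
  have R: "(\<Sum>k\<in>words N (a + b). y (Idx (rho k)) * shuf z z' (Idx k)) / fact (a + b) = ?R"
    by (rule shuf_pairing[OF ext_alt[OF y] t(2)])
  have sz: "shuf z z' \<in> tens N (a + b)" by (rule shuf_in_tens[OF t(2,3)])
  have "cap_val N b (ev N (strand b \<otimes>\<otimes> Cap a \<otimes>\<otimes> strand b) (((\<Sum>p\<in>words N b. \<Sum>q\<in>words N a.
      vscale (y (Idx (p @ q))) (basis p \<star> basis q)) \<star> z) \<star> z')) = ?R"
    unfolding star_sum(1) ev_sum cap_val_sum star_scale ev_scale cap_val_scale
  proof (intro sum.cong HOL.refl)
    fix p q assume p: "p \<in> words N b" and q: "q \<in> words N a"
    note b = basis_in_tens[OF p] basis_in_tens[OF q]
    have "ev N (strand b \<otimes>\<otimes> Cap a \<otimes>\<otimes> strand b) (((basis p \<star> basis q) \<star> z) \<star> z') =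
        vscale (z (Idx (rho q)) / fact a) (basis p \<star> z')"
    proof -
      have "ev N (strand b \<otimes>\<otimes> Cap a) (basis p \<star> (basis q \<star> z)) = vscale (z (Idx (rho q)) / fact a) (basis p)"
        using b t star_in_tens[OF b(2) t(2)]
        by (subst ev_tens) (simp_all add: cap_val_basis[OF q] star_scale)
      then show ?thesis
        unfolding star_assoc[of "basis p" "basis q" z]
        using b t star_in_tens[OF b(1) star_in_tens[OF b(2) t(2)]]
        by (subst ev_tens) (simp_all add: star_scale)
    qed
    then show "y (Idx (p @ q)) * cap_val N b (ev N (strand b \<otimes>\<otimes> Cap a \<otimes>\<otimes> strand b) (((basis p \<star> basis q) \<star> z) \<star> z')) =
        y (Idx (p @ q)) * (z (Idx (rho q)) / fact a) * (z' (Idx (rho p)) / fact b)"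
      by (simp add: cap_val_scale cap_val_basis[OF p])
  qed
  then have "cap_val N b (ev N (strand b \<otimes>\<otimes> Cap a \<otimes>\<otimes> strand b) ((y \<star> z) \<star> z')) = ?R"
    unfolding tens_expand2[OF t(1), symmetric] .
  moreover have "cap_val N (a + b) (y \<star> shuf z z') = ?R"
  proof -
    have "y \<in> tens N (a + b)" using t(1) by (simp add: add.commute)
    then have "cap_val N (a + b) (y \<star> shuf z z') =
        (\<Sum>k\<in>words N (a + b). y (Idx (rho (rho k))) * shuf z z' (Idx (rho k))) / fact (a + b)"
      by (simp add: cap_val_star)
    also have "\<dots> = ?R"
      using R sum_rho[of "\<lambda>k. y (Idx (rho k)) * shuf z z' (Idx k)"] by simp
    finally show ?thesis .
  qed
  ultimately show "cap_val N b (ev N (strand b \<otimes>\<otimes> Cap a \<otimes>\<otimes> strand b) ((y \<star> z) \<star> z')) =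
      cap_val N (a + b) (y \<star> shuf z z')" by simp
  have "cap_val N a (ev N (strand a \<otimes>\<otimes> Cap b \<otimes>\<otimes> strand a) ((z \<star> z') \<star> (\<Sum>p\<in>words N b. \<Sum>q\<in>words N a.
      vscale (y (Idx (p @ q))) (basis p \<star> basis q)))) = ?R"
    unfolding star_sum(2) ev_sum cap_val_sum star_scale ev_scale cap_val_scale
  proof (intro sum.cong HOL.refl)
    fix p q assume p: "p \<in> words N b" and q: "q \<in> words N a"
    note b = basis_in_tens[OF p] basis_in_tens[OF q]
    have "ev N (strand a \<otimes>\<otimes> Cap b \<otimes>\<otimes> strand a) ((z \<star> (z' \<star> basis p)) \<star> basis q) =
        vscale (z' (Idx (rho p)) / fact b) (z \<star> basis q)"
    proof -
      have "ev N (strand a \<otimes>\<otimes> Cap b) (z \<star> (z' \<star> basis p)) = vscale (z' (Idx (rho p)) / fact b) z"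
        using b t star_in_tens[OF t(3) b(1)]
        by (subst ev_tens) (simp_all add: cap_val_basis[OF p] star_scale)
      then show ?thesis
        using b t star_in_tens[OF t(2) star_in_tens[OF t(3) b(1)]]
        by (subst ev_tens) (simp_all add: star_scale)
    qed
    then show "y (Idx (p @ q)) * cap_val N a (ev N (strand a \<otimes>\<otimes> Cap b \<otimes>\<otimes> strand a) ((z \<star> z') \<star> basis p \<star> basis q)) =
        y (Idx (p @ q)) * (z (Idx (rho q)) / fact a) * (z' (Idx (rho p)) / fact b)"
      using t by (simp add: star_assoc cap_val_scale cap_val_basis[OF q] mult_ac)
  qed
  then have "cap_val N a (ev N (strand a \<otimes>\<otimes> Cap b \<otimes>\<otimes> strand a) ((z \<star> z') \<star> y)) = ?R"
    unfolding tens_expand2[OF t(1), symmetric] .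
  moreover have "cap_val N (a + b) (shuf z z' \<star> y) = ?R"
    using R by (simp add: cap_val_star[OF sz] mult.commute)
  ultimately show "cap_val N a (ev N (strand a \<otimes>\<otimes> Cap b \<otimes>\<otimes> strand a) ((z \<star> z') \<star> y)) =
      cap_val N (a + b) (shuf z z' \<star> y)" by simp
qed

text \<open>Where a web has several inputs, the two sides are compared on products of alternating
  tensors, which span the domain.\<close>

lemma web_rel_sound:
  assumes "web_rel N f g" and s: "s \<in> wspace N (web_dom f)"
  shows "ev N f s = ev N g s"
  using assms(1)
proof cases
  case (merge_assoc a b c)
  have s': "s \<in> wspace N [a, b, c]" using s merge_assoc by (simp add: thick_def)
  show ?thesis
  proof (rule eq_on_wspace3[OF lin_ev lin_ev _ s'])
    fix t u v assume "t \<in> ext_space N a" "u \<in> ext_space N b" "v \<in> ext_space N c"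
    then have m: "t \<in> tens N a" "u \<in> tens N b" "v \<in> tens N c" by (simp_all add: ext_tens)
    have 1: "ev N (Merge a b \<otimes>\<otimes> strand c) (t \<star> u \<star> v) = shuf t u \<star> v"
      unfolding star_assoc[symmetric] using m star_in_tens[OF m(1,2)]
      by (subst ev_tens) (simp_all add: merge_map_star)
    have 2: "ev N (strand a \<otimes>\<otimes> Merge b c) (t \<star> u \<star> v) = t \<star> shuf u v"
      using m star_in_tens[OF m(2,3)] by (subst ev_tens) (simp_all add: merge_map_star)
    show "ev N f (t \<star> u \<star> v) = ev N g (t \<star> u \<star> v)"
      using shuf_in_tens[OF m(1,2)] m by (simp add: merge_assoc 1 2 merge_map_star shuf_assoc)
  qed
next
  case (split_assoc a b c)
  have s': "s \<in> tens N (a + b + c)" using wspace_tens[OF s] split_assoc by simp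
  \<comment> \<open>Splits are inclusions, so both sides are the identity; they need not be tested
    on products.\<close>
  show ?thesis
    using s' by (simp add: split_assoc ev_tens_id add.assoc)
next
  case (merge_split a b)
  have s': "s \<in> ext_space N (a + b)" using s merge_split by (simp add: wspace_single)
  show ?thesis using merge_map_ext[OF s'] by (simp add: merge_split)
next
  case (split_merge a b c d)
  have s': "s \<in> wspace N [a, c]" using s split_merge by simp
  show ?thesis
  proof (rule eq_on_wspace2[OF lin_ev lin_ev _ s'])
    fix t u assume "t \<in> ext_space N a" "u \<in> ext_space N c"
    then have m: "t \<in> tens N a" "u \<in> tens N c" by (simp_all add: ext_tens)
    show "ev N f (t \<star> u) = ev N g (t \<star> u)"
      using split_merge_sound[OF \<open>a + c = b + d\<close> m] m by (simp add: split_merge ev_sum_web merge_map_star)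
  qed
next
  case (zigzag_left a)
  have s': "s \<in> ext_space N a" using s zigzag_left by (simp add: thick_def wspace_single)
  have "ev N (strand a \<otimes>\<otimes> Cup a) (s \<star> unit_tensor) = s \<star> cup N a"
    using ext_tens[OF s'] by (subst ev_tens) (simp_all add: unit_in_tens unit_tensor_simps)
  then show ?thesis
    using ext_tens[OF s'] by (simp add: zigzag_left zigzag_sound[OF s'])
next
  case (zigzag_right a)
  have s': "s \<in> ext_space N a" using s zigzag_right by (simp add: thick_def wspace_single)
  have "ev N (Cup a \<otimes>\<otimes> strand a) (unit_tensor \<star> s) = cup N a \<star> s"
    using ext_tens[OF s'] by (subst ev_tens) (simp_all add: unit_in_tens unit_tensor_simps)
  then show ?thesis
    using ext_tens[OF s'] by (simp add: zigzag_right zigzag_sound[OF s'])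
next
  case (cap_cross a b)
  have s': "s \<in> wspace N [a, b, a]" using s cap_cross by (simp add: thick_def)
  show ?thesis
  proof (rule eq_on_wspace3[OF lin_ev lin_ev _ s'])
    fix t u v assume "t \<in> ext_space N a" "u \<in> ext_space N b" "v \<in> ext_space N a"
    then have m: "t \<in> tens N a" "u \<in> tens N b" "v \<in> tens N a" by (simp_all add: ext_tens)
    have 1: "ev N (strand a \<otimes>\<otimes> Cross b a) (t \<star> u \<star> v) = vscale ((-1) ^ (b * a)) ((t \<star> v) \<star> u)"
      using m star_in_tens[OF m(2,3)] by (subst ev_tens) (simp_all add: cross_map_star star_scale star_assoc)
    have 2: "ev N (Cap a \<otimes>\<otimes> strand b) ((t \<star> v) \<star> u) = vscale (cap_val N a (t \<star> v)) u"
      using m star_in_tens[OF m(1,3)] by (subst ev_tens) (simp_all add: star_scale)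
    have 3: "ev N (Cross a b \<otimes>\<otimes> strand a) (t \<star> u \<star> v) = vscale ((-1) ^ (a * b)) (u \<star> (t \<star> v))"
      unfolding star_assoc[symmetric] using m star_in_tens[OF m(1,2)]
      by (subst ev_tens) (simp_all add: cross_map_star star_scale)
    have 4: "ev N (strand b \<otimes>\<otimes> Cap a) (u \<star> (t \<star> v)) = vscale (cap_val N a (t \<star> v)) u"
      using m star_in_tens[OF m(1,3)] by (subst ev_tens) (simp_all add: star_scale)
    show "ev N f (t \<star> u \<star> v) = ev N g (t \<star> u \<star> v)"
      by (simp add: cap_cross 1 2 3 4 ev_scale mult.commute)
  qed
next
  case (cup_cross a b)
  have s': "s \<in> ext_space N b" using s cup_cross by (simp add: thick_def wspace_single)
  note m = ext_tens[OF s']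
  have 1: "ev N (strand b \<otimes>\<otimes> Cup a) (s \<star> unit_tensor) = s \<star> cup N a"
    using m by (subst ev_tens) (simp_all add: unit_in_tens unit_tensor_simps)
  have 2: "ev N (Cup a \<otimes>\<otimes> strand b) (unit_tensor \<star> s) = cup N a \<star> s"
    using m by (subst ev_tens) (simp_all add: unit_in_tens unit_tensor_simps)
  have "ev N (Cross b a \<otimes>\<otimes> strand a) (s \<star> cup N a) = ev N (strand a \<otimes>\<otimes> Cross a b) (cup N a \<star> s)"
    unfolding cup_def star_sum ev_sum
  proof (intro sum.cong HOL.refl)
    fix i assume i: "i \<in> incs N a"
    then have w: "wedge_vb i \<in> tens N a" "wedge_vb (rho i) \<in> tens N a" by (simp_all add: wedge_vb_tens)
    have "ev N (Cross b a \<otimes>\<otimes> strand a) ((s \<star> wedge_vb i) \<star> wedge_vb (rho i)) =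
        vscale ((-1) ^ (b * a)) (wedge_vb i \<star> s \<star> wedge_vb (rho i))"
      using w m star_in_tens[OF m w(1)]
      by (subst ev_tens) (simp_all add: cross_map_star star_scale star_assoc)
    moreover have "ev N (strand a \<otimes>\<otimes> Cross a b) (wedge_vb i \<star> (wedge_vb (rho i) \<star> s)) =
        vscale ((-1) ^ (a * b)) (wedge_vb i \<star> s \<star> wedge_vb (rho i))"
      using w m star_in_tens[OF w(2) m]
      by (subst ev_tens) (simp_all add: cross_map_star star_scale)
    ultimately show "ev N (Cross b a \<otimes>\<otimes> strand a) (s \<star> wedge_vb i \<star> wedge_vb (rho i)) =
        ev N (strand a \<otimes>\<otimes> Cross a b) ((wedge_vb i \<star> wedge_vb (rho i)) \<star> s)"
      by (simp add: star_assoc mult.commute)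
  qed
  then show ?thesis
    using 1 2 m by (simp add: cup_cross)
next
  case (cap_split a b)
  have s': "s \<in> wspace N [b + a, a, b]" using s cap_split by (simp add: thick_def)
  show ?thesis
  proof (rule eq_on_wspace3[OF lin_ev lin_ev _ s'])
    fix t u v assume e: "t \<in> ext_space N (b + a)" "u \<in> ext_space N a" "v \<in> ext_space N b"
    then have m: "t \<in> tens N (b + a)" "u \<in> tens N a" "v \<in> tens N b" by (simp_all add: ext_tens)
    have 1: "ev N (Split b a \<otimes>\<otimes> strand a \<otimes>\<otimes> strand b) ((t \<star> u) \<star> v) = (t \<star> u) \<star> v"
      by (subst ev_tens) (use m star_in_tens[OF m(1,2)] in \<open>simp_all add: ev_tens_id\<close>)
    have 2: "ev N (strand (a + b) \<otimes>\<otimes> Merge a b) (t \<star> (u \<star> v)) = t \<star> shuf u v"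
      using m star_in_tens[OF m(2,3)] by (subst ev_tens) (simp_all add: merge_map_star add.commute)
    show "ev N f (t \<star> u \<star> v) = ev N g (t \<star> u \<star> v)"
      using cap_split_sound(1)[OF e] 1 2 by (simp add: cap_split star_assoc)
  qed
next
  case (split_cap a b)
  have s': "s \<in> wspace N [a, b, b + a]" using s split_cap by (simp add: thick_def)
  show ?thesis
  proof (rule eq_on_wspace3[OF lin_ev lin_ev _ s'])
    fix t u v assume e: "t \<in> ext_space N a" "u \<in> ext_space N b" "v \<in> ext_space N (b + a)"
    then have m: "t \<in> tens N a" "u \<in> tens N b" "v \<in> tens N (b + a)" by (simp_all add: ext_tens)
    have 1: "ev N (strand a \<otimes>\<otimes> strand b \<otimes>\<otimes> Split b a) ((t \<star> u) \<star> v) = (t \<star> u) \<star> v"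
      by (subst ev_tens) (use m star_in_tens[OF m(1,2)] in \<open>simp_all add: ev_tens_id\<close>)
    have 2: "ev N (Merge a b \<otimes>\<otimes> strand (a + b)) ((t \<star> u) \<star> v) = shuf t u \<star> v"
      using m star_in_tens[OF m(1,2)] by (subst ev_tens) (simp_all add: merge_map_star add.commute)
    show "ev N f (t \<star> u \<star> v) = ev N g (t \<star> u \<star> v)"
      using cap_split_sound(2)[OF e(3,1,2)] 1 2 by (simp add: split_cap star_assoc)
  qed
next
  case (circle a)
  obtain c where "s = vscale c unit_tensor"
    using s circle by (auto simp: wspace_Nil span_unit)
  then show ?thesis by (simp add: circle cap_val_scale cap_val_cup pw unit_tensor_simps)
next
  case (lollipop a)
  have "alt_vec s" using s lollipop by (intro ext_alt) (simp add: wspace_single)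
  \<comment> \<open>Positivity of \<open>a\<close> makes it the successor of \<open>a - 1\<close>,
    which provides an innermost pair to contract.\<close>
  then show ?thesis using lollipop cap_val_alt[of s N "a - 1"] by simp
next
  case (cap_twist a)
  have s': "s \<in> wspace N [a, a]" using s cap_twist by simp
  show ?thesis
  proof (rule eq_on_wspace2[OF lin_ev lin_ev _ s'])
    fix t u assume "t \<in> ext_space N a" "u \<in> ext_space N a"
    then have m: "t \<in> tens N a" "u \<in> tens N a" by (simp_all add: ext_tens)
    \<comment> \<open>Reindexing by \<open>rho\<close> shows that the cap is symmetric, so the only
      sign is (-1)^(a^2) from the crossing.\<close>
    have "cap_val N a (u \<star> t) = cap_val N a (t \<star> u)"
      using sum_rho[of "\<lambda>k. u (Idx k) * t (Idx (rho k))" N a] m by (simp add: cap_val_star mult.commute)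
    moreover have "(-1) ^ (a * a) = ((-1) ^ a :: complex)"
      by (cases "even a") simp_all
    ultimately show "ev N f (t \<star> u) = ev N g (t \<star> u)"
      using m by (simp add: cap_twist cross_map_star cap_val_scale)
  qed
qed

text \<open>The restriction to \<open>wspace\<close> is essential because several relations hold
  only on alternating tensors; \<open>ev_wspace\<close> carries it through composites, and products
  of tensors through the monoidal clauses.\<close>

theorem web_eq_sound:
  "web_eq N f g \<Longrightarrow> s \<in> wspace N (web_dom f) \<Longrightarrow> ev N f s = ev N g s"
proof (induction arbitrary: s rule: web_eq.induct)
  case (rel f g)
  then show ?case by (rule web_rel_sound)
next
  case (sym f g)
  then show ?case using web_eq_wt[OF sym.hyps] by simp
next
  case (trans f g h)
  then show ?case using web_eq_wt[OF trans.hyps(1)] by simp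
next
  case (comp_cong f f' g g')
  have "ev N g s \<in> wspace N (web_dom f)"
    using comp_cong web_eq_wt[OF comp_cong.hyps(2)] ev_wspace[of g s N] by simp
  then show ?case using comp_cong by simp
next
  case (tens_cong f f' g g')
  note w = web_eq_wt[OF tens_cong.hyps(1)] web_eq_wt[OF tens_cong.hyps(2)]
  show ?case
  proof (rule wspace_append_eqI[OF lin_ev lin_ev, of N "web_dom f" "web_dom g"])
    fix t u assume "t \<in> wspace N (web_dom f)" "u \<in> wspace N (web_dom g)"
    then show "ev N (f \<otimes>\<otimes> g) (t \<star> u) = ev N (f' \<otimes>\<otimes> g') (t \<star> u)"
      using w tens_cong.IH wspace_tens by (simp add: ev_tens)
  qed (use tens_cong.prems in simp)
next
  case (tens_assoc f g h)
  show ?case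
  proof (rule wspace_append_eqI[OF lin_ev lin_ev, of N "web_dom f @ web_dom g" "web_dom h"])
    fix s v assume s: "s \<in> wspace N (web_dom f @ web_dom g)" and v: "v \<in> wspace N (web_dom h)"
    show "ev N (f \<otimes>\<otimes> g \<otimes>\<otimes> h) (s \<star> v) = ev N (f \<otimes>\<otimes> (g \<otimes>\<otimes> h)) (s \<star> v)"
    proof (rule wspace_append_eqI[OF lin_comp[OF lin_star(1) lin_ev] lin_comp[OF lin_star(1) lin_ev] _ s])
      fix t u assume t: "t \<in> wspace N (web_dom f)" and u: "u \<in> wspace N (web_dom g)"
      note m = wspace_tens[OF t] wspace_tens[OF u] wspace_tens[OF v]
      have "ev N (f \<otimes>\<otimes> g \<otimes>\<otimes> h) ((t \<star> u) \<star> v) = (ev N f t \<star> ev N g u) \<star> ev N h v"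
        using m star_in_tens[OF m(1,2)] by (simp add: ev_tens)
      moreover have "ev N (f \<otimes>\<otimes> (g \<otimes>\<otimes> h)) (t \<star> (u \<star> v)) = ev N f t \<star> (ev N g u \<star> ev N h v)"
        using m star_in_tens[OF m(2,3)] by (simp add: ev_tens)
      ultimately show "ev N (f \<otimes>\<otimes> g \<otimes>\<otimes> h) ((t \<star> u) \<star> v) = ev N (f \<otimes>\<otimes> (g \<otimes>\<otimes> h)) ((t \<star> u) \<star> v)"
        by (simp add: star_assoc)
    qed
  qed (use tens_assoc.prems in simp)
next
  case (tens_unit_left f)
  then have s: "s \<in> wspace N (web_dom f)" by simp
  have "ev N (Ident [] \<otimes>\<otimes> f) (unit_tensor \<star> s) = unit_tensor \<star> ev N f s"
    using wspace_tens[OF s] by (simp add: ev_tens unit_in_tens del: unit_star)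
  then show ?case
    using unit_star(1)[OF wspace_tens[OF s]] unit_star(1)[OF wspace_tens[OF ev_wspace[OF tens_unit_left.hyps s]]] by simp
next
  case (tens_unit_right f)
  then have s: "s \<in> wspace N (web_dom f)" by simp
  have "ev N (f \<otimes>\<otimes> Ident []) (s \<star> unit_tensor) = ev N f s \<star> unit_tensor"
    using wspace_tens[OF s] by (simp add: ev_tens unit_in_tens del: unit_star)
  then show ?case
    using unit_star(2)[OF wspace_tens[OF s]] unit_star(2)[OF wspace_tens[OF ev_wspace[OF tens_unit_right.hyps s]]] by simp
next
  case (tens_id x y)
  then show ?case using wspace_tens[of s N "x @ y"] by (simp add: ev_tens_id)
next
  case (interchange f h g k)
  show ?case
  proof (rule wspace_append_eqI[OF lin_ev lin_ev, of N "web_dom h" "web_dom k"])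
    fix t u assume t: "t \<in> wspace N (web_dom h)" and u: "u \<in> wspace N (web_dom k)"
    note m = wspace_tens[OF t] wspace_tens[OF u]
    have "ev N h t \<in> tens N (sum_list (web_dom f))" "ev N k u \<in> tens N (sum_list (web_dom g))"
      using interchange.hyps wspace_tens[OF ev_wspace[OF _ t]] wspace_tens[OF ev_wspace[OF _ u]] by simp_all
    then show "ev N ((f \<otimes>\<otimes> g) \<odot>\<odot> (h \<otimes>\<otimes> k)) (t \<star> u) = ev N ((f \<odot>\<odot> h) \<otimes>\<otimes> (g \<odot>\<odot> k)) (t \<star> u)"
      using m by (simp add: ev_tens)
  qed (use interchange.prems in simp)
next
  case (tens_add_left f g h)
  show ?case
  proof (rule wspace_append_eqI[OF lin_ev lin_ev, of N "web_dom f" "web_dom h"])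
    fix t u assume t: "t \<in> wspace N (web_dom f)" and u: "u \<in> wspace N (web_dom h)"
    then show "ev N ((f \<oplus>\<oplus> g) \<otimes>\<otimes> h) (t \<star> u) = ev N ((f \<otimes>\<otimes> h) \<oplus>\<oplus> (g \<otimes>\<otimes> h)) (t \<star> u)"
      using tens_add_left.hyps wspace_tens[OF t] wspace_tens[OF u] by (simp add: ev_tens star_add)
  qed (use tens_add_left.prems in simp)
next
  case (tens_add_right f g h)
  show ?case
  proof (rule wspace_append_eqI[OF lin_ev lin_ev, of N "web_dom f" "web_dom g"])
    fix t u assume t: "t \<in> wspace N (web_dom f)" and u: "u \<in> wspace N (web_dom g)"
    then show "ev N (f \<otimes>\<otimes> (g \<oplus>\<oplus> h)) (t \<star> u) = ev N ((f \<otimes>\<otimes> g) \<oplus>\<oplus> (f \<otimes>\<otimes> h)) (t \<star> u)"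
      using tens_add_right.hyps wspace_tens[OF t] wspace_tens[OF u] by (simp add: ev_tens star_add)
  qed (use tens_add_right.prems in simp)
next
  case (tens_scale_left f g c)
  show ?case
  proof (rule wspace_append_eqI[OF lin_ev lin_ev, of N "web_dom f" "web_dom g"])
    fix t u assume t: "t \<in> wspace N (web_dom f)" and u: "u \<in> wspace N (web_dom g)"
    then show "ev N (Scale c f \<otimes>\<otimes> g) (t \<star> u) = ev N (Scale c (f \<otimes>\<otimes> g)) (t \<star> u)"
      using wspace_tens[OF t] wspace_tens[OF u] by (simp add: ev_tens star_scale)
  qed (use tens_scale_left.prems in simp)
next
  case (tens_scale_right f g c)
  show ?case
  proof (rule wspace_append_eqI[OF lin_ev lin_ev, of N "web_dom f" "web_dom g"])
    fix t u assume t: "t \<in> wspace N (web_dom f)" and u: "u \<in> wspace N (web_dom g)"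
    then show "ev N (f \<otimes>\<otimes> Scale c g) (t \<star> u) = ev N (Scale c (f \<otimes>\<otimes> g)) (t \<star> u)"
      using wspace_tens[OF t] wspace_tens[OF u] by (simp add: ev_tens star_scale)
  qed (use tens_scale_right.prems in simp)
qed (auto simp: ev_add ev_scale cfun.scale_left_distrib cfun.scale_right_distrib add.assoc add.commute)

section \<open>Equivariance\<close>

text \<open>Wedges are shuffle products of vectors, so the Leibniz rule replaces one vector at a
  time and every term remains alternating.\<close>

lemma dv_ext:
  assumes g: "g \<in> so N" and t: "t \<in> ext_space N a"
  shows "dv N g t \<in> ext_space N a"
proof -
  have "dv N g (wedge ys) \<in> ext_space N (length ys)" if "set ys \<subseteq> Vspace N" for ys
    using that
  proof (induction ys)
    case Nil
    then show ?case by (simp add: wedge_Nil dv_unit ext_space_iff tens_def alt_def pw)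
  next
    case (Cons y ys)
    have v: "vec1 z \<in> ext_space N 1" if "z \<in> Vspace N" for z
      using vec1_in_tens[OF that] by (auto simp: ext_space_iff alt_def vec1_simps(5))
    have w: "wedge ys \<in> ext_space N (length ys)"
      using Cons.prems by (simp add: ext_space_iff alt_wedge wedge_in_tens)
    have gy: "g y \<in> Vspace N" using Cons.prems by (intro lin_in[OF soE(1)[OF g]]) simp
    have "dv N g (wedge (y # ys)) = shuf (vec1 (g y)) (wedge ys) + shuf (vec1 y) (dv N g (wedge ys))"
      using Cons.prems by (simp add: wedge_Cons dv_shuf dv_vec1[OF g])
    moreover have "shuf (vec1 (g y)) (wedge ys) \<in> ext_space N (1 + length ys)"
      "shuf (vec1 y) (dv N g (wedge ys)) \<in> ext_space N (1 + length ys)"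
      using Cons by (intro shuf_ext v gy w; simp)+
    ultimately show ?case
      using cfun.subspace_add[of "ext_space N (1 + length ys)"] by (simp add: ext_space_def)
  qed
  then show ?thesis
    by (intro lin_UNIV_into[OF lin_dv _ _ t[unfolded ext_space_def]]) (auto simp: ext_space_def)
qed

lemma dv_wspace:
  assumes g: "g \<in> so N"
  shows "t \<in> wspace N x \<Longrightarrow> dv N g t \<in> wspace N x"
proof (induction x arbitrary: t)
  case Nil
  then obtain c where "t = vscale c unit_tensor" by (auto simp: wspace_Nil span_unit)
  then show ?case by (simp add: dv_scale dv_unit cfun.subspace_0)
next
  case (Cons a x)
  have "t \<in> wspace N ([a] @ x)" using Cons.prems by simp
  then show ?case
  proof (rule wspace_append_into[OF lin_dv subspace_wspace, rotated])
    fix u v assume u: "u \<in> wspace N [a]" and v: "v \<in> wspace N x"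
    have "dv N g u \<in> wspace N [a]" using u dv_ext[OF g] by (simp add: wspace_single)
    from wspace_star[OF this v] wspace_star[OF u Cons.IH[OF v]]
    show "dv N g (u \<star> v) \<in> wspace N (a # x)"
      by (simp add: dv_star cfun.subspace_add)
  qed
qed

text \<open>Elements of the word spaces are built from vectors by the two products, so a derivation
  of both is determined by its values on \<open>V\<close>. All module axioms are reduced to
  this.\<close>

lemma derivation_unique:
  assumes D: "lin UNIV UNIV D" "\<And>t u. D (t \<star> u) = D t \<star> u + t \<star> D u"
      "\<And>t u. D (shuf t u) = shuf (D t) u + shuf t (D u)" "D unit_tensor = 0"
    and D': "lin UNIV UNIV D'" "\<And>t u. D' (t \<star> u) = D' t \<star> u + t \<star> D' u"
      "\<And>t u. D' (shuf t u) = shuf (D' t) u + shuf t (D' u)" "D' unit_tensor = 0"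
    and eq: "\<And>y. y \<in> Vspace N \<Longrightarrow> D (vec1 y) = D' (vec1 y)"
    and t: "t \<in> wspace N x"
  shows "D t = D' t"
proof -
  have w: "D (wedge ys) = D' (wedge ys)" if "set ys \<subseteq> Vspace N" for ys
    using that by (induction ys) (simp_all add: wedge_Nil wedge_Cons D D' eq)
  have "D t = D' t" if "t \<in> gens N x" for t
    using that by (induction x arbitrary: t) (auto simp: D D' w)
  then show ?thesis
    by (rule lin_UNIV_eq_on_span[OF D(1) D'(1) _ t[unfolded wspace_def]])
qed

lemma vec1_lin: "vec1 (y + z) = vec1 y + vec1 z" "vec1 (vscale c y) = vscale c (vec1 y)" "vec1 (y - z) = vec1 y - vec1 z"
  by (rule label_eqI; simp add: vec1_def on_words_simps pw split: list.split)+

lemma dv_so_add: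
  assumes g: "g \<in> so N" and h: "h \<in> so N" and t: "t \<in> wspace N x"
  shows "dv N (so_add N g h) t = dv N g t + dv N h t"
  by (rule derivation_unique[OF lin_dv dv_star dv_shuf dv_unit lin_plus[OF lin_dv lin_dv] _ _ _ _ t])
    (simp_all add: dv_star dv_shuf dv_unit star_add shuf_add dv_vec1 g h so_add_in,
      simp add: so_add_def vec1_lin)

lemma dv_so_scale:
  assumes g: "g \<in> so N" and t: "t \<in> wspace N x"
  shows "dv N (so_scale N c g) t = vscale c (dv N g t)"
  by (rule derivation_unique[OF lin_dv dv_star dv_shuf dv_unit lin_vscale[OF lin_dv] _ _ _ _ t])
    (simp_all add: dv_star dv_shuf dv_unit star_scale shuf_scale dv_vec1 g so_scale_in cfun.scale_right_distrib,
      simp add: so_scale_def vec1_lin)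

text \<open>A commutator of derivations is again a derivation, since the mixed terms cancel in
  pairs; on vectors the identity is the definition of the bracket.\<close>

lemma dv_so_bracket:
  assumes g: "g \<in> so N" and h: "h \<in> so N" and t: "t \<in> wspace N x"
  shows "dv N (so_bracket N g h) t = dv N g (dv N h t) - dv N h (dv N g t)"
proof (rule derivation_unique[OF lin_dv dv_star dv_shuf dv_unit _ _ _ _ _ t])
  show "lin UNIV UNIV (\<lambda>t. dv N g (dv N h t) - dv N h (dv N g t))"
    by (rule lin_minus[OF lin_comp[OF lin_dv lin_dv] lin_comp[OF lin_dv lin_dv]]) simp
  have m: "(t - t') \<star> u = t \<star> u - t' \<star> u" "u \<star> (t - t') = u \<star> t - u \<star> t'"
    "shuf (t - t') u = shuf t u - shuf t' u" "shuf u (t - t') = shuf u t - shuf u t'" for t t' u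
    using star_add(1)[of "t - t'" t' u] star_add(2)[of u "t - t'" t']
      shuf_add(1)[of "t - t'" t' u] shuf_add(2)[of u "t - t'" t'] by (simp_all add: algebra_simps)
  show "dv N g (dv N h (t \<star> u)) - dv N h (dv N g (t \<star> u)) =
      (dv N g (dv N h t) - dv N h (dv N g t)) \<star> u + t \<star> (dv N g (dv N h u) - dv N h (dv N g u))" for t u
    by (simp add: dv_star dv_add m algebra_simps)
  show "dv N g (dv N h (shuf t u)) - dv N h (dv N g (shuf t u)) =
      shuf (dv N g (dv N h t) - dv N h (dv N g t)) u + shuf t (dv N g (dv N h u) - dv N h (dv N g u))" for t u
    by (simp add: dv_shuf dv_add m algebra_simps)
  have "dv N g 0 = 0" for g
    using dv_scale[of N g 0 0] by simp
  then show "dv N g (dv N h unit_tensor) - dv N h (dv N g unit_tensor) = 0"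
    by (simp add: dv_unit)
  fix y assume y: "y \<in> Vspace N"
  have "g y \<in> Vspace N" "h y \<in> Vspace N"
    using y lin_in soE(1) g h by blast+
  then show "dv N (so_bracket N g h) (vec1 y) = dv N g (dv N h (vec1 y)) - dv N h (dv N g (vec1 y))"
    using y by (simp add: dv_vec1 g h so_bracket_in) (simp add: so_bracket_def vec1_lin)
qed

section \<open>Invariance of caps and cups\<close>

lemma so_matrix_skew:
  assumes g: "g \<in> so N" and ij: "i \<in> idx N" "j \<in> idx N"
  shows "g (vb j) i + g (vb (- i)) (- j) = 0"
proof -
  have s: "(\<Sum>l\<in>idx N. f l * vb k (- l)) = f (- k)" "(\<Sum>l\<in>idx N. vb k l * f l) = f k"
    if "k \<in> idx N" for f :: "int \<Rightarrow> complex" and k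
  proof -
    have "(\<Sum>l\<in>idx N. f l * vb k (- l)) = (\<Sum>l\<in>idx N. if l = - k then f l else 0)"
      by (intro sum.cong) (auto simp: vb_def)
    then show "(\<Sum>l\<in>idx N. f l * vb k (- l)) = f (- k)" using that by (simp add: idx_uminus)
    have "(\<Sum>l\<in>idx N. vb k l * f l) = (\<Sum>l\<in>idx N. if l = k then f l else 0)"
      by (intro sum.cong) (auto simp: vb_def)
    then show "(\<Sum>l\<in>idx N. vb k l * f l) = f k" using that by simp
  qed
  have "bform N (g (vb j)) (vb (- i)) + bform N (vb j) (g (vb (- i))) = 0"
    using ij by (intro soE(2)[OF g]) (simp_all add: idx_uminus)
  then show ?thesis
    using ij s(1)[of "- i" "g (vb j)"] s(2)[of j "\<lambda>l. g (vb (- i)) (- l)"]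
    by (simp add: bform_def idx_uminus)
qed

lemma der_snoc: "der G I f (k @ [x]) = der G I (\<lambda>k'. f (k' @ [x])) k + (\<Sum>j\<in>I. G x j * f (k @ [j]))"
  by (induction k arbitrary: f) simp_all

text \<open>Peel off the outermost pair of letters: the terms acting on this pair cancel by
  skewness, and those acting inside vanish by induction. The tensor \<open>t\<close> is
  arbitrary.\<close>

lemma cap_val_dv:
  assumes g: "g \<in> so N"
  shows "cap_val N a (dv N g t) = 0"
proof -
  let ?G = "\<lambda>i j. g (vb j) i" and ?I = "idx N"
  have "(\<Sum>k\<in>words N a. der ?G ?I f (k @ rho k)) = 0" for f
  proof (induction a arbitrary: f)
    case 0
    then show ?case by (simp add: sum_words_0)
  next
    case (Suc a)
    \<comment> \<open>Substituting \<open>- j\<close> for \<open>j\<close> and exchanging the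
      summation order turns the second double sum into minus the first.\<close>
    have "(\<Sum>x\<in>?I. \<Sum>j\<in>?I. ?G x j * f (j # k @ [- x])) + (\<Sum>x\<in>?I. \<Sum>j\<in>?I. ?G (- x) j * f (x # k @ [j])) = 0" for k
    proof -
      have "(\<Sum>x\<in>?I. \<Sum>j\<in>?I. ?G (- x) j * f (x # k @ [j])) = (\<Sum>x\<in>?I. \<Sum>j\<in>?I. ?G (- x) (- j) * f (x # k @ [- j]))"
      proof (rule sum.cong[OF HOL.refl])
        fix x
        show "(\<Sum>j\<in>?I. ?G (- x) j * f (x # k @ [j])) = (\<Sum>j\<in>?I. ?G (- x) (- j) * f (x # k @ [- j]))"
          by (rule sum.reindex_bij_witness[of _ uminus uminus]) (auto simp: idx_uminus)
      qed
      also have "\<dots> = (\<Sum>j\<in>?I. \<Sum>x\<in>?I. ?G (- x) (- j) * f (x # k @ [- j]))"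
        by (rule sum.swap)
      also have "\<dots> = - (\<Sum>j\<in>?I. \<Sum>x\<in>?I. ?G j x * f (x # k @ [- j]))"
        unfolding sum_negf[symmetric]
      proof (intro sum.cong HOL.refl)
        fix j x assume "j \<in> ?I" "x \<in> ?I"
        then have "?G (- x) (- j) = - ?G j x"
          using so_matrix_skew[OF g, of j x] by (simp add: eq_neg_iff_add_eq_0 add.commute)
        then show "?G (- x) (- j) * f (x # k @ [- j]) = - (?G j x * f (x # k @ [- j]))" by simp
      qed
      finally show ?thesis by simp
    qed
    then have z: "(\<Sum>k\<in>words N a. (\<Sum>x\<in>?I. \<Sum>j\<in>?I. ?G x j * f (j # (k @ rho k) @ [- x])) +
        (\<Sum>x\<in>?I. \<Sum>j\<in>?I. ?G (- x) j * f (x # (k @ rho k) @ [j]))) = 0"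
      by (intro sum.neutral ballI)
    have "(\<Sum>k\<in>words N (Suc a). der ?G ?I f (k @ rho k)) =
        (\<Sum>x\<in>?I. \<Sum>k\<in>words N a. (\<Sum>j\<in>?I. ?G x j * f (j # (k @ rho k) @ [- x])) +
          (\<Sum>j\<in>?I. ?G (- x) j * f (x # (k @ rho k) @ [j]))) +
        (\<Sum>x\<in>?I. \<Sum>k\<in>words N a. der ?G ?I (\<lambda>k'. f (x # k' @ [- x])) (k @ rho k))"
      unfolding sum_words_Suc sum.distrib[symmetric]
      by (intro sum.cong HOL.refl) (simp add: der_snoc[of ?G ?I _ "k @ rho k" for k, simplified] sum.distrib algebra_simps)
    also have "(\<Sum>x\<in>?I. \<Sum>k\<in>words N a. der ?G ?I (\<lambda>k'. f (x # k' @ [- x])) (k @ rho k)) = 0"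
      by (simp add: Suc.IH)
    also have "(\<Sum>x\<in>?I. \<Sum>k\<in>words N a. (\<Sum>j\<in>?I. ?G x j * f (j # (k @ rho k) @ [- x])) +
          (\<Sum>j\<in>?I. ?G (- x) j * f (x # (k @ rho k) @ [j]))) = 0"
      using z by (subst sum.swap) (simp add: sum.distrib)
    finally show ?case by simp
  qed
  then show ?thesis by (simp add: cap_val_def dv_def on_words_simps)
qed

lemma cup_dv:
  assumes g: "g \<in> so N"
  shows "dv N g (cup N a) = 0"
proof -
  let ?w = wedge_vb
  have d: "dv N g (?w i) \<in> ext_space N a" if "i \<in> incs N a" for i
    using that by (intro dv_ext[OF g] wedge_vb_ext)
  \<comment> \<open>the invariance of the cap under \<open>g\<close>, evaluated on dual basis vectors\<close>
  have c: "dv N g (?w i) (Idx j) + dv N g (?w (rho j)) (Idx (rho i)) = 0"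
    if i: "i \<in> incs N a" and j: "j \<in> incs N a" for i j
  proof -
    have "cap_val N a (dv N g (?w i) \<star> ?w (rho j)) + cap_val N a (?w i \<star> dv N g (?w (rho j))) =
        cap_val N a (dv N g (?w i \<star> ?w (rho j)))"
      by (simp add: dv_star cap_val_def pw sum.distrib add_divide_distrib)
    then show ?thesis
      using i j by (simp add: cap_val_dv[OF g] cap_val_wedge_left d cap_val_wedge_right)
  qed
  have "dv N g (cup N a) = (\<Sum>i\<in>incs N a. dv N g (?w i) \<star> ?w (rho i)) + (\<Sum>j\<in>incs N a. ?w j \<star> dv N g (?w (rho j)))"
    unfolding cup_def lin_UNIV_sum[OF lin_dv] by (simp add: dv_star sum.distrib)
  also have "(\<Sum>i\<in>incs N a. dv N g (?w i) \<star> ?w (rho i)) =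
      (\<Sum>i\<in>incs N a. \<Sum>j\<in>incs N a. vscale (dv N g (?w i) (Idx j)) (?w j \<star> ?w (rho i)))"
  proof (intro sum.cong HOL.refl)
    fix i assume i: "i \<in> incs N a"
    have "(\<Sum>j\<in>incs N a. vscale (dv N g (?w i) (Idx j)) (?w j)) \<star> ?w (rho i) =
        (\<Sum>j\<in>incs N a. vscale (dv N g (?w i) (Idx j)) (?w j \<star> ?w (rho i)))"
      by (simp add: star_sum star_scale)
    then show "dv N g (?w i) \<star> ?w (rho i) = (\<Sum>j\<in>incs N a. vscale (dv N g (?w i) (Idx j)) (?w j \<star> ?w (rho i)))"
      using ext_expand[OF d[OF i]] by simp
  qed
  also have "\<dots> = (\<Sum>j\<in>incs N a. \<Sum>i\<in>incs N a. vscale (dv N g (?w i) (Idx j)) (?w j \<star> ?w (rho i)))"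
    by (rule sum.swap)
  also have "(\<Sum>j\<in>incs N a. ?w j \<star> dv N g (?w (rho j))) =
      (\<Sum>j\<in>incs N a. \<Sum>i\<in>incs N a. vscale (dv N g (?w (rho j)) (Idx (rho i))) (?w j \<star> ?w (rho i)))"
  proof (intro sum.cong HOL.refl)
    fix j assume j: "j \<in> incs N a"
    have "?w j \<star> (\<Sum>i\<in>incs N a. vscale (dv N g (?w (rho j)) (Idx (rho i))) (?w (rho i))) =
        (\<Sum>i\<in>incs N a. vscale (dv N g (?w (rho j)) (Idx (rho i))) (?w j \<star> ?w (rho i)))"
      by (simp add: star_sum star_scale)
    then show "?w j \<star> dv N g (?w (rho j)) = (\<Sum>i\<in>incs N a. vscale (dv N g (?w (rho j)) (Idx (rho i))) (?w j \<star> ?w (rho i)))"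
      using ext_expand_rho[OF d[of "rho j"]] j by simp
  qed
  \<comment> \<open>Both expansions now run over the same products of wedges, and the coefficients
    combine to the expression that vanishes by \<open>c\<close>.\<close>
  finally have "dv N g (cup N a) = (\<Sum>j\<in>incs N a. \<Sum>i\<in>incs N a.
      vscale (dv N g (?w i) (Idx j) + dv N g (?w (rho j)) (Idx (rho i))) (?w j \<star> ?w (rho i)))"
    by (simp add: sum.distrib cfun.scale_left_distrib)
  also have "\<dots> = 0"
    by (intro sum.neutral ballI) (simp add: c)
  finally show ?thesis .
qed

lemma dv_zero [simp]: "dv N g 0 = 0"
  using dv_scale[of N g 0 0] by simp

lemma ev_dv:
  assumes g: "g \<in> so N"
  shows "wt f \<Longrightarrow> t \<in> wspace N (web_dom f) \<Longrightarrow> ev N f (dv N g t) = dv N g (ev N f t)"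
proof (induction f arbitrary: t)
  case (Merge a b)
  then have t: "t \<in> wspace N [a, b]" by simp
  show ?case
  proof (rule eq_on_wspace2[OF lin_comp[OF lin_dv lin_ev] lin_comp[OF lin_ev lin_dv] _ t])
    fix u v assume u: "u \<in> ext_space N a" and v: "v \<in> ext_space N b"
    show "ev N (Merge a b) (dv N g (u \<star> v)) = dv N g (ev N (Merge a b) (u \<star> v))"
      using ext_tens[OF u] dv_in_tens[OF g ext_tens[OF u]]
      unfolding dv_star ev_add by (simp add: merge_map_star dv_shuf)
  qed
next
  case (Cross a b)
  then have t: "t \<in> wspace N [a, b]" by simp
  show ?case
  proof (rule eq_on_wspace2[OF lin_comp[OF lin_dv lin_ev] lin_comp[OF lin_ev lin_dv] _ t])
    fix u v assume u: "u \<in> ext_space N a" and v: "v \<in> ext_space N b"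
    show "ev N (Cross a b) (dv N g (u \<star> v)) = dv N g (ev N (Cross a b) (u \<star> v))"
      using ext_tens[OF u] dv_in_tens[OF g ext_tens[OF u]] ext_tens[OF v] dv_in_tens[OF g ext_tens[OF v]]
      unfolding dv_star ev_add
      by (simp add: cross_map_star dv_star dv_scale cfun.scale_right_distrib add.commute)
  qed
next
  case (Cup a)
  then obtain c where "t = vscale c unit_tensor" by (auto simp: wspace_Nil span_unit)
  then show ?case by (simp add: dv_scale dv_unit cup_dv[OF g] zero_fun_apply)
next
  case (Cap a)
  then show ?case by (simp add: cap_val_dv[OF g] dv_scale dv_unit)
next
  case (Comp f h)
  then show ?case using ev_wspace[of h t N] by simp
next
  case (Tens f h)
  show ?case
  proof (rule wspace_append_eqI[OF lin_comp[OF lin_dv lin_ev] lin_comp[OF lin_ev lin_dv], of N "web_dom f" "web_dom h"])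
    fix u v assume u: "u \<in> wspace N (web_dom f)" and v: "v \<in> wspace N (web_dom h)"
    show "ev N (f \<otimes>\<otimes> h) (dv N g (u \<star> v)) = dv N g (ev N (f \<otimes>\<otimes> h) (u \<star> v))"
      using Tens wspace_tens[OF u] wspace_tens[OF v] wspace_tens[OF dv_wspace[OF g u]] wspace_tens[OF dv_wspace[OF g v]] u v
      unfolding dv_star ev_add by (simp add: ev_tens dv_star)
  qed (use Tens.prems in simp)
qed (auto simp: dv_add dv_scale)

section \<open>The functor\<close>

definition webmod :: "nat \<Rightarrow> nat list \<Rightarrow> so_module" where
  "webmod N x = \<lparr>underlying = wspace N x, act = (\<lambda>g\<in>so N. \<lambda>t\<in>wspace N x. dv N g t)\<rparr>"

text \<open>The linear map on nested tensors that takes \<open>w \<otimes>\<^sub>v v\<close> to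
  \<open>w \<star> v\<close>.\<close>

definition tensor_concat :: "vec \<Rightarrow> vec" where
  "tensor_concat t = on_words (splits (\<lambda>p q. t (Tensor (Idx p) (Idx q))))"

text \<open>A word does not remember where it was concatenated, so the inverse needs the degree
  \<open>m\<close> of the left factor.\<close>

definition untensor :: "nat \<Rightarrow> vec \<Rightarrow> vec" where
  "untensor m t = (\<lambda>l. case l of Tensor (Idx p) (Idx q) \<Rightarrow> if length p = m then t (Idx (p @ q)) else 0 | _ \<Rightarrow> 0)"

definition web_functor :: "nat \<Rightarrow> (nat list, web set, so_module, so_map) mfunctor" where
  "web_functor N = \<lparr>
     F_ob = webmod N,
     F_ar = (\<lambda>A. let f = (SOME f. f \<in> A) in mk (webmod N (web_dom f)) (webmod N (web_cod f)) (ev N f)),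
     F_mult = (\<lambda>x y. mk (tensor_module N (webmod N x) (webmod N y)) (webmod N (x @ y)) tensor_concat),
     F_unit = mk (trivial_module N) (webmod N []) (\<lambda>w. w)\<rparr>"

section \<open>Modules of words and the concatenation isomorphisms\<close>

lemma underlying_webmod [simp]: "underlying (webmod N x) = wspace N x"
  by (simp add: webmod_def)

lemma act_webmod: "g \<in> so N \<Longrightarrow> t \<in> wspace N x \<Longrightarrow> act (webmod N x) g t = dv N g t"
  by (simp add: webmod_def)

lemma wspace_finite: "\<exists>B. finite B \<and> wspace N x = cfun.span B"
proof (rule finite_basis_of_subspace)
  show "finite (basis ` words N (sum_list x))" by simp
  show "wspace N x \<subseteq> cfun.span (basis ` words N (sum_list x))"
  proof
    fix t assume "t \<in> wspace N x"
    then have "t = (\<Sum>l\<in>words N (sum_list x). vscale (t (Idx l)) (basis l))"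
      by (intro tens_expand wspace_tens)
    moreover have "\<dots> \<in> cfun.span (basis ` words N (sum_list x))"
      by (intro cfun.span_sum cfun.span_scale cfun.span_base) simp
    ultimately show "t \<in> cfun.span (basis ` words N (sum_list x))" by simp
  qed
qed simp

lemma is_so_module_webmod: "is_so_module N (webmod N x)"
proof -
  obtain B where B: "finite B" "wspace N x = cfun.span B" using wspace_finite by blast
  show ?thesis
    unfolding webmod_def
    by (rule so_moduleI[OF B])
      (auto simp: dv_so_add dv_so_scale dv_so_bracket dv_wspace dv_add dv_scale intro!: linI)
qed

lemma webmod_single: "webmod N [a] = ext_power N a"
proof -
  have "dv N g t = deriv_fun g t" if "g \<in> so N" "t \<in> ext_space N a" for g t
    using deriv_fun_dv[OF that(1) ext_tens[OF that(2)]] by simp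
  then show ?thesis
    by (auto simp: webmod_def ext_power_def wspace_single fun_eq_iff restrict_def)
qed

lemma lin_tensor_concat: "lin UNIV UNIV tensor_concat"
proof -
  have "tensor_concat (v + w) = tensor_concat v + tensor_concat w" "tensor_concat (vscale c v) = vscale c (tensor_concat v)" for v w c
    by (rule label_eqI; simp add: tensor_concat_def on_words_simps pw splits_add splits_scale)+
  then show ?thesis by (simp add: lin_UNIV)
qed

lemma lin_untensor: "lin UNIV UNIV (untensor m)"
proof -
  have "untensor m (v + w) = untensor m v + untensor m w" "untensor m (vscale c v) = vscale c (untensor m v)" for v w c
    by (auto simp: untensor_def pw fun_eq_iff split: label.split)
  then show ?thesis by (simp add: lin_UNIV)
qed

lemma tensor_concat_tensor: "tensor_concat (w \<otimes>\<^sub>v v) = w \<star> v"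
  by (simp add: tensor_concat_def star_def tensor_vec_simps)

lemma untensor_star:
  assumes w: "w \<in> tens N m" and v: "v \<in> tens N n"
  shows "untensor m (w \<star> v) = w \<otimes>\<^sub>v v"
proof (rule label_eqI)
  fix p q
  show "untensor m (w \<star> v) (Tensor p q) = (w \<otimes>\<^sub>v v) (Tensor p q)"
    using w by (cases p; cases q)
      (auto simp: untensor_def tensor_vec_simps star_append tensD(1)[OF w] tensD(1)[OF v] dest: tensD(3))
qed (simp add: untensor_def tensor_vec_simps)

lemma equivariant_tensor_concat:
  "equivariant N (tensor_module N (webmod N x) (webmod N y)) (webmod N (x @ y)) tensor_concat"
proof (rule equivariant_tensorI[OF is_so_module_webmod is_so_module_webmod is_so_module_webmod])
  have "lin (cfun.span {w \<otimes>\<^sub>v v |w v. w \<in> wspace N x \<and> v \<in> wspace N y}) (wspace N (x @ y)) tensor_concat"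
    by (rule lin_into[OF lin_weaken[OF lin_tensor_concat subset_UNIV subset_refl] subspace_wspace])
      (auto simp: tensor_concat_tensor intro: wspace_star)
  then show "lin (underlying (tensor_module N (webmod N x) (webmod N y))) (underlying (webmod N (x @ y))) tensor_concat"
    by (simp add: underlying_tensor tensor_space_def)
  fix g w v assume "g \<in> so N" "w \<in> underlying (webmod N x)" "v \<in> underlying (webmod N y)"
  then show "tensor_concat (act (webmod N x) g w \<otimes>\<^sub>v v) + tensor_concat (w \<otimes>\<^sub>v act (webmod N y) g v) =
      act (webmod N (x @ y)) g (tensor_concat (w \<otimes>\<^sub>v v))"
    by (simp add: act_webmod tensor_concat_tensor dv_star wspace_star)
qed

lemma equivariant_ev:
  assumes f: "wt f"
  shows "equivariant N (webmod N (web_dom f)) (webmod N (web_cod f)) (ev N f)"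
  unfolding equivariant_def
proof (intro conjI ballI)
  show "lin (underlying (webmod N (web_dom f))) (underlying (webmod N (web_cod f))) (ev N f)"
    using ev_wspace[OF f] by (intro linI) (simp_all add: ev_add ev_scale)
  fix g t assume "g \<in> so N" "t \<in> underlying (webmod N (web_dom f))"
  then show "ev N f (act (webmod N (web_dom f)) g t) = act (webmod N (web_cod f)) g (ev N f t)"
    using ev_wspace[OF f] ev_dv[OF _ f] by (simp add: act_webmod)
qed

text \<open>The functor evaluates an arbitrary representative chosen by \<open>SOME\<close>;
  \<open>web_eq_wt\<close> and \<open>web_eq_sound\<close> make the choice immaterial.\<close>

lemma F_ar_class:
  assumes f: "wt f"
  shows "F_ar (web_functor N) (web_class N f) = mk (webmod N (web_dom f)) (webmod N (web_cod f)) (ev N f)"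
proof -
  define h where "h = (SOME h. h \<in> web_class N f)"
  have "h \<in> web_class N f"
    unfolding h_def by (rule someI[of _ f]) (rule web_class_refl[OF f])
  then have h: "web_eq N f h" by (simp add: web_class_def)
  have "mk (webmod N (web_dom f)) (webmod N (web_cod f)) (ev N f) = mk (webmod N (web_dom f)) (webmod N (web_cod f)) (ev N h)"
    by (rule mk_cong) (simp add: web_eq_sound[OF h])
  then show ?thesis
    using web_eq_wt[OF h] by (simp add: web_functor_def h_def[symmetric])
qed

lemma functor_simps:
  "F_ob (web_functor N) = webmod N"
  "F_mult (web_functor N) x y = mk (tensor_module N (webmod N x) (webmod N y)) (webmod N (x @ y)) tensor_concat"
  "F_unit (web_functor N) = mk (trivial_module N) (webmod N []) (\<lambda>w. w)"
  by (simp_all add: web_functor_def)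

lemma equivariant_unit: "equivariant N (trivial_module N) (webmod N []) (\<lambda>w. w)"
proof -
  have "dv N g w = 0" if "w \<in> cfun.span {unit_tensor}" for g w
    using that by (auto simp: span_unit dv_scale dv_unit)
  then show ?thesis
    by (simp add: equivariant_def underlying_trivial act_trivial wspace_Nil act_webmod lin_id)
qed

text \<open>The inverse cuts words after \<open>sum_list x\<close> letters. It need not be shown
  equivariant separately, since the inverse of an equivariant bijection is equivariant.\<close>

lemma iso_mult:
  "iso_ar (so_mod N) (tensor_module N (webmod N x) (webmod N y)) (webmod N (x @ y))
     (mk (tensor_module N (webmod N x) (webmod N y)) (webmod N (x @ y)) tensor_concat)"
proof (rule iso_mkI[OF is_so_module_tensor[OF is_so_module_webmod is_so_module_webmod] is_so_module_webmod equivariant_tensor_concat])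
  let ?T = "tensor_space (wspace N x) (wspace N y)" and ?u = "untensor (sum_list x)"
  have u: "?u (w \<star> v) = w \<otimes>\<^sub>v v" if "w \<in> wspace N x" "v \<in> wspace N y" for w v
    by (rule untensor_star[OF wspace_tens[OF that(1)] wspace_tens[OF that(2)]])
  have "?u t \<in> ?T" if "t \<in> wspace N (x @ y)" for t
    by (rule wspace_append_into[OF lin_untensor subspace_tensor_space _ that]) (simp add: u tensor_vec_in)
  then show "lin (underlying (webmod N (x @ y))) (underlying (tensor_module N (webmod N x) (webmod N y))) ?u"
    using lin_untensor by (auto simp: lin_def underlying_tensor)
  show "tensor_concat (?u t) = t" if "t \<in> underlying (webmod N (x @ y))" for t
    by (rule wspace_append_eqI[OF lin_comp[OF lin_untensor lin_tensor_concat] lin_id[OF subset_UNIV], of N x y])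
      (use that in \<open>simp_all add: u tensor_concat_tensor\<close>)
  show "?u (tensor_concat t) = t" if "t \<in> underlying (tensor_module N (webmod N x) (webmod N y))" for t
    by (rule lin_eq_on_tensor[OF lin_weaken[OF lin_comp[OF lin_tensor_concat lin_untensor] subset_UNIV subset_refl]
          lin_id[OF subset_refl] _ that[unfolded underlying_tensor]])
      (simp add: tensor_concat_tensor u)
qed

lemma equivariant_id_webmod: "equivariant N (webmod N x) (webmod N x) (\<lambda>t. t)"
  by (rule equivariant_id[OF is_so_module_webmod])

lemma F_ar_Ident: "x \<in> web_ob \<Longrightarrow> F_ar (web_functor N) (web_class N (Ident x)) = mk (webmod N x) (webmod N x) (\<lambda>t. t)"
  by (simp add: F_ar_class)

text \<open>The cases follow the functor axioms. Naturality of the multiplication is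
  \<open>ev_tens\<close>, and compatibility with the associators is associativity of
  \<open>\<star>\<close>.\<close>

theorem web_functor: "linear_monoidal_functor (web_cat N) (so_mod N) (web_functor N)"
proof (intro linear_monoidal_functor.intro web_cat_category so_mod_category linear_monoidal_functor_axioms.intro, goal_cases)
  case (1 x) then show ?case by (simp add: so_mod_simps functor_simps is_so_module_webmod)
next
  case (2 x y f) then show ?case
    by (auto simp: web_arrows so_mod_simps(2) functor_simps F_ar_class
        intro!: mk_in_so_maps is_so_module_webmod equivariant_ev)
next
  case (3 x) then show ?case by (simp add: web_cat_simps so_mod_simps functor_simps F_ar_Ident)
next
  case (4 x y z f g) then show ?case
    by (auto simp: web_arrows web_class_cmp F_ar_class cmp_mk[OF equivariant_ev])
      (metis cmp_mk equivariant_ev)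
next
  case (5 x y f g) then show ?case
    by (auto simp: web_arrows web_class_add F_ar_class so_mod_simps)
next
  case (6 x y f c) then show ?case
    by (auto simp: web_arrows web_class_scale F_ar_class so_mod_simps)
next
  case 7
  show ?case unfolding functor_simps so_mod_simps web_cat_simps
    by (rule iso_mk[OF is_so_module_trivial is_so_module_webmod equivariant_unit equivariant_inverse[OF is_so_module_webmod equivariant_unit _ is_so_module_trivial]])
      (auto simp: wspace_Nil underlying_trivial intro: lin_id)
next
  case (8 x y) then show ?case
    by (simp add: functor_simps so_mod_simps web_cat_simps iso_mult)
next
  case (9 x x' y y' f g)
  then obtain f1 g1 where m: "f = web_class N f1" "g = web_class N g1"
    and w: "wt f1" "wt g1" "web_dom f1 = x" "web_cod f1 = x'" "web_dom g1 = y" "web_cod g1 = y'"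
    by (auto simp: web_arrows)
  have e: "equivariant N (webmod N x) (webmod N x') (ev N f1)" "equivariant N (webmod N y) (webmod N y') (ev N g1)"
    "equivariant N (webmod N (x @ y)) (webmod N (x' @ y')) (ev N (f1 \<otimes>\<otimes> g1))"
    using equivariant_ev[of f1 N] equivariant_ev[of g1 N] equivariant_ev[of "f1 \<otimes>\<otimes> g1" N] w by simp_all
  note M = is_so_module_webmod
  note t = equivariant_tensor_fun[OF M M M M e(1,2)]
  have "mk (tensor_module N (webmod N x) (webmod N y)) (webmod N (x' @ y')) (\<lambda>s. tensor_concat (tensor_fun (ev N f1) (ev N g1) s)) =
      mk (tensor_module N (webmod N x) (webmod N y)) (webmod N (x' @ y')) (\<lambda>s. ev N (f1 \<otimes>\<otimes> g1) (tensor_concat s))"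
  proof (rule mk_tensor_eq[OF M M equivariant_compose[OF t equivariant_tensor_concat] equivariant_compose[OF equivariant_tensor_concat e(3)]])
    fix u v assume u: "u \<in> underlying (webmod N x)" and v: "v \<in> underlying (webmod N y)"
    show "tensor_concat (tensor_fun (ev N f1) (ev N g1) (u \<otimes>\<^sub>v v)) = ev N (f1 \<otimes>\<otimes> g1) (tensor_concat (u \<otimes>\<^sub>v v))"
      using u v w wspace_tens[of u N x] wspace_tens[of v N y]
      by (simp add: tensor_fun_equivariant[OF e(1,2) u v] tensor_concat_tensor ev_tens)
  qed
  then show ?case
    using w by (simp add: m functor_simps web_class_tensor F_ar_class tensor_mk[OF M M e(2)]
        cmp_mk[OF t] cmp_mk[OF equivariant_tensor_concat])
next
  case (10 x y z)
  then have ob: "x @ y @ z \<in> web_ob" by (simp add: web_cat_simps web_ob_append)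
  note M = is_so_module_webmod and T = is_so_module_tensor[OF is_so_module_webmod is_so_module_webmod]
  note i = equivariant_id_webmod
  note a = equivariant_assoc_fun[OF M M M, of N x y z]
  note t1 = equivariant_tensor_fun[OF T M M M equivariant_tensor_concat i, of N x y z]
  note t2 = equivariant_tensor_fun[OF M T M M i equivariant_tensor_concat, of N x y z]
  have c1: "equivariant N (tensor_module N (tensor_module N (webmod N x) (webmod N y)) (webmod N z)) (webmod N (x @ y @ z))
      (\<lambda>s. tensor_concat (tensor_fun tensor_concat (\<lambda>t. t) s))"
    using equivariant_compose[OF t1 equivariant_tensor_concat] by simp
  note c2 = equivariant_compose[OF equivariant_compose[OF a t2] equivariant_tensor_concat]
  have "mk (tensor_module N (tensor_module N (webmod N x) (webmod N y)) (webmod N z)) (webmod N (x @ y @ z))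
      (\<lambda>s. tensor_concat (tensor_fun tensor_concat (\<lambda>t. t) s)) =
    mk (tensor_module N (tensor_module N (webmod N x) (webmod N y)) (webmod N z)) (webmod N (x @ y @ z))
      (\<lambda>s. tensor_concat (tensor_fun (\<lambda>t. t) tensor_concat (assoc_fun s)))"
  proof (rule mk_tensor3_eq[OF c1 equivariant_compose[OF equivariant_compose[OF a t2] equivariant_tensor_concat]])
    fix u v w assume u: "u \<in> underlying (webmod N x)" and v: "v \<in> underlying (webmod N y)" and w: "w \<in> underlying (webmod N z)"
    have uv: "u \<otimes>\<^sub>v v \<in> underlying (tensor_module N (webmod N x) (webmod N y))"
      "v \<otimes>\<^sub>v w \<in> underlying (tensor_module N (webmod N y) (webmod N z))"
      using u v w by (simp_all add: underlying_tensor tensor_vec_in)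
    show "tensor_concat (tensor_fun tensor_concat (\<lambda>t. t) ((u \<otimes>\<^sub>v v) \<otimes>\<^sub>v w)) = tensor_concat (tensor_fun (\<lambda>t. t) tensor_concat (assoc_fun ((u \<otimes>\<^sub>v v) \<otimes>\<^sub>v w)))"
      by (simp add: assoc_fun_tensor tensor_fun_equivariant[OF equivariant_tensor_concat i uv(1) w]
          tensor_fun_equivariant[OF i equivariant_tensor_concat u uv(2)] tensor_concat_tensor star_assoc)
  qed
  then show ?case
    using ob t1 t2
    by (simp add: functor_simps web_cat_simps so_mod_simps F_ar_Ident tensor_mk[OF T M i] tensor_mk[OF M T equivariant_tensor_concat]
        cmp_mk[OF t1] cmp_mk[OF a] cmp_mk[OF c2] cmp_mk[OF equivariant_compose[OF a t2]])
next
  case (11 x)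
  then have ob: "x \<in> web_ob" by (simp add: web_cat_simps)
  note M = is_so_module_webmod and tr = is_so_module_trivial and i = equivariant_id_webmod
  note t = equivariant_tensor_fun[OF tr M M M equivariant_unit i, of N x]
  note c = equivariant_compose[OF t equivariant_tensor_concat, simplified]
  have "mk (tensor_module N (trivial_module N) (webmod N x)) (webmod N x) (\<lambda>s. tensor_concat (tensor_fun (\<lambda>w. w) (\<lambda>t. t) s)) =
    mk (tensor_module N (trivial_module N) (webmod N x)) (webmod N x) (\<lambda>t p. t (Tensor (Idx []) p))"
  proof (rule mk_tensor_eq[OF tr M c iso_lunit(1)[OF M]])
    fix w v assume w: "w \<in> underlying (trivial_module N)" and v: "v \<in> underlying (webmod N x)"
    then obtain c where c: "w = vscale c unit_tensor" by (auto simp: underlying_trivial span_unit)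
    show "tensor_concat (tensor_fun (\<lambda>w. w) (\<lambda>t. t) (w \<otimes>\<^sub>v v)) = (\<lambda>p. (w \<otimes>\<^sub>v v) (Tensor (Idx []) p))"
      unfolding tensor_fun_equivariant[OF equivariant_unit i w v] tensor_concat_tensor
      unfolding c lunit_tensor star_scale using v wspace_tens[of v N x] by simp
  qed
  then show ?case
    using ob t c
    by (simp add: functor_simps web_cat_simps so_mod_simps F_ar_Ident tensor_mk[OF tr M i] cmp_mk[OF t] cmp_mk[OF c] cmp_mk[OF iso_lunit(1)[OF M]])
next
  case (12 x)
  then have ob: "x \<in> web_ob" by (simp add: web_cat_simps)
  note M = is_so_module_webmod and tr = is_so_module_trivial and i = equivariant_id_webmod
  note t = equivariant_tensor_fun[OF M tr M M i equivariant_unit, of N x]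
  note c = equivariant_compose[OF t equivariant_tensor_concat, simplified]
  have "mk (tensor_module N (webmod N x) (trivial_module N)) (webmod N x) (\<lambda>s. tensor_concat (tensor_fun (\<lambda>t. t) (\<lambda>w. w) s)) =
    mk (tensor_module N (webmod N x) (trivial_module N)) (webmod N x) (\<lambda>t p. t (Tensor p (Idx [])))"
  proof (rule mk_tensor_eq[OF M tr c iso_runit(1)[OF M]])
    fix v w assume w: "w \<in> underlying (trivial_module N)" and v: "v \<in> underlying (webmod N x)"
    then obtain c where c: "w = vscale c unit_tensor" by (auto simp: underlying_trivial span_unit)
    show "tensor_concat (tensor_fun (\<lambda>t. t) (\<lambda>w. w) (v \<otimes>\<^sub>v w)) = (\<lambda>p. (v \<otimes>\<^sub>v w) (Tensor p (Idx [])))"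
      unfolding tensor_fun_equivariant[OF i equivariant_unit v w] tensor_concat_tensor
      unfolding c runit_tensor star_scale using v wspace_tens[of v N x] by simp
  qed
  then show ?case
    using ob t c
    by (simp add: functor_simps web_cat_simps so_mod_simps F_ar_Ident tensor_mk[OF M tr equivariant_unit] cmp_mk[OF t] cmp_mk[OF c] cmp_mk[OF iso_runit(1)[OF M]])
qed

section \<open>Values of the functor on the generators\<close>

lemma F_ar_generator:
  assumes "wt f" "t \<in> wspace N (web_dom f)"
  shows "arrow_map (F_ar (web_functor N) (web_class N f)) t = ev N f t"
  using assms by (simp add: F_ar_class)

lemma F_mult_tensor:
  assumes "t \<in> ext_space N a" "u \<in> ext_space N b"
  shows "arrow_map (F_mult (web_functor N) [a] [b]) (t \<otimes>\<^sub>v u) = t \<star> u"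
  using assms by (simp add: functor_simps underlying_tensor tensor_vec_in wspace_single tensor_concat_tensor)

lemma F_mult_sum:
  assumes "finite A" "\<And>i. i \<in> A \<Longrightarrow> t i \<in> ext_space N a" "\<And>i. i \<in> A \<Longrightarrow> u i \<in> ext_space N b"
  shows "arrow_map (F_mult (web_functor N) [a] [b]) (\<Sum>i\<in>A. vscale (c i) (t i \<otimes>\<^sub>v u i)) = (\<Sum>i\<in>A. vscale (c i) (t i \<star> u i))"
proof -
  have "(\<Sum>i\<in>A. vscale (c i) (t i \<otimes>\<^sub>v u i)) \<in> tensor_space (ext_space N a) (ext_space N b)"
    using assms by (intro cfun.subspace_sum[OF subspace_tensor_space] cfun.subspace_scale[OF subspace_tensor_space] tensor_vec_in)
  then have "arrow_map (F_mult (web_functor N) [a] [b]) (\<Sum>i\<in>A. vscale (c i) (t i \<otimes>\<^sub>v u i)) =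
      tensor_concat (\<Sum>i\<in>A. vscale (c i) (t i \<otimes>\<^sub>v u i))"
    by (simp add: functor_simps underlying_tensor wspace_single)
  also have "\<dots> = (\<Sum>i\<in>A. vscale (c i) (t i \<star> u i))"
    unfolding lin_UNIV_sum[OF lin_tensor_concat] using lin_tensor_concat by (simp add: lin_UNIV tensor_concat_tensor)
  finally show ?thesis .
qed

lemma wedge_vb_ext': "set i \<subseteq> idx N \<Longrightarrow> wedge_vb i \<in> ext_space N (length i)"
  by (simp add: ext_space_iff alt_wedge wedge_vb_in_tens)

theorem theoremA:
  fixes N :: nat
  assumes "N \<ge> 1"
  shows "\<exists>F. linear_monoidal_functor (web_cat N) (so_mod N) F \<and>
    (\<forall>a\<ge>1. F_ob F [a] = ext_power N a) \<and>
    (\<forall>a\<ge>1. \<forall>b\<ge>1. \<forall>i j. length i = a \<and> set i \<subseteq> idx N \<and> length j = b \<and> set j \<subseteq> idx N \<longrightarrow>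
       arrow_map (F_ar F (web_class N (Merge a b))) (arrow_map (F_mult F [a] [b]) (wedge_vb i \<otimes>\<^sub>v wedge_vb j))
         = wedge_vb (i @ j)) \<and>
    (\<forall>a\<ge>1. \<forall>b\<ge>1. \<forall>i. length i = a + b \<and> set i \<subseteq> idx N \<longrightarrow>
       arrow_map (F_ar F (web_class N (Split a b))) (wedge_vb i) =
         arrow_map (F_mult F [a] [b]) (\<Sum>w\<in>min_coset_reps a b.
           vscale ((-1) ^ perm_length (a + b) w)
             (wedge_vb (map (\<lambda>k. i ! w k) [0..<a])
                \<otimes>\<^sub>v wedge_vb (map (\<lambda>k. i ! w k) [a..<a + b])))) \<and>
    (\<forall>a\<ge>1. \<forall>b\<ge>1. \<forall>y\<in>underlying (ext_power N a). \<forall>z\<in>underlying (ext_power N b).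
       arrow_map (F_ar F (web_class N (Cross a b))) (arrow_map (F_mult F [a] [b]) (y \<otimes>\<^sub>v z)) =
         arrow_map (F_mult F [b] [a]) (vscale ((-1) ^ (a * b)) (z \<otimes>\<^sub>v y))) \<and>
    (\<forall>a\<ge>1. \<forall>i j. length i = a \<and> set i \<subseteq> idx N \<and> sorted_wrt (<) i \<and>
                length j = a \<and> set j \<subseteq> idx N \<and> sorted_wrt (>) j \<longrightarrow>
       arrow_map (F_ar F (web_class N (Cap a))) (arrow_map (F_mult F [a] [a]) (wedge_vb i \<otimes>\<^sub>v wedge_vb (rev j))) =
         arrow_map (F_unit F) (vscale (\<Prod>k<a. if i ! k = - (j ! k) then 1 else 0) unit_tensor)) \<and>
    (\<forall>a\<ge>1. arrow_map (F_ar F (web_class N (Cup a))) (arrow_map (F_unit F) unit_tensor) =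
       arrow_map (F_mult F [a] [a])
         (\<Sum>i | length i = a \<and> set i \<subseteq> idx N \<and> sorted_wrt (<) i.
            wedge_vb i \<otimes>\<^sub>v wedge_vb (rev (map uminus i))))"
proof (intro exI[of _ "web_functor N"] conjI allI impI ballI)
  show "linear_monoidal_functor (web_cat N) (so_mod N) (web_functor N)" by (rule web_functor)
next
  fix a :: nat
  show "F_ob (web_functor N) [a] = ext_power N a" by (simp add: functor_simps webmod_single)
next
  fix a b :: nat and i j :: "int list"
  assume ab: "a \<ge> 1" "b \<ge> 1" and ij: "length i = a \<and> set i \<subseteq> idx N \<and> length j = b \<and> set j \<subseteq> idx N"
  then have m: "wedge_vb i \<in> ext_space N a" "wedge_vb j \<in> ext_space N b"
    using wedge_vb_ext'[of i N] wedge_vb_ext'[of j N] by auto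
  show "arrow_map (F_ar (web_functor N) (web_class N (Merge a b)))
      (arrow_map (F_mult (web_functor N) [a] [b]) (wedge_vb i \<otimes>\<^sub>v wedge_vb j)) = wedge_vb (i @ j)"
    using ab ext_star[OF m] ext_tens[OF m(1)]
    by (simp add: F_mult_tensor[OF m] F_ar_generator merge_map_star wedge_append)
next
  fix a b :: nat and i :: "int list"
  assume ab: "a \<ge> 1" "b \<ge> 1" and i: "length i = a + b \<and> set i \<subseteq> idx N"
  let ?p = "\<lambda>w. wedge_vb (map (\<lambda>k. i ! w k) [0..<a])" and ?q = "\<lambda>w. wedge_vb (map (\<lambda>k. i ! w k) [a..<a + b])"
  have nth: "w k < a + b" if "w \<in> min_coset_reps a b" "k < a + b" for w k
    using that permutes_in_image[OF min_coset_repsD(1)[OF that(1)], of k] by simp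
  have m: "?p w \<in> ext_space N a" "?q w \<in> ext_space N b" if w: "w \<in> min_coset_reps a b" for w
  proof -
    have "set (map (\<lambda>k. i ! w k) [0..<a]) \<subseteq> idx N" "set (map (\<lambda>k. i ! w k) [a..<a + b]) \<subseteq> idx N"
      using i nth[OF w] by auto
    from this[THEN wedge_vb_ext'] show "?p w \<in> ext_space N a" "?q w \<in> ext_space N b" by simp_all
  qed
  have "wedge_vb i = (\<Sum>w\<in>min_coset_reps a b. vscale ((-1) ^ perm_length (a + b) w)
      (wedge (map (\<lambda>k. map vb i ! w k) [0..<a]) \<star> wedge (map (\<lambda>k. map vb i ! w k) [a..<a + b])))"
    by (rule wedge_coset[where N = N]) (use i in auto)
  also have "\<dots> = (\<Sum>w\<in>min_coset_reps a b. vscale ((-1) ^ perm_length (a + b) w) (?p w \<star> ?q w))"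
  proof (intro sum.cong HOL.refl)
    fix w assume w: "w \<in> min_coset_reps a b"
    have e: "map (\<lambda>k. map vb i ! w k) [0..<a] = map vb (map (\<lambda>k. i ! w k) [0..<a])"
      "map (\<lambda>k. map vb i ! w k) [a..<a + b] = map vb (map (\<lambda>k. i ! w k) [a..<a + b])"
      using i nth[OF w] by auto
    show "vscale ((-1) ^ perm_length (a + b) w) (wedge (map (\<lambda>k. map vb i ! w k) [0..<a]) \<star>
        wedge (map (\<lambda>k. map vb i ! w k) [a..<a + b])) = vscale ((-1) ^ perm_length (a + b) w) (?p w \<star> ?q w)"
      unfolding e ..
  qed
  also have "\<dots> = arrow_map (F_mult (web_functor N) [a] [b])
      (\<Sum>w\<in>min_coset_reps a b. vscale ((-1) ^ perm_length (a + b) w) (?p w \<otimes>\<^sub>v ?q w))"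
    by (rule F_mult_sum[symmetric]) (simp_all only: finite_min_coset_reps m)
  finally show "arrow_map (F_ar (web_functor N) (web_class N (Split a b))) (wedge_vb i) =
      arrow_map (F_mult (web_functor N) [a] [b])
        (\<Sum>w\<in>min_coset_reps a b. vscale ((-1) ^ perm_length (a + b) w) (?p w \<otimes>\<^sub>v ?q w))"
    using ab i wedge_vb_ext'[of i N] by (simp add: F_ar_generator wspace_single)
next
  fix a b :: nat and y z
  assume ab: "a \<ge> 1" "b \<ge> 1" and "y \<in> underlying (ext_power N a)" "z \<in> underlying (ext_power N b)"
  then have m: "y \<in> ext_space N a" "z \<in> ext_space N b" by (simp_all add: ext_power_def)
  \<comment> \<open>\<open>F_mult_sum\<close> with a one-element index set moves the sign out of the
    structure map.\<close>
  show "arrow_map (F_ar (web_functor N) (web_class N (Cross a b))) (arrow_map (F_mult (web_functor N) [a] [b]) (y \<otimes>\<^sub>v z)) =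
      arrow_map (F_mult (web_functor N) [b] [a]) (vscale ((-1) ^ (a * b)) (z \<otimes>\<^sub>v y))"
    using ab ext_star[OF m] m F_mult_sum[of "{()}" "\<lambda>_. z" N b "\<lambda>_. y" a "\<lambda>_. (-1) ^ (a * b)"]
    by (simp add: F_mult_tensor F_ar_generator cross_map_star[OF ext_tens[OF m(1)] ext_tens[OF m(2)]])
next
  fix a :: nat and i j :: "int list"
  assume a: "a \<ge> 1" and ij: "length i = a \<and> set i \<subseteq> idx N \<and> sorted_wrt (<) i \<and>
      length j = a \<and> set j \<subseteq> idx N \<and> sorted_wrt (>) j"
  then have i: "i \<in> incs N a" and j: "rev j \<in> incs N a"
    by (auto simp: incs_def sorted_wrt_rev)
  note m = wedge_vb_ext[OF i] wedge_vb_ext[OF j]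
  \<comment> \<open>The statement lists \<open>j\<close> in decreasing order, so the wedge on the
    right belongs to the increasing word \<open>rev j\<close>; it is dual to \<open>i\<close>
    exactly when the letters cancel position by position.\<close>
  have "rev j = rho i \<longleftrightarrow> j = map uminus i" by (simp add: rho_def)
  also have "\<dots> \<longleftrightarrow> (\<forall>k<a. i ! k = - (j ! k))"
    using ij by (auto simp: list_eq_iff_nth_eq)
  finally have "cap_val N a (wedge_vb i \<star> wedge_vb (rev j)) = (if \<forall>k<a. i ! k = - (j ! k) then 1 else 0)"
    using i j by (simp add: cap_val_wedge_left m(2) wedge_vb_incs incsD(1)[of _ N a])
  also have "\<dots> = (\<Prod>k<a. if i ! k = - (j ! k) then 1 else 0)"
    by (auto simp: prod_zero_iff)
  finally show "arrow_map (F_ar (web_functor N) (web_class N (Cap a)))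
      (arrow_map (F_mult (web_functor N) [a] [a]) (wedge_vb i \<otimes>\<^sub>v wedge_vb (rev j))) =
    arrow_map (F_unit (web_functor N)) (vscale (\<Prod>k<a. if i ! k = - (j ! k) then 1 else 0) unit_tensor)"
    using a ext_star[OF m]
    by (simp add: F_mult_tensor[OF m] F_ar_generator functor_simps(3) underlying_trivial cfun.span_scale cfun.span_base)
next
  fix a :: nat
  assume a: "a \<ge> 1"
  have "arrow_map (F_mult (web_functor N) [a] [a]) (\<Sum>i\<in>incs N a. vscale 1 (wedge_vb i \<otimes>\<^sub>v wedge_vb (rho i))) =
      (\<Sum>i\<in>incs N a. vscale 1 (wedge_vb i \<star> wedge_vb (rho i)))"
    by (rule F_mult_sum) (simp_all add: wedge_vb_ext)
  then have "arrow_map (F_mult (web_functor N) [a] [a]) (\<Sum>i\<in>incs N a. wedge_vb i \<otimes>\<^sub>v wedge_vb (rho i)) = cup N a"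
    by (simp add: cup_def)
  then show "arrow_map (F_ar (web_functor N) (web_class N (Cup a))) (arrow_map (F_unit (web_functor N)) unit_tensor) =
      arrow_map (F_mult (web_functor N) [a] [a])
        (\<Sum>i | length i = a \<and> set i \<subseteq> idx N \<and> sorted_wrt (<) i.
           wedge_vb i \<otimes>\<^sub>v wedge_vb (rev (map uminus i)))"
    using a unit_in_wspace
    by (simp add: F_ar_generator functor_simps(3) underlying_trivial cfun.span_base unit_tensor_simps incs_def rho_def)
qed

end
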